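(* Let $f:\mathcal W\times\Theta\times\mathcal X\to\mathbb R$ be convex-concave in $(w,\theta)$ and $L$-Lipschitz w.r.t. $\|\cdot\|$ for every $x\in\mathcal X$, and let $\mathcal Z=\mathcal W\times\Theta$ have diameter $B$ w.r.t. $\|[w,\theta]\|=\sqrt{\|w\|_w^2+\|\theta\|_\theta^2}$. Assume that $\|\cdot\|_w^2$ and $\|\cdot\|_\theta^2$ are $\frac1\kappa$-strongly convex w.r.t. $\|\cdot\|_w$ and $\|\cdot\|_\theta$ respectively. Let $n'=\frac{n}{\log_2 n}$ and let $\mathcal A_{\mathrm{emp}}$ be a subroutine satisfying $\hat\alpha$-relative accuracy for any (convex-concave) $(5L)$-Lipschitz loss function and any dataset of size $n'$. Then the algorithm $\mathcal R_{\mathrm{SSP}}$ (recursive regularization), run on $S\sim\mathcal D^n$ with $\mathcal A_{\mathrm{emp}}$ as a subroutine and $$\lambda=\frac{48}{B}\Big(\hat\alpha\kappa^2+\frac{L\kappa^{3/2}}{\sqrt{n'}}\Big),$$ satisfies $$\mathrm{Gap}_{\mathrm{SP}}(\mathcal R_{\mathrm{SSP}})=O\Big(B\hat\alpha\kappa^2\log(n)+\frac{BL\kappa^{3/2}\log^{3/2}(n)}{\sqrt n}\Big),$$ where $O(\cdot)$ hides only a universal constant.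
   Context: Setting. $\mathcal X$ is a data domain, $\mathcal D$ an unknown distribution on $\mathcal X$, $S\sim\mathcal D^n$ an i.i.d. sample. $\mathcal W\subseteq\mathbb R^{d_w}$ and $\Theta\subseteq\mathbb R^{d_\theta}$ are compact convex sets, with norms $\|\cdot\|_w$ and $\|\cdot\|_\theta$ on the respective spaces; $\mathcal Z=\mathcal W\times\Theta$, and $[w,\theta]$ denotes concatenation. "$L$-Lipschitz" means $|f(w_1,\theta_1;x)-f(w_2,\theta_2;x)|\le L\|[w_1,\theta_1]-[w_2,\theta_2]\|$ for all points and all $x$. $F_{\mathcal D}(w,\theta)=\mathbb E_{x\sim\mathcal D}[f(w,\theta;x)]$. A function $\psi$ is $\mu$-strongly convex w.r.t. a norm $\|\cdot\|$ if $\psi(z)-\psi(z')\ge\langle\nabla\psi(z'),z-z'\rangle+\frac\mu2\|z-z'\|^2$ for all $z,z'$ ($\nabla$ being an arbitrary subgradient selection). Strong SP-gap. For a randomized algorithm $\mathcal A$ with output $[\mathcal A_w(S),\mathcal A_\theta(S)]\in\mathcal W\times\Theta$, $$\mathrm{Gap}_{\mathrm{SP}}(\mathcal A)=\mathbb E_{\mathcal A,S}\Big[\max_{\theta\in\Theta}F_{\mathcal D}(\mathcal A_w(S),\theta)-\min_{w\in\mathcal W}F_{\mathcal D}(w,\mathcal A_\theta(S))\Big].$$ Relative accuracy. A (randomized) subroutine $\mathcal A_{\mathrm{emp}}$ takes as input a dataset, a loss function, an initial point in $\mathcal Z$, and a positive number (meant as a bound on the expected distance of the initial point to the empirical saddle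 point), and outputs a point of $\mathcal Z$. Given a dataset $S'\in\mathcal X^{n'}$, a loss $f'$ and an initial point $[w',\theta']$, it satisfies $\hat\alpha$-relative accuracy w.r.t. the empirical saddle point $[w^*_{S'},\theta^*_{S'}]$ of $F'_{S'}(w,\theta)=\frac1{n'}\sum_{x\in S'}f'(w,\theta;x)$ if, for all $\hat D>0$, whenever $\mathbb E\|[w',\theta']-[w^*_{S'},\theta^*_{S'}]\|\le\hat D$, the output $[\bar w,\bar\theta]$ satisfies $\mathbb E[F'_{S'}(\bar w,\theta^*_{S'})-F'_{S'}(w^*_{S'},\bar\theta)]\le\hat D\hat\alpha$. Algorithm $\mathcal R_{\mathrm{SSP}}$ (parameter $\lambda$). Let $n'=n/\log_2(n)$ and $T=\log_2\big(\frac{L}{B\lambda}\big)$ (treated as integers). Let $S_1,\dots,S_T$ be disjoint subsets of $S$, each of size $n'$. Let $[\bar w_0,\bar\theta_0]$ be any point of $\mathcal W\times\Theta$ and set $f^{(1)}(w,\theta;x)=f(w,\theta;x)+2\lambda\|w-\bar w_0\|_w^2-2\lambda\|\theta-\bar\theta_0\|_\theta^2$. For $t=1,\dots,T$: set $[\bar w_t,\bar\theta_t]=\mathcal A_{\mathrm{emp}}\big(S_t,f^{(t)},[\bar w_{t-1},\bar\theta_{t-1}],\frac{B}{2^t}\big)$ and $f^{(t+1)}(w,\theta;x)=f^{(t)}(w,\theta;x)+2^{t+1}\lambda\|w-\bar w_t\|_w^2-2^{t+1}\lambda\|\theta-\bar\theta_t\|_\theta^2$. Output $[\bar w_T,\bar\theta_T]$.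 *)

theory Defs
  imports "HOL-Probability.Probability"
begin

text \<open>
  Norms are functions on a Euclidean space because the norms on the two factors are arbitrary
  (not the Euclidean norm of the type class).
\<close>

definition is_norm :: "('a::real_vector \<Rightarrow> real) \<Rightarrow> bool" where
  "is_norm N \<longleftrightarrow>
     (\<forall>x. N x = 0 \<longleftrightarrow> x = 0) \<and>
     (\<forall>c x. N (c *\<^sub>R x) = \<bar>c\<bar> * N x) \<and>
     (\<forall>x y. N (x + y) \<le> N x + N y)"

definition pair_norm :: "('w \<Rightarrow> real) \<Rightarrow> ('t \<Rightarrow> real) \<Rightarrow> 'w \<times> 't \<Rightarrow> real" where
  "pair_norm Nw Nt z = sqrt ((Nw (fst z))\<^sup>2 + (Nt (snd z))\<^sup>2)"

definition norm_diameter :: "('a::real_vector \<Rightarrow> real) \<Rightarrow> 'a set \<Rightarrow> real" where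
  "norm_diameter N A = (SUP (z, z') \<in> A \<times> A. N (z - z'))"

text \<open>
  \<open>G\<close> is the subgradient selection; for \<open>\<mu> \<ge> 0\<close> the inequality itself makes
  \<open>G z'\<close> a subgradient of \<open>\<psi>\<close> at \<open>z'\<close>.
\<close>

definition strongly_convex ::
    "real \<Rightarrow> ('a::euclidean_space \<Rightarrow> real) \<Rightarrow> ('a \<Rightarrow> real) \<Rightarrow> bool" where
  "strongly_convex \<mu> N \<psi> \<longleftrightarrow>
     (\<exists>G. \<forall>z z'. \<psi> z - \<psi> z' \<ge> G z' \<bullet> (z - z') + \<mu> / 2 * (N (z - z'))\<^sup>2)"

type_synonym ('w, 't, 'x) loss = "'w \<Rightarrow> 't \<Rightarrow> 'x \<Rightarrow> real"

definition convex_concave ::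
    "'w::real_vector set \<Rightarrow> 't::real_vector set \<Rightarrow> 'x set \<Rightarrow> ('w, 't, 'x) loss \<Rightarrow> bool" where
  "convex_concave W \<Theta> X f \<longleftrightarrow>
     (\<forall>x\<in>X. (\<forall>\<theta>\<in>\<Theta>. convex_on W (\<lambda>w. f w \<theta> x)) \<and>
             (\<forall>w\<in>W. concave_on \<Theta> (\<lambda>\<theta>. f w \<theta> x)))"

definition lipschitz_loss ::
    "('w::real_vector \<Rightarrow> real) \<Rightarrow> ('t::real_vector \<Rightarrow> real) \<Rightarrow> 'w set \<Rightarrow> 't set \<Rightarrow> 'x set
     \<Rightarrow> real \<Rightarrow> ('w, 't, 'x) loss \<Rightarrow> bool" where
  "lipschitz_loss Nw Nt W \<Theta> X L f \<longleftrightarrow>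
     (\<forall>x\<in>X. \<forall>w1\<in>W. \<forall>w2\<in>W. \<forall>\<theta>1\<in>\<Theta>. \<forall>\<theta>2\<in>\<Theta>.
        \<bar>f w1 \<theta>1 x - f w2 \<theta>2 x\<bar> \<le> L * pair_norm Nw Nt ((w1, \<theta>1) - (w2, \<theta>2)))"

definition population_risk :: "'x measure \<Rightarrow> ('w, 't, 'x) loss \<Rightarrow> 'w \<Rightarrow> 't \<Rightarrow> real" where
  "population_risk D f w \<theta> = (\<integral>x. f w \<theta> x \<partial>D)"

text \<open>A dataset of size \<open>m\<close> over \<open>X\<close> is an element of \<open>{..<m} \<rightarrow>\<^sub>E X\<close>.\<close>

definition empirical_risk :: "nat \<Rightarrow> (nat \<Rightarrow> 'x) \<Rightarrow> ('w, 't, 'x) loss \<Rightarrow> 'w \<Rightarrow> 't \<Rightarrow> real" where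
  "empirical_risk m S f w \<theta> = (\<Sum>i<m. f w \<theta> (S i)) / real m"

definition saddle_point :: "'w set \<Rightarrow> 't set \<Rightarrow> ('w \<Rightarrow> 't \<Rightarrow> real) \<Rightarrow> 'w \<times> 't \<Rightarrow> bool" where
  "saddle_point W \<Theta> F z \<longleftrightarrow> z \<in> W \<times> \<Theta> \<and>
     (\<forall>w\<in>W. \<forall>\<theta>\<in>\<Theta>. F (fst z) \<theta> \<le> F (fst z) (snd z) \<and> F (fst z) (snd z) \<le> F w (snd z))"

text \<open>
  The measurable space of points of \<open>W \<times> \<Theta>\<close>. Laws of outputs live on it, so they are
  supported in \<open>W \<times> \<Theta>\<close>.
\<close>

definition point_space ::
    "'w::euclidean_space set \<Rightarrow> 't::euclidean_space set \<Rightarrow> ('w \<times> 't) measure" where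
  "point_space W \<Theta> = restrict_space borel (W \<times> \<Theta>)"

text \<open>
  A randomized subroutine maps a dataset, a loss, an initial point and a positive number to the
  law of its output.
\<close>

type_synonym ('w, 't, 'x) subroutine =
  "(nat \<Rightarrow> 'x) \<Rightarrow> ('w, 't, 'x) loss \<Rightarrow> 'w \<times> 't \<Rightarrow> real \<Rightarrow> ('w \<times> 't) measure"

definition randomized_subroutine ::
    "'w::euclidean_space set \<Rightarrow> 't::euclidean_space set \<Rightarrow> 'x set \<Rightarrow> nat
     \<Rightarrow> ('w, 't, 'x) subroutine \<Rightarrow> bool" where
  "randomized_subroutine W \<Theta> X m A \<longleftrightarrow>
     (\<forall>S \<in> {..<m} \<rightarrow>\<^sub>E X. \<forall>f. \<forall>d>0.
        (\<lambda>z. A S f z d) \<in> point_space W \<Theta> \<rightarrow>\<^sub>M prob_algebra (point_space W \<Theta>))"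

text \<open>
  The dataset and the loss are fixed, the initial point is random with law \<open>P\<close>. The
  expectations are over the initial point and the internal randomness of the subroutine.
  If the saddle point is not unique, the condition is imposed for each of them.
\<close>

definition relative_accuracy ::
    "('w::euclidean_space \<Rightarrow> real) \<Rightarrow> ('t::euclidean_space \<Rightarrow> real) \<Rightarrow> 'w set \<Rightarrow> 't set
     \<Rightarrow> nat \<Rightarrow> ('w, 't, 'x) subroutine \<Rightarrow> real \<Rightarrow> (nat \<Rightarrow> 'x) \<Rightarrow> ('w, 't, 'x) loss \<Rightarrow> bool" where
  "relative_accuracy Nw Nt W \<Theta> m A \<alpha> S f \<longleftrightarrow>
     (\<forall>zs. saddle_point W \<Theta> (empirical_risk m S f) zs \<longrightarrow>
       (\<forall>d>0. \<forall>P \<in> space (prob_algebra (point_space W \<Theta>)).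
          (\<integral>z. pair_norm Nw Nt (z - zs) \<partial>P) \<le> d \<longrightarrow>
          (\<integral>z. (empirical_risk m S f (fst z) (snd zs) - empirical_risk m S f (fst zs) (snd z))
             \<partial>(P \<bind> (\<lambda>z'. A S f z' d))) \<le> d * \<alpha>))"

text \<open>
  \<open>reg_loss Nw Nt lam f t h\<close> is the loss of round \<open>t\<close> when \<open>h k\<close> is the iterate of round \<open>k\<close>
  (\<open>h 0\<close> being the starting point); it depends on \<open>h 0, \<dots>, h (t - 1)\<close> only.
\<close>

primrec reg_loss ::
    "('w::euclidean_space \<Rightarrow> real) \<Rightarrow> ('t::euclidean_space \<Rightarrow> real) \<Rightarrow> real \<Rightarrow> ('w, 't, 'x) loss
     \<Rightarrow> nat \<Rightarrow> (nat \<Rightarrow> 'w \<times> 't) \<Rightarrow> ('w, 't, 'x) loss" where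
  "reg_loss Nw Nt lam f 0 h = f"
| "reg_loss Nw Nt lam f (Suc t) h = (\<lambda>w \<theta> x.
     reg_loss Nw Nt lam f t h w \<theta> x
       + 2 ^ (t + 1) * lam * (Nw (w - fst (h t)))\<^sup>2
       - 2 ^ (t + 1) * lam * (Nt (\<theta> - snd (h t)))\<^sup>2)"

text \<open>
  Joint law of the iterates of rounds \<open>0, \<dots>, t\<close> on the sample \<open>S\<close>. The subsets of \<open>S\<close> are given
  by indices: the \<open>i\<close>-th point used in round \<open>t\<close> is \<open>S (idx t i)\<close>.
\<close>

primrec ssp_history ::
    "('w::euclidean_space \<Rightarrow> real) \<Rightarrow> ('t::euclidean_space \<Rightarrow> real) \<Rightarrow> 'w set \<Rightarrow> 't set
     \<Rightarrow> real \<Rightarrow> real \<Rightarrow> nat \<Rightarrow> (nat \<Rightarrow> nat \<Rightarrow> nat) \<Rightarrow> ('w, 't, 'x) subroutine \<Rightarrow> 'w \<times> 't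
     \<Rightarrow> ('w, 't, 'x) loss \<Rightarrow> nat \<Rightarrow> (nat \<Rightarrow> 'x) \<Rightarrow> (nat \<Rightarrow> 'w \<times> 't) measure" where
  "ssp_history Nw Nt W \<Theta> B lam m idx A z0 f 0 S =
     return (Pi\<^sub>M {..0} (\<lambda>_. point_space W \<Theta>)) (\<lambda>k\<in>{..0}. z0)"
| "ssp_history Nw Nt W \<Theta> B lam m idx A z0 f (Suc t) S = do {
     h \<leftarrow> ssp_history Nw Nt W \<Theta> B lam m idx A z0 f t S;
     z \<leftarrow> A (\<lambda>i\<in>{..<m}. S (idx (Suc t) i)) (reg_loss Nw Nt lam f (Suc t) h) (h t) (B / 2 ^ Suc t);
     return (Pi\<^sub>M {..Suc t} (\<lambda>_. point_space W \<Theta>)) (h(Suc t := z))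
   }"

definition R_SSP ::
    "('w::euclidean_space \<Rightarrow> real) \<Rightarrow> ('t::euclidean_space \<Rightarrow> real) \<Rightarrow> 'w set \<Rightarrow> 't set
     \<Rightarrow> real \<Rightarrow> real \<Rightarrow> nat \<Rightarrow> nat \<Rightarrow> (nat \<Rightarrow> nat \<Rightarrow> nat) \<Rightarrow> ('w, 't, 'x) subroutine \<Rightarrow> 'w \<times> 't
     \<Rightarrow> ('w, 't, 'x) loss \<Rightarrow> (nat \<Rightarrow> 'x) \<Rightarrow> ('w \<times> 't) measure" where
  "R_SSP Nw Nt W \<Theta> B lam m T idx A z0 f S = do {
     h \<leftarrow> ssp_history Nw Nt W \<Theta> B lam m idx A z0 f T S;
     return (point_space W \<Theta>) (h T)
   }"

text \<open>
  The losses passed to the subroutine depend on earlier random outputs. The output of each round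
  has to depend measurably on its dataset and on the earlier iterates for the composition of the
  rounds to have a law.
\<close>

definition measurable_rounds ::
    "('w::euclidean_space \<Rightarrow> real) \<Rightarrow> ('t::euclidean_space \<Rightarrow> real) \<Rightarrow> 'w set \<Rightarrow> 't set
     \<Rightarrow> 'x measure \<Rightarrow> real \<Rightarrow> real \<Rightarrow> nat \<Rightarrow> nat \<Rightarrow> ('w, 't, 'x) subroutine
     \<Rightarrow> ('w, 't, 'x) loss \<Rightarrow> bool" where
  "measurable_rounds Nw Nt W \<Theta> D B lam m T A f \<longleftrightarrow>
     (\<forall>t<T. (\<lambda>(S, h). A S (reg_loss Nw Nt lam f (Suc t) h) (h t) (B / 2 ^ Suc t))
        \<in> Pi\<^sub>M {..<m} (\<lambda>_. D) \<Otimes>\<^sub>M Pi\<^sub>M {..t} (\<lambda>_. point_space W \<Theta>)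
           \<rightarrow>\<^sub>M prob_algebra (point_space W \<Theta>))"

text \<open>
  Strong gap of a randomized algorithm, given as a map from samples to laws of outputs.
\<close>

definition Gap_SP ::
    "'w set \<Rightarrow> 't set \<Rightarrow> 'x measure \<Rightarrow> nat \<Rightarrow> ('w, 't, 'x) loss
     \<Rightarrow> ((nat \<Rightarrow> 'x) \<Rightarrow> ('w \<times> 't) measure) \<Rightarrow> real" where
  "Gap_SP W \<Theta> D n f A =
     (\<integral>z. (SUP \<theta>\<in>\<Theta>. population_risk D f (fst z) \<theta>) - (INF w\<in>W. population_risk D f w (snd z))
        \<partial>(Pi\<^sub>M {..<n} (\<lambda>_. D) \<bind> A))"

end

(*
  Let b = B / 2^t. In round t the regularizer makes the objective strongly convex-concave with
  modulus mu >= 2^t lam / kappa, so it has a unique saddle point, both for the empirical and for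
  the population risk. Replacing one sample point moves the empirical saddle point by at most
  2L / (mu n'), hence it generalizes and lies within b / 12 of the population saddle point in
  expectation. Relative accuracy and strong convexity put the output of the subroutine close to
  the empirical saddle point. Adding the next regularizer, centred at the iterate, does not
  increase the distance between the iterate and the population saddle point, so by induction the
  iterate of round t is within b of the population saddle point of round t in expectation.

  The final population saddle point zs is a saddle point of risk plus regularizer. First-order
  optimality bounds the strong gap of the unregularized risk at zs by
  2B sum_k 2^(k+1) lam |zs - z_k|, and each of the T summands is O(lam B).

  The rounds use disjoint parts of the sample, so the law of the iterates is the same as with a
  fresh sample in every round; this makes the conditioning on earlier rounds rigorous.
*)
theory Submission
  imports Defs
begin

section \<open>Norms and strong convexity\<close>

text \<open>Relative accuracy speaks about one fixed dataset, whereas the inductive distance bound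
  holds only on average over datasets and earlier rounds. Hence the guarantee is made linear in the
  actual distance of a deterministic start: a linear bound can be averaged, first over the dataset
  and then over the history. Quadratic growth controls squared distances; at scale b they become
  first powers through N <= N^2 / (2 b) + b / 2.

  One \<open>lam\<close> serves all rounds because the modulus grows like 2^t while the target
  radius shrinks like 2^-t, so that their product stays at least lam B / \<kappa>. The factor 48
  leaves room for the recursion E r' <= (b + E r) / 24 + 3 b / 4, which maps E r = 2 b to 7 b / 8.
  Strong convexity of the squared norms forces \<kappa> >= 1/2, so the powers of \<kappa> in
  \<open>lam\<close> dominate those met in the estimates.

  Rounding the number of rounds is used from both sides: 2^T lam B <= L keeps the regularized losses
  5L-Lipschitz when T is positive, and L <= 2^(T+1) lam B makes the last transfer, from the saddle
  point to the iterate, cost O(lam B^2).\<close>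

lemma is_norm_eq_0_iff: "is_norm N \<Longrightarrow> N x = 0 \<longleftrightarrow> x = 0"
  by (simp add: is_norm_def)

lemma is_norm_scaleR: "is_norm N \<Longrightarrow> N (c *\<^sub>R x) = \<bar>c\<bar> * N x"
  by (simp add: is_norm_def)

lemma is_norm_triangle: "is_norm N \<Longrightarrow> N (x + y) \<le> N x + N y"
  by (simp add: is_norm_def)

lemma is_norm_minus: "is_norm N \<Longrightarrow> N (- x) = N x"
  using is_norm_scaleR[of N "-1" x] by simp

lemma is_norm_diff_commute: "is_norm N \<Longrightarrow> N (x - y) = N (y - x)"
  using is_norm_minus[of N "x - y"] by simp

lemma is_norm_nonneg: "is_norm N \<Longrightarrow> 0 \<le> N x"
  using is_norm_triangle[of N x "- x"] is_norm_eq_0_iff[of N 0] is_norm_minus[of N x] by simp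

lemma is_norm_dist_triangle: "is_norm N \<Longrightarrow> N (x - z) \<le> N (x - y) + N (y - z)"
  using is_norm_triangle[of N "x - y" "y - z"] by simp

lemma is_norm_dist_diff_le: "is_norm N \<Longrightarrow> \<bar>N (x - z) - N (y - z)\<bar> \<le> N (x - y)"
  using is_norm_dist_triangle[of N x z y] is_norm_dist_triangle[of N y z x] is_norm_diff_commute[of N x y]
  by simp

text \<open>The squared triangle inequality is a first-order expansion of the squared norm along a
  direction. It stands in for a derivative, which an arbitrary norm need not have; the term
  quadratic in \<open>s\<close> disappears once the inequality is divided by \<open>s\<close> and
  \<open>s\<close> tends to 0.\<close>

lemma is_norm_power2_add_le:
  assumes "is_norm N" "0 \<le> s"
  shows "(N (x + s *\<^sub>R y))\<^sup>2 - (N x)\<^sup>2 \<le> 2 * s * (N x * N y) + s\<^sup>2 * (N y)\<^sup>2"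
proof -
  have "(N (x + s *\<^sub>R y))\<^sup>2 \<le> (N x + s * N y)\<^sup>2"
    using is_norm_triangle[OF assms(1), of x "s *\<^sub>R y"] assms
    by (intro power_mono is_norm_nonneg) (simp_all add: is_norm_scaleR)
  then show ?thesis by (simp add: power2_eq_square algebra_simps)
qed

lemma convex_on_is_norm:
  assumes "is_norm N"
  shows "convex_on UNIV N"
proof (rule convex_onI)
  fix t x y assume "0 < (t::real)" "t < 1"
  then show "N ((1 - t) *\<^sub>R x + t *\<^sub>R y) \<le> (1 - t) * N x + t * N y"
    using is_norm_triangle[OF assms, of "(1 - t) *\<^sub>R x" "t *\<^sub>R y"] by (simp add: is_norm_scaleR[OF assms])
qed simp

lemma continuous_on_is_norm:
  fixes N :: "'a::euclidean_space \<Rightarrow> real"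
  assumes "is_norm N"
  shows "continuous_on S N"
  using convex_on_continuous[OF open_UNIV convex_on_is_norm[OF assms]] continuous_on_subset by blast

text \<open>The constant is the minimum of \<open>N\<close> on the Euclidean unit sphere, positive
  because \<open>N\<close> vanishes only at 0. It turns estimates in \<open>N\<close> into
  topological convergence.\<close>

lemma is_norm_ge_norm:
  fixes N :: "'a::euclidean_space \<Rightarrow> real"
  assumes N: "is_norm N"
  obtains c where "0 < c" "\<And>x. c * norm x \<le> N x"
proof -
  have ne: "sphere (0::'a) 1 \<noteq> {}" by simp
  obtain u where u: "u \<in> sphere 0 1" "\<And>x. x \<in> sphere 0 1 \<Longrightarrow> N u \<le> N x"
    using continuous_attains_inf[OF compact_sphere ne continuous_on_is_norm[OF N]] by blast
  have "0 < N u"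
    using u(1) is_norm_nonneg[OF N, of u] is_norm_eq_0_iff[OF N, of u] by (cases "u = 0") auto
  moreover have "N u * norm x \<le> N x" for x
  proof (cases "x = 0")
    case False
    have "N u \<le> N ((1 / norm x) *\<^sub>R x)" using False by (intro u(2)) simp
    then show ?thesis using False by (simp add: is_norm_scaleR[OF N] field_simps)
  qed (use is_norm_eq_0_iff[OF N, of 0] in simp)
  ultimately show thesis using that by blast
qed

lemma is_norm_pair_norm:
  assumes Nw: "is_norm Nw" and Nt: "is_norm Nt"
  shows "is_norm (pair_norm Nw Nt)"
  unfolding is_norm_def
proof (intro conjI allI)
  fix z :: "'a \<times> 'b"
  show "pair_norm Nw Nt z = 0 \<longleftrightarrow> z = 0"
    by (auto simp: pair_norm_def sum_power2_eq_zero_iff is_norm_eq_0_iff[OF Nw] is_norm_eq_0_iff[OF Nt] prod_eq_iff)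
next
  fix c and z :: "'a \<times> 'b"
  have "(Nw (fst (c *\<^sub>R z)))\<^sup>2 + (Nt (snd (c *\<^sub>R z)))\<^sup>2 = c\<^sup>2 * ((Nw (fst z))\<^sup>2 + (Nt (snd z))\<^sup>2)"
    by (simp add: is_norm_scaleR[OF Nw] is_norm_scaleR[OF Nt] power_mult_distrib algebra_simps)
  then show "pair_norm Nw Nt (c *\<^sub>R z) = \<bar>c\<bar> * pair_norm Nw Nt z"
    by (simp add: pair_norm_def real_sqrt_mult)
next
  fix z z' :: "'a \<times> 'b"
  have "pair_norm Nw Nt (z + z') \<le> sqrt ((Nw (fst z) + Nw (fst z'))\<^sup>2 + (Nt (snd z) + Nt (snd z'))\<^sup>2)"
    unfolding pair_norm_def fst_add snd_add
    by (intro real_sqrt_le_mono add_mono power_mono is_norm_triangle is_norm_nonneg Nw Nt)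
  also have "\<dots> \<le> pair_norm Nw Nt z + pair_norm Nw Nt z'"
    unfolding pair_norm_def by (rule real_sqrt_sum_squares_triangle_ineq)
  finally show "pair_norm Nw Nt (z + z') \<le> pair_norm Nw Nt z + pair_norm Nw Nt z'" .
qed

lemma pair_norm_power2: "(pair_norm Nw Nt z)\<^sup>2 = (Nw (fst z))\<^sup>2 + (Nt (snd z))\<^sup>2"
  by (simp add: pair_norm_def)

lemma pair_norm_Cauchy_Schwarz:
  "Nw (fst a) * Nw (fst b) + Nt (snd a) * Nt (snd b) \<le> pair_norm Nw Nt a * pair_norm Nw Nt b"
  unfolding pair_norm_def real_sqrt_mult[symmetric]
proof (rule real_le_rsqrt)
  have *: "(p * q + r * s)\<^sup>2 \<le> (p\<^sup>2 + r\<^sup>2) * (q\<^sup>2 + s\<^sup>2)" for p q r s :: real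
    using zero_le_power2[of "p * s - q * r"] by (simp add: power2_eq_square algebra_simps)
  show "(Nw (fst a) * Nw (fst b) + Nt (snd a) * Nt (snd b))\<^sup>2
      \<le> ((Nw (fst a))\<^sup>2 + (Nt (snd a))\<^sup>2) * ((Nw (fst b))\<^sup>2 + (Nt (snd b))\<^sup>2)"
    by (rule *)
qed

text \<open>Segment form instead of subgradients: the losses are convex only on \<open>W\<close> and
  \<open>\<Theta>\<close>, and in this form strong convexity restricts to subsets and adds up with
  no subgradient calculus. Modulus 0 covers plain convexity.\<close>

definition strongly_convex_on ::
    "'a::real_vector set \<Rightarrow> ('a \<Rightarrow> real) \<Rightarrow> real \<Rightarrow> ('a \<Rightarrow> real) \<Rightarrow> bool" where
  "strongly_convex_on S N \<mu> g \<longleftrightarrow>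
     (\<forall>x\<in>S. \<forall>y\<in>S. \<forall>s\<in>{0..1}. g ((1 - s) *\<^sub>R x + s *\<^sub>R y)
        \<le> (1 - s) * g x + s * g y - \<mu> / 2 * s * (1 - s) * (N (x - y))\<^sup>2)"

text \<open>The subgradient inequality is used from the intermediate point towards both endpoints.
  Weighted with \<open>1 - s\<close> and \<open>s\<close>, the linear terms cancel and the quadratic
  ones combine to the factor \<open>s * (1 - s)\<close>.\<close>

lemma strongly_convex_imp_strongly_convex_on:
  assumes N: "is_norm N" and sc: "strongly_convex \<mu> N \<psi>"
  shows "strongly_convex_on UNIV N \<mu> \<psi>"
  unfolding strongly_convex_on_def
proof (intro ballI)
  fix x y :: 'a and s :: real assume s: "s \<in> {0..1}"
  obtain G where G: "\<And>z z'. \<psi> z - \<psi> z' \<ge> G z' \<bullet> (z - z') + \<mu> / 2 * (N (z - z'))\<^sup>2"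
    using sc unfolding strongly_convex_def by blast
  define p where "p = (1 - s) *\<^sub>R x + s *\<^sub>R y"
  have xp: "x - p = s *\<^sub>R (x - y)" and yp: "y - p = - ((1 - s) *\<^sub>R (x - y))"
    by (simp_all add: p_def algebra_simps)
  have Nx: "N (x - p) = s * N (x - y)" and Ny: "N (y - p) = (1 - s) * N (x - y)"
    using s by (simp_all only: xp yp is_norm_minus[OF N] is_norm_scaleR[OF N]) auto
  define g where "g = G p \<bullet> (x - y)"
  define d where "d = N (x - y)"
  have 1: "\<psi> x - \<psi> p \<ge> s * g + \<mu> / 2 * (s * d)\<^sup>2"
    using G[of p x] by (simp add: xp[symmetric] Nx d_def g_def) (simp add: xp)
  have 2: "\<psi> y - \<psi> p \<ge> - ((1 - s) * g) + \<mu> / 2 * ((1 - s) * d)\<^sup>2"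
    using G[of p y] unfolding Ny unfolding yp d_def g_def by (simp only: inner_minus_right inner_scaleR_right)
  have "(1 - s) * (s * g + \<mu> / 2 * (s * d)\<^sup>2) + s * (- ((1 - s) * g) + \<mu> / 2 * ((1 - s) * d)\<^sup>2)
      \<le> (1 - s) * (\<psi> x - \<psi> p) + s * (\<psi> y - \<psi> p)"
    using s 1 2 by (intro add_mono mult_left_mono) auto
  moreover have "(1 - s) * (s * g + \<mu> / 2 * (s * d)\<^sup>2) + s * (- ((1 - s) * g) + \<mu> / 2 * ((1 - s) * d)\<^sup>2)
      = \<mu> / 2 * s * (1 - s) * d\<^sup>2"
    by (simp add: power2_eq_square algebra_simps add_divide_distrib diff_divide_distrib)
  moreover have "(1 - s) * (\<psi> x - \<psi> p) + s * (\<psi> y - \<psi> p) = (1 - s) * \<psi> x + s * \<psi> y - \<psi> p"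
    by (simp add: algebra_simps)
  ultimately show "\<psi> ((1 - s) *\<^sub>R x + s *\<^sub>R y)
        \<le> (1 - s) * \<psi> x + s * \<psi> y - \<mu> / 2 * s * (1 - s) * (N (x - y))\<^sup>2"
    unfolding p_def[symmetric] d_def[symmetric] by linarith
qed

text \<open>Strong convexity is tested on the segment from \<open>u\<close> to \<open>- u\<close>,
  at its midpoint 0, where the squared norm vanishes. As \<open>N (2 *\<^sub>R u)\<close> is twice
  \<open>N u\<close>, this leaves \<open>1 / (2 * \<kappa>) \<le> 1\<close>. Later the bound lets a
  higher power of \<open>\<kappa>\<close> absorb a lower one.\<close>

lemma strongly_convex_kappa_ge_half:
  fixes N :: "'a::euclidean_space \<Rightarrow> real"
  assumes N: "is_norm N" and sc: "strongly_convex (1 / \<kappa>) N (\<lambda>w. (N w)\<^sup>2)" and "0 < \<kappa>"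
  shows "1 / 2 \<le> \<kappa>"
proof -
  obtain u :: 'a where "u \<noteq> 0" using nonempty_Basis nonzero_Basis by blast
  then have "0 < N u" using is_norm_nonneg[OF N, of u] is_norm_eq_0_iff[OF N, of u] by simp
  have "strongly_convex_on UNIV N (1 / \<kappa>) (\<lambda>w. (N w)\<^sup>2)"
    by (rule strongly_convex_imp_strongly_convex_on[OF N sc])
  from this[unfolded strongly_convex_on_def, rule_format, of u "- u" "1 / 2"]
  moreover have "N 0 = 0" using is_norm_eq_0_iff[OF N, of 0] by simp
  ultimately have "0 \<le> (N u)\<^sup>2 - 1 / \<kappa> / 8 * (N (2 *\<^sub>R u))\<^sup>2"
    by (simp add: is_norm_minus[OF N] scaleR_2 field_simps)
  then have "(N u)\<^sup>2 / (2 * \<kappa>) \<le> (N u)\<^sup>2"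
    by (simp add: is_norm_scaleR[OF N] power_mult_distrib)
  then show ?thesis using \<open>0 < N u\<close> \<open>0 < \<kappa>\<close> by (simp add: field_simps)
qed

lemma strongly_convex_on_subset:
  "strongly_convex_on S N \<mu> g \<Longrightarrow> T \<subseteq> S \<Longrightarrow> strongly_convex_on T N \<mu> g"
  unfolding strongly_convex_on_def by blast

lemma strongly_convex_on_translation:
  "strongly_convex_on UNIV N \<mu> g \<Longrightarrow> strongly_convex_on UNIV N \<mu> (\<lambda>x. g (x - u))"
  unfolding strongly_convex_on_def
proof (intro ballI)
  fix x y :: 'a and s :: real
  assume *: "\<forall>x\<in>UNIV. \<forall>y\<in>UNIV. \<forall>s\<in>{0..1}. g ((1 - s) *\<^sub>R x + s *\<^sub>R y)
        \<le> (1 - s) * g x + s * g y - \<mu> / 2 * s * (1 - s) * (N (x - y))\<^sup>2" and s: "s \<in> {0..1}"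
  have "(1 - s) *\<^sub>R (x - u) + s *\<^sub>R (y - u) = (1 - s) *\<^sub>R x + s *\<^sub>R y - u"
    by (simp add: algebra_simps)
  then show "g ((1 - s) *\<^sub>R x + s *\<^sub>R y - u)
      \<le> (1 - s) * g (x - u) + s * g (y - u) - \<mu> / 2 * s * (1 - s) * (N (x - y))\<^sup>2"
    using *[rule_format, of "x - u" "y - u" s] s by simp
qed

lemma strongly_convex_on_add:
  "strongly_convex_on S N \<mu> g \<Longrightarrow> strongly_convex_on S N \<nu> h
   \<Longrightarrow> strongly_convex_on S N (\<mu> + \<nu>) (\<lambda>x. g x + h x)"
  unfolding strongly_convex_on_def
proof (intro ballI, elim ballE)
  fix x y :: 'a and s :: real
  assume "g ((1 - s) *\<^sub>R x + s *\<^sub>R y) \<le> (1 - s) * g x + s * g y - \<mu> / 2 * s * (1 - s) * (N (x - y))\<^sup>2"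
    and "h ((1 - s) *\<^sub>R x + s *\<^sub>R y) \<le> (1 - s) * h x + s * h y - \<nu> / 2 * s * (1 - s) * (N (x - y))\<^sup>2"
  then show "g ((1 - s) *\<^sub>R x + s *\<^sub>R y) + h ((1 - s) *\<^sub>R x + s *\<^sub>R y)
      \<le> (1 - s) * (g x + h x) + s * (g y + h y) - (\<mu> + \<nu>) / 2 * s * (1 - s) * (N (x - y))\<^sup>2"
    by (simp add: algebra_simps add_divide_distrib)
qed auto

lemma strongly_convex_on_scale:
  assumes "strongly_convex_on S N \<mu> g" "0 \<le> c"
  shows "strongly_convex_on S N (c * \<mu>) (\<lambda>x. c * g x)"
  unfolding strongly_convex_on_def
proof (intro ballI)
  fix x y :: 'a and s :: real assume "x \<in> S" "y \<in> S" "s \<in> {0..1}"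
  then have "c * g ((1 - s) *\<^sub>R x + s *\<^sub>R y)
      \<le> c * ((1 - s) * g x + s * g y - \<mu> / 2 * s * (1 - s) * (N (x - y))\<^sup>2)"
    using assms unfolding strongly_convex_on_def by (intro mult_left_mono) auto
  then show "c * g ((1 - s) *\<^sub>R x + s *\<^sub>R y)
      \<le> (1 - s) * (c * g x) + s * (c * g y) - (c * \<mu>) / 2 * s * (1 - s) * (N (x - y))\<^sup>2"
    by (simp add: algebra_simps)
qed

lemma convex_on_imp_strongly_convex_on:
  "convex_on S g \<Longrightarrow> strongly_convex_on S N 0 g"
  unfolding strongly_convex_on_def by (auto intro: convex_onD)

lemma strongly_convex_on_imp_convex_on:
  assumes "strongly_convex_on S N \<mu> g" "0 \<le> \<mu>" "convex S"
  shows "convex_on S g"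
proof (rule convex_onI[OF _ assms(3)])
  fix t x y assume t: "0 < (t::real)" "t < 1" and xy: "x \<in> S" "y \<in> S"
  have "g ((1 - t) *\<^sub>R x + t *\<^sub>R y) \<le> (1 - t) * g x + t * g y - \<mu> / 2 * t * (1 - t) * (N (x - y))\<^sup>2"
    using assms(1) t xy unfolding strongly_convex_on_def by auto
  moreover have "0 \<le> \<mu> / 2 * t * (1 - t) * (N (x - y))\<^sup>2" using assms(2) t by simp
  ultimately show "g ((1 - t) *\<^sub>R x + t *\<^sub>R y) \<le> (1 - t) * g x + t * g y" by linarith
qed

lemma strongly_convex_on_sum:
  assumes "finite I" "\<And>i. i \<in> I \<Longrightarrow> strongly_convex_on S N (\<mu> i) (g i)"
  shows "strongly_convex_on S N (\<Sum>i\<in>I. \<mu> i) (\<lambda>x. \<Sum>i\<in>I. g i x)"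
  using assms
proof (induction I rule: finite_induct)
  case empty
  then show ?case by (simp add: strongly_convex_on_def)
next
  case (insert i I)
  then show ?case by (simp add: strongly_convex_on_add)
qed

text \<open>Strong convexity compares \<open>x\<close> with a point of the segment towards
  \<open>y\<close>, and minimality of \<open>x\<close> removes the value at that point. After
  division by \<open>s\<close> the quadratic term carries the factor \<open>r = 1 - s\<close>, which
  may be taken arbitrarily close to 1.\<close>

lemma strongly_convex_on_minimum_growth:
  assumes "convex S" and sc: "strongly_convex_on S N \<mu> g" and x: "x \<in> S" and min: "\<And>y. y \<in> S \<Longrightarrow> g x \<le> g y"
    and y: "y \<in> S"
  shows "\<mu> / 2 * (N (x - y))\<^sup>2 \<le> g y - g x"
proof (rule field_le_mult_one_interval)
  fix r :: real assume r: "0 < r" "r < 1"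
  define s where "s = 1 - r"
  have s: "0 < s" "s < 1" "r = 1 - s" using r by (auto simp: s_def)
  have "g x \<le> g ((1 - s) *\<^sub>R x + s *\<^sub>R y)"
    using s x y by (intro min convexD[OF \<open>convex S\<close>]) auto
  also have "\<dots> \<le> (1 - s) * g x + s * g y - \<mu> / 2 * s * (1 - s) * (N (x - y))\<^sup>2"
    using sc s x y unfolding strongly_convex_on_def by auto
  finally have "s * (r * (\<mu> / 2 * (N (x - y))\<^sup>2)) \<le> s * (g y - g x)"
    unfolding s(3) by (simp add: algebra_simps)
  then show "r * (\<mu> / 2 * (N (x - y))\<^sup>2) \<le> g y - g x"
    using s(1) by (simp only: mult_le_cancel_left_pos)
qed

text \<open>Growth of \<open>G p\<close> at its minimizer bounds the squared distance of two
  minimizers by a difference of values, and changing the parameter twice costs at most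
  \<open>2 * K * M (p - p')\<close>. So the minimizer is Hoelder continuous of order 1/2 in the
  parameter, enough for a fixed point argument.\<close>

lemma strongly_convex_on_argmin_continuous:
  fixes S :: "'a::euclidean_space set" and P :: "'b::euclidean_space set"
  assumes S: "compact S" "convex S" "S \<noteq> {}" and N: "is_norm N" and M: "is_norm M" and \<mu>: "0 < \<mu>"
    and sc: "\<And>p. p \<in> P \<Longrightarrow> strongly_convex_on S N \<mu> (G p)"
    and cont: "\<And>p. p \<in> P \<Longrightarrow> continuous_on S (G p)"
    and lip: "\<And>p p' x. p \<in> P \<Longrightarrow> p' \<in> P \<Longrightarrow> x \<in> S \<Longrightarrow> \<bar>G p x - G p' x\<bar> \<le> K * M (p - p')"
  obtains b where "continuous_on P b" "\<And>p. p \<in> P \<Longrightarrow> b p \<in> S"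
    "\<And>p x. p \<in> P \<Longrightarrow> x \<in> S \<Longrightarrow> G p (b p) \<le> G p x"
proof -
  have "\<exists>x. x \<in> S \<and> (\<forall>y\<in>S. G p x \<le> G p y)" if "p \<in> P" for p
    using continuous_attains_inf[OF S(1,3) cont[OF that]] by blast
  then obtain b where b: "\<And>p. p \<in> P \<Longrightarrow> b p \<in> S" "\<And>p x. p \<in> P \<Longrightarrow> x \<in> S \<Longrightarrow> G p (b p) \<le> G p x"
    by metis
  obtain c where c: "0 < c" "\<And>x. c * norm x \<le> N x"
    using is_norm_ge_norm[OF N] by metis
  have bound: "(dist (b p') (b p))\<^sup>2 \<le> 4 * K / (\<mu> * c\<^sup>2) * M (p' - p)" if p: "p \<in> P" "p' \<in> P" for p p'
  proof -
    have "\<mu> / 2 * (N (b p - b p'))\<^sup>2 \<le> G p (b p') - G p (b p)"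
      using p b by (intro strongly_convex_on_minimum_growth[OF S(2) sc]) auto
    also have "\<dots> \<le> 2 * (K * M (p' - p))"
      using lip[of p p' "b p'"] lip[of p p' "b p"] b(2)[of p' "b p"] b(1) p
        is_norm_diff_commute[OF M, of p p'] by simp
    finally have "\<mu> / 2 * (N (b p - b p'))\<^sup>2 \<le> 2 * (K * M (p' - p))" .
    moreover have "\<mu> / 2 * (c * dist (b p') (b p))\<^sup>2 \<le> \<mu> / 2 * (N (b p - b p'))\<^sup>2"
      using c(1) c(2)[of "b p - b p'"] \<mu>
      by (intro mult_left_mono power_mono) (auto simp: dist_norm norm_minus_commute)
    ultimately have "\<mu> / 2 * (c * dist (b p') (b p))\<^sup>2 \<le> 2 * (K * M (p' - p))"
      by linarith
    then show ?thesis
      using \<mu> c(1) by (simp add: field_simps)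
  qed
  have "continuous_on P b"
    unfolding continuous_on_def
  proof
    fix p assume p: "p \<in> P"
    have "((\<lambda>p'. M (p' - p)) \<longlongrightarrow> M (p - p)) (at p within P)"
      using continuous_on_is_norm[OF M, of UNIV]
      by (intro continuous_on_tendsto_compose[where f = M and s = UNIV] tendsto_intros) auto
    then have "((\<lambda>p'. 4 * K / (\<mu> * c\<^sup>2) * M (p' - p)) \<longlongrightarrow> 4 * K / (\<mu> * c\<^sup>2) * 0) (at p within P)"
      using is_norm_eq_0_iff[OF M, of 0] by (intro tendsto_mult tendsto_const) simp
    then have "((\<lambda>p'. (dist (b p') (b p))\<^sup>2) \<longlongrightarrow> 0) (at p within P)"
      using bound[OF p]
      by - (rule tendsto_sandwich[where f = "\<lambda>_. 0" and h = "\<lambda>p'. 4 * K / (\<mu> * c\<^sup>2) * M (p' - p)"], auto simp: eventually_at_filter)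
    from tendsto_real_sqrt[OF this] have "((\<lambda>p'. dist (b p') (b p)) \<longlongrightarrow> 0) (at p within P)"
      by simp
    then show "(b \<longlongrightarrow> b p) (at p within P)"
      using tendsto_dist_iff by blast
  qed
  then show thesis using that b by blast
qed

section \<open>Saddle points\<close>

locale saddle_domain =
  fixes W :: "'w::euclidean_space set" and \<Theta> :: "'t::euclidean_space set"
    and Nw :: "'w \<Rightarrow> real" and Nt :: "'t \<Rightarrow> real"
  assumes compact_W: "compact W" and convex_W: "convex W" and W_ne: "W \<noteq> {}"
    and compact_Th: "compact \<Theta>" and convex_Th: "convex \<Theta>" and Th_ne: "\<Theta> \<noteq> {}"
    and Nw: "is_norm Nw" and Nt: "is_norm Nt"
begin

abbreviation Nz :: "'w \<times> 't \<Rightarrow> real" where "Nz \<equiv> pair_norm Nw Nt"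

lemma Nz: "is_norm Nz"
  by (rule is_norm_pair_norm[OF Nw Nt])

lemma Nz_eq_Nw: "Nz (w, 0) = Nw w" and Nz_eq_Nt: "Nz (0, \<theta>) = Nt \<theta>"
  using is_norm_eq_0_iff[OF Nw, of 0] is_norm_eq_0_iff[OF Nt, of 0] is_norm_nonneg[OF Nw] is_norm_nonneg[OF Nt]
  by (simp_all add: pair_norm_def)

lemma Nw_le_Nz: "Nw (fst z) \<le> Nz z" and Nt_le_Nz: "Nt (snd z) \<le> Nz z"
  using is_norm_nonneg[OF Nw] is_norm_nonneg[OF Nt] by (simp_all add: pair_norm_def real_le_rsqrt)

lemma measurable_Nz: "Nz \<in> borel_measurable borel"
  by (intro borel_measurable_continuous_onI continuous_on_is_norm Nz)

lemma compact_Z: "compact (W \<times> \<Theta>)"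
  by (rule compact_Times[OF compact_W compact_Th])

text \<open>\<open>norm_diameter\<close> is a supremum of reals and bounds the distances only if
  these are bounded above; compactness of the domain provides this.\<close>

lemma bdd_above_Nz_diff: "bdd_above ((\<lambda>(z, z'). Nz (z - z')) ` ((W \<times> \<Theta>) \<times> (W \<times> \<Theta>)))"
proof -
  have "continuous_on ((W \<times> \<Theta>) \<times> (W \<times> \<Theta>)) (\<lambda>(z, z'). Nz (z - z'))"
    unfolding case_prod_beta
    by (intro continuous_on_compose2[OF continuous_on_is_norm[OF Nz, of UNIV]] continuous_intros) auto
  then show ?thesis
    by (intro bounded_imp_bdd_above compact_imp_bounded compact_continuous_image compact_Times compact_Z)
qed

lemma Nz_diff_le_diameter:
  assumes "z \<in> W \<times> \<Theta>" "z' \<in> W \<times> \<Theta>"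
  shows "Nz (z - z') \<le> norm_diameter Nz (W \<times> \<Theta>)"
proof -
  have "(\<lambda>(z, z'). Nz (z - z')) (z, z') \<le> norm_diameter Nz (W \<times> \<Theta>)"
    unfolding norm_diameter_def using assms by (intro cSUP_upper bdd_above_Nz_diff) simp
  then show ?thesis by simp
qed

definition lipschitz_fun :: "real \<Rightarrow> ('w \<Rightarrow> 't \<Rightarrow> real) \<Rightarrow> bool" where
  "lipschitz_fun K F \<longleftrightarrow> (\<forall>w1\<in>W. \<forall>w2\<in>W. \<forall>\<theta>1\<in>\<Theta>. \<forall>\<theta>2\<in>\<Theta>.
     \<bar>F w1 \<theta>1 - F w2 \<theta>2\<bar> \<le> K * Nz ((w1, \<theta>1) - (w2, \<theta>2)))"

definition sc_sc :: "real \<Rightarrow> ('w \<Rightarrow> 't \<Rightarrow> real) \<Rightarrow> bool" where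
  "sc_sc \<mu> F \<longleftrightarrow> (\<forall>\<theta>\<in>\<Theta>. strongly_convex_on W Nw \<mu> (\<lambda>w. F w \<theta>)) \<and>
     (\<forall>w\<in>W. strongly_convex_on \<Theta> Nt \<mu> (\<lambda>\<theta>. - F w \<theta>))"

lemma lipschitz_funD:
  "lipschitz_fun K F \<Longrightarrow> w1 \<in> W \<Longrightarrow> w2 \<in> W \<Longrightarrow> \<theta>1 \<in> \<Theta> \<Longrightarrow> \<theta>2 \<in> \<Theta>
   \<Longrightarrow> \<bar>F w1 \<theta>1 - F w2 \<theta>2\<bar> \<le> K * Nz ((w1, \<theta>1) - (w2, \<theta>2))"
  unfolding lipschitz_fun_def by blast

lemma lipschitz_fun_continuous_on:
  assumes "lipschitz_fun K F"
  shows "continuous_on (W \<times> \<Theta>) (\<lambda>z. F (fst z) (snd z))"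
  unfolding continuous_on_def
proof
  fix z assume z: "z \<in> W \<times> \<Theta>"
  have "((\<lambda>z'. Nz (z' - z)) \<longlongrightarrow> Nz (z - z)) (at z within W \<times> \<Theta>)"
    by (intro continuous_on_tendsto_compose[OF continuous_on_is_norm[OF Nz, of UNIV]] tendsto_intros) auto
  then have "((\<lambda>z'. K * Nz (z' - z)) \<longlongrightarrow> K * 0) (at z within W \<times> \<Theta>)"
    using is_norm_eq_0_iff[OF Nz, of 0] by (intro tendsto_mult tendsto_const) simp
  moreover have "\<bar>F (fst z') (snd z') - F (fst z) (snd z)\<bar> \<le> K * Nz (z' - z)" if "z' \<in> W \<times> \<Theta>" for z'
    using lipschitz_funD[OF assms, of "fst z'" "fst z" "snd z'" "snd z"] that z by auto
  ultimately have "((\<lambda>z'. \<bar>F (fst z') (snd z') - F (fst z) (snd z)\<bar>) \<longlongrightarrow> 0) (at z within W \<times> \<Theta>)"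
    by - (rule tendsto_sandwich[where f = "\<lambda>_. 0" and h = "\<lambda>z'. K * Nz (z' - z)"], auto simp: eventually_at_filter)
  then show "((\<lambda>z. F (fst z) (snd z)) \<longlongrightarrow> F (fst z) (snd z)) (at z within W \<times> \<Theta>)"
    using LIM_zero_iff tendsto_rabs_zero_iff by blast
qed

text \<open>Each coordinate of a saddle point is optimal while the other one is held fixed. Adding
  the two growth bounds cancels the saddle value and assembles the two squares into that of
  \<open>Nz\<close>.\<close>

lemma saddle_point_growth:
  assumes "sc_sc \<mu> F" "saddle_point W \<Theta> F zs" "z \<in> W \<times> \<Theta>"
  shows "\<mu> / 2 * (Nz (z - zs))\<^sup>2 \<le> F (fst z) (snd zs) - F (fst zs) (snd z)"
proof -
  have zs: "fst zs \<in> W" "snd zs \<in> \<Theta>" and z: "fst z \<in> W" "snd z \<in> \<Theta>"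
    using assms unfolding saddle_point_def by auto
  have "\<mu> / 2 * (Nw (fst zs - fst z))\<^sup>2 \<le> F (fst z) (snd zs) - F (fst zs) (snd zs)"
    using assms zs z unfolding sc_sc_def saddle_point_def
    by (intro strongly_convex_on_minimum_growth[OF convex_W, where g = "\<lambda>w. F w (snd zs)"]) auto
  moreover have "\<mu> / 2 * (Nt (snd zs - snd z))\<^sup>2 \<le> - F (fst zs) (snd z) - - F (fst zs) (snd zs)"
    using assms zs z unfolding sc_sc_def saddle_point_def
    by (intro strongly_convex_on_minimum_growth[OF convex_Th, where g = "\<lambda>\<theta>. - F (fst zs) \<theta>"]) auto
  ultimately show ?thesis
    by (simp add: pair_norm_power2 is_norm_diff_commute[OF Nw] is_norm_diff_commute[OF Nt] algebra_simps)
qed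

lemma saddle_point_gap_nonpos:
  assumes "saddle_point W \<Theta> F z" "z' \<in> W \<times> \<Theta>"
  shows "F (fst z) (snd z') - F (fst z') (snd z) \<le> 0"
  using assms unfolding saddle_point_def by (fastforce intro: order_trans)

lemma saddle_point_unique:
  assumes "sc_sc \<mu> F" "0 < \<mu>" "saddle_point W \<Theta> F z" "saddle_point W \<Theta> F z'"
  shows "z = z'"
proof -
  have "z \<in> W \<times> \<Theta>" "z' \<in> W \<times> \<Theta>" using assms unfolding saddle_point_def by auto
  then have "\<mu> / 2 * (Nz (z - z'))\<^sup>2 \<le> 0"
    using saddle_point_growth[OF assms(1,4)] saddle_point_gap_nonpos[OF assms(3)] by fastforce
  then have "(Nz (z - z'))\<^sup>2 \<le> 0" using \<open>0 < \<mu>\<close> by (simp add: mult_le_0_iff)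
  then show ?thesis using is_norm_eq_0_iff[OF Nz, of "z - z'"] by simp
qed

text \<open>
  A saddle point is a fixed point of the pair of best responses, which are continuous thanks to
  strong convexity.
\<close>

lemma saddle_point_exists:
  assumes "sc_sc \<mu> F" "0 < \<mu>" "lipschitz_fun K F"
  shows "\<exists>z. saddle_point W \<Theta> F z"
proof -
  have cont: "continuous_on (W \<times> \<Theta>) (\<lambda>z. F (fst z) (snd z))"
    by (rule lipschitz_fun_continuous_on[OF assms(3)])
  have cw: "continuous_on W (\<lambda>w. F w \<theta>)" if "\<theta> \<in> \<Theta>" for \<theta>
    using that continuous_on_compose2[OF cont continuous_on_Pair[OF continuous_on_id continuous_on_const], of \<theta> W] by auto
  have ct: "continuous_on \<Theta> (\<lambda>\<theta>. - F w \<theta>)" if "w \<in> W" for w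
    using that continuous_on_minus[OF continuous_on_compose2[OF cont continuous_on_Pair[OF continuous_on_const continuous_on_id], of w \<Theta>]] by auto
  obtain bw where bw: "continuous_on \<Theta> bw" "\<And>\<theta>. \<theta> \<in> \<Theta> \<Longrightarrow> bw \<theta> \<in> W"
      "\<And>\<theta> w. \<theta> \<in> \<Theta> \<Longrightarrow> w \<in> W \<Longrightarrow> F (bw \<theta>) \<theta> \<le> F w \<theta>"
  proof (rule strongly_convex_on_argmin_continuous[OF compact_W convex_W W_ne Nw Nt assms(2), where G = "\<lambda>\<theta> w. F w \<theta>" and P = \<Theta>])
    show "\<bar>F w \<theta> - F w \<theta>'\<bar> \<le> K * Nt (\<theta> - \<theta>')" if "\<theta> \<in> \<Theta>" "\<theta>' \<in> \<Theta>" "w \<in> W" for \<theta> \<theta>' w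
      using lipschitz_funD[OF assms(3), of w w \<theta> \<theta>'] that by (simp add: Nz_eq_Nt)
  qed (use assms(1) cw in \<open>auto simp: sc_sc_def\<close>)
  obtain bt where bt: "continuous_on W bt" "\<And>w. w \<in> W \<Longrightarrow> bt w \<in> \<Theta>"
      "\<And>w \<theta>. w \<in> W \<Longrightarrow> \<theta> \<in> \<Theta> \<Longrightarrow> - F w (bt w) \<le> - F w \<theta>"
  proof (rule strongly_convex_on_argmin_continuous[OF compact_Th convex_Th Th_ne Nt Nw assms(2), where G = "\<lambda>w \<theta>. - F w \<theta>" and P = W])
    show "\<bar>- F w \<theta> - - F w' \<theta>\<bar> \<le> K * Nw (w - w')" if "w \<in> W" "w' \<in> W" "\<theta> \<in> \<Theta>" for \<theta> w' w
      using lipschitz_funD[OF assms(3), of w w' \<theta> \<theta>] that by (simp add: Nz_eq_Nw)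
  qed (use assms(1) ct in \<open>auto simp: sc_sc_def\<close>)
  have "continuous_on (W \<times> \<Theta>) (\<lambda>z. (bw (snd z), bt (fst z)))"
    by (intro continuous_intros continuous_on_compose2[OF bw(1)] continuous_on_compose2[OF bt(1)]) auto
  moreover have "(\<lambda>z. (bw (snd z), bt (fst z))) \<in> W \<times> \<Theta> \<rightarrow> W \<times> \<Theta>"
    using bw(2) bt(2) by auto
  ultimately obtain z where z: "z \<in> W \<times> \<Theta>" "(bw (snd z), bt (fst z)) = z"
    using brouwer[OF compact_Z convex_Times[OF convex_W convex_Th]] W_ne Th_ne by blast
  have "saddle_point W \<Theta> F z"
    unfolding saddle_point_def
  proof (intro conjI ballI)
    fix w \<theta> assume *: "w \<in> W" "\<theta> \<in> \<Theta>"
    show "F (fst z) \<theta> \<le> F (fst z) (snd z)"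
      using bt(3)[of "fst z" \<theta>] z * by (cases z) auto
    show "F (fst z) (snd z) \<le> F w (snd z)"
      using bw(3)[of "snd z" w] z * by (cases z) auto
  qed (rule z)
  then show ?thesis ..
qed

text \<open>An arbitrary choice, made canonical by uniqueness under a positive modulus; uniqueness
  is also what makes it measurable in parameters.\<close>

definition saddle :: "('w \<Rightarrow> 't \<Rightarrow> real) \<Rightarrow> 'w \<times> 't" where
  "saddle F = (SOME z. saddle_point W \<Theta> F z)"

lemma saddle_point_saddle:
  "sc_sc \<mu> F \<Longrightarrow> 0 < \<mu> \<Longrightarrow> lipschitz_fun K F \<Longrightarrow> saddle_point W \<Theta> F (saddle F)"
  unfolding saddle_def using saddle_point_exists by (rule someI_ex)

text \<open>Each saddle inequality is evaluated at the other saddle point. In the sum the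
  \<open>F\<close> terms cancel, and what remains compares the squared distances to the centre
  \<open>(u, v)\<close>.\<close>

lemma saddle_point_shift:
  assumes F: "saddle_point W \<Theta> F z1"
    and F': "saddle_point W \<Theta> (\<lambda>w \<theta>. F w \<theta> + a * (Nw (w - u))\<^sup>2 - a * (Nt (\<theta> - v))\<^sup>2) z2"
    and "0 < a"
  shows "Nz (z2 - (u, v)) \<le> Nz (z1 - (u, v))"
proof -
  have z: "z1 \<in> W \<times> \<Theta>" "z2 \<in> W \<times> \<Theta>" using F F' unfolding saddle_point_def by auto
  have "a * ((Nw (fst z2 - u))\<^sup>2 + (Nt (snd z2 - v))\<^sup>2) \<le> a * ((Nw (fst z1 - u))\<^sup>2 + (Nt (snd z1 - v))\<^sup>2)"
    using saddle_point_gap_nonpos[OF F z(2)] saddle_point_gap_nonpos[OF F' z(1)]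
    by (simp add: algebra_simps)
  then have "(Nz (z2 - (u, v)))\<^sup>2 \<le> (Nz (z1 - (u, v)))\<^sup>2"
    using \<open>0 < a\<close> by (simp add: pair_norm_power2)
  then show ?thesis
    using is_norm_nonneg[OF Nz] by (rule power2_le_imp_le)
qed

text \<open>The growth bounds of \<open>F\<close> at \<open>z\<close> and of \<open>F'\<close> at
  \<open>z'\<close> involve the same two swapped points, \<open>(fst z', snd z)\<close> and
  \<open>(fst z, snd z')\<close>. In their sum only the perturbation \<open>F - F'\<close> at these
  points survives, and one factor \<open>Nz (z - z')\<close> can be divided out.\<close>

lemma saddle_point_stability:
  assumes "sc_sc \<mu> F" "sc_sc \<mu> F'" "saddle_point W \<Theta> F z" "saddle_point W \<Theta> F' z'"
    and "(F (fst z') (snd z) - F' (fst z') (snd z)) - (F (fst z) (snd z') - F' (fst z) (snd z'))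
         \<le> c * Nz (z - z')"
    and "0 \<le> c"
  shows "\<mu> * Nz (z - z') \<le> c"
proof -
  have z: "z \<in> W \<times> \<Theta>" "z' \<in> W \<times> \<Theta>" using assms unfolding saddle_point_def by auto
  have "\<mu> * (Nz (z - z'))\<^sup>2 \<le> c * Nz (z - z')"
    using saddle_point_growth[OF assms(1,3) z(2)] saddle_point_growth[OF assms(2,4) z(1)] assms(5)
      is_norm_diff_commute[OF Nz, of z z']
    by simp
  then have "(\<mu> * Nz (z - z')) * Nz (z - z') \<le> c * Nz (z - z')"
    by (simp add: power2_eq_square mult.assoc)
  then show ?thesis
    using is_norm_nonneg[OF Nz, of "z - z'"] \<open>0 \<le> c\<close> by (cases "Nz (z - z') = 0") auto
qed

text \<open>First-order optimality without derivatives. Both coordinates of \<open>zs\<close> move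
  by a step \<open>s\<close> towards \<open>z\<close>; convex-concavity of \<open>C\<close> bounds
  \<open>s\<close> times the gap by the change of \<open>C\<close>, the saddle inequality bounds
  this by the change of the regularizers, and \<open>s\<close> tends to 0 after division. The factor
  \<open>2 * B\<close> comes from expanding the squared norms, with \<open>B\<close> bounding the
  distance from \<open>zs\<close> to \<open>z\<close>.\<close>

lemma saddle_point_regularized_gap:
  assumes cc: "\<And>\<theta>. \<theta> \<in> \<Theta> \<Longrightarrow> convex_on W (\<lambda>w. C w \<theta>)" "\<And>w. w \<in> W \<Longrightarrow> concave_on \<Theta> (\<lambda>\<theta>. C w \<theta>)"
    and I: "finite I" and a: "\<And>k. k \<in> I \<Longrightarrow> 0 \<le> a k"
    and zs: "saddle_point W \<Theta> (\<lambda>w \<theta>. C w \<theta> + (\<Sum>k\<in>I. a k * ((Nw (w - fst (h k)))\<^sup>2 - (Nt (\<theta> - snd (h k)))\<^sup>2))) zs"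
      (is "saddle_point W \<Theta> (\<lambda>w \<theta>. C w \<theta> + ?R w \<theta>) zs")
    and B: "norm_diameter Nz (W \<times> \<Theta>) = B"
    and z: "z \<in> W \<times> \<Theta>"
  shows "C (fst zs) (snd z) - C (fst z) (snd zs) \<le> 2 * B * (\<Sum>k\<in>I. a k * Nz (zs - h k))"
proof -
  obtain ws ts where zs': "zs = (ws, ts)" by fastforce
  obtain w \<theta> where z': "z = (w, \<theta>)" by fastforce
  have in_sets: "ws \<in> W" "ts \<in> \<Theta>" "w \<in> W" "\<theta> \<in> \<Theta>"
    using zs z by (auto simp: saddle_point_def zs' z')
  have zB: "Nz (z - zs) \<le> B" using B Nz_diff_le_diameter[of z zs] in_sets by (simp add: zs' z')
  have small: "C ws \<theta> - C w ts \<le> 2 * B * (\<Sum>k\<in>I. a k * Nz (zs - h k)) + s * (B\<^sup>2 * (\<Sum>k\<in>I. a k))"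
    if s: "0 < s" "s < 1" for s
  proof -
    let ?w = "(1 - s) *\<^sub>R ws + s *\<^sub>R w" and ?t = "(1 - s) *\<^sub>R ts + s *\<^sub>R \<theta>"
    have wt: "?w \<in> W" "?t \<in> \<Theta>"
      using s in_sets by (auto intro!: convexD[OF convex_W] convexD[OF convex_Th])
    have 1: "C ?w ts \<le> (1 - s) * C ws ts + s * C w ts"
      using s in_sets by (intro convex_onD[OF cc(1)]) auto
    have 2: "(1 - s) * C ws ts + s * C ws \<theta> \<le> C ws ?t"
      using convex_onD[OF cc(2)[unfolded concave_on_def], of ws s ts \<theta>] s in_sets by simp
    \<comment> \<open>The coordinates move separately: the saddle inequality compares the half-moved
      points \<open>(ws, ?t)\<close> and \<open>(?w, ts)\<close>.\<close>
    have 3: "C ws ?t + ?R ws ?t \<le> C ?w ts + ?R ?w ts"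
      using saddle_point_gap_nonpos[OF zs, of "(?w, ?t)"] wt by (simp add: zs')
    have "s * (C ws \<theta> - C w ts) \<le> ?R ?w ts - ?R ws ?t"
      using 1 2 3 by (simp add: algebra_simps)
    also have "\<dots> = (\<Sum>k\<in>I. a k * (((Nw (?w - fst (h k)))\<^sup>2 - (Nw (ws - fst (h k)))\<^sup>2)
                              + ((Nt (?t - snd (h k)))\<^sup>2 - (Nt (ts - snd (h k)))\<^sup>2)))"
      by (simp add: sum_subtractf[symmetric] algebra_simps)
    also have "\<dots> \<le> (\<Sum>k\<in>I. a k * (2 * s * (B * Nz (zs - h k)) + s\<^sup>2 * B\<^sup>2))"
    proof (intro sum_mono mult_left_mono a)
      fix k
      have w': "?w - fst (h k) = (ws - fst (h k)) + s *\<^sub>R (w - ws)"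
        and t': "?t - snd (h k) = (ts - snd (h k)) + s *\<^sub>R (\<theta> - ts)" by (simp_all add: algebra_simps)
      have "((Nw (?w - fst (h k)))\<^sup>2 - (Nw (ws - fst (h k)))\<^sup>2) + ((Nt (?t - snd (h k)))\<^sup>2 - (Nt (ts - snd (h k)))\<^sup>2)
          \<le> 2 * s * (Nw (ws - fst (h k)) * Nw (w - ws) + Nt (ts - snd (h k)) * Nt (\<theta> - ts))
            + s\<^sup>2 * ((Nw (w - ws))\<^sup>2 + (Nt (\<theta> - ts))\<^sup>2)"
        using is_norm_power2_add_le[OF Nw, of s "ws - fst (h k)" "w - ws"]
          is_norm_power2_add_le[OF Nt, of s "ts - snd (h k)" "\<theta> - ts"] s
        unfolding w' t' by (simp add: algebra_simps)
      also have "\<dots> \<le> 2 * s * (Nz (zs - h k) * Nz (z - zs)) + s\<^sup>2 * (Nz (z - zs))\<^sup>2"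
        using pair_norm_Cauchy_Schwarz[of Nw "zs - h k" "z - zs" Nt] s
        by (intro add_mono mult_left_mono) (auto simp: zs' z' pair_norm_power2)
      also have "\<dots> \<le> 2 * s * (Nz (zs - h k) * B) + s\<^sup>2 * B\<^sup>2"
        using s zB is_norm_nonneg[OF Nz] by (intro add_mono mult_left_mono power_mono) auto
      finally show "((Nw (?w - fst (h k)))\<^sup>2 - (Nw (ws - fst (h k)))\<^sup>2) + ((Nt (?t - snd (h k)))\<^sup>2 - (Nt (ts - snd (h k)))\<^sup>2)
          \<le> 2 * s * (B * Nz (zs - h k)) + s\<^sup>2 * B\<^sup>2" by (simp add: mult.commute)
    qed
    also have "\<dots> = s * (2 * B * (\<Sum>k\<in>I. a k * Nz (zs - h k)) + s * (B\<^sup>2 * (\<Sum>k\<in>I. a k)))"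
      by (simp add: sum_distrib_left sum.distrib power2_eq_square algebra_simps)
    finally show ?thesis using s(1) by (simp only: mult_le_cancel_left_pos)
  qed
  define c where "c = B\<^sup>2 * (\<Sum>k\<in>I. a k)"
  have c: "0 \<le> c" unfolding c_def by (intro mult_nonneg_nonneg sum_nonneg a) auto
  have "C ws \<theta> - C w ts \<le> 2 * B * (\<Sum>k\<in>I. a k * Nz (zs - h k))"
  proof (rule field_le_epsilon)
    fix e :: real assume e: "0 < e"
    \<comment> \<open>\<open>c\<close> may be 0, hence the denominator \<open>c + 1\<close>; with
      this step the remainder \<open>s * c\<close> is at most \<open>e\<close>.\<close>
    define s where "s = min (1 / 2) (e / (c + 1))"
    have s: "0 < s" "s < 1" using e c by (auto simp: s_def)
    have "s * c \<le> e / (c + 1) * (c + 1)" using e c s unfolding s_def by (intro mult_mono) auto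
    then have "s * c \<le> e" using c by simp
    then show "C ws \<theta> - C w ts \<le> 2 * B * (\<Sum>k\<in>I. a k * Nz (zs - h k)) + e"
      using small[OF s] by (simp add: c_def)
  qed
  then show ?thesis by (simp add: zs' z')
qed

end

section \<open>Measurability\<close>

text \<open>The preimage of a closed set \<open>C\<close> is built with countable operations:
  \<open>p x\<close> lies in \<open>C\<close> iff for every \<open>m\<close> some point of a
  countable dense subset of \<open>C \<inter> Z\<close> satisfies the first \<open>m + 1\<close>
  constraints up to \<open>1 / Suc m\<close>. Density and continuity give one direction. For the
  other, compactness extracts a limit of the approximate solutions; it solves all constraints and
  equals \<open>p x\<close> by uniqueness.\<close>

lemma measurable_unique_solution:
  fixes Z :: "'b::euclidean_space set" and \<psi> :: "nat \<Rightarrow> 'a \<Rightarrow> 'b \<Rightarrow> real"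
  assumes Z: "compact Z"
    and cont: "\<And>i x. x \<in> space M \<Longrightarrow> continuous_on Z (\<psi> i x)"
    and meas: "\<And>i z. z \<in> Z \<Longrightarrow> (\<lambda>x. \<psi> i x z) \<in> borel_measurable M"
    and p: "\<And>x. x \<in> space M \<Longrightarrow> p x \<in> Z"
    and unique: "\<And>x z. x \<in> space M \<Longrightarrow> z \<in> Z \<Longrightarrow> (\<forall>i. \<psi> i x z \<le> 0) \<longleftrightarrow> z = p x"
  shows "p \<in> borel_measurable M"
proof -
  have "p -` C \<inter> space M \<in> sets M" if C: "closed C" for C
  proof -
    obtain E where E: "countable E" "E \<subseteq> C \<inter> Z" "C \<inter> Z \<subseteq> closure E"
      using separable by blast
    have cpt: "compact (C \<inter> Z)" using closed_Int_compact[OF C Z] .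
    have "p -` C \<inter> space M
        = {x \<in> space M. \<forall>m. \<exists>z\<in>E. \<forall>i\<in>{..m}. \<psi> i x z < 1 / Suc m}"
    proof (intro set_eqI iffI)
      fix x assume x: "x \<in> p -` C \<inter> space M"
      then have px: "p x \<in> C \<inter> Z" "\<And>i. \<psi> i x (p x) \<le> 0" using p unique by auto
      have "\<exists>z\<in>E. \<forall>i\<in>{..m}. \<psi> i x z < 1 / Suc m" for m
      proof -
        have "p x \<in> closure E" using px E by auto
        then obtain zz where zz: "\<And>n. zz n \<in> E" "zz \<longlonglongrightarrow> p x"
          unfolding closure_sequential by blast
        have "(\<lambda>n. \<psi> i x (zz n)) \<longlonglongrightarrow> \<psi> i x (p x)" for i
          using subsetD[OF E(2) zz(1)] px x by (intro continuous_on_tendsto_compose[OF cont zz(2)]) auto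
        then have "\<forall>\<^sub>F n in sequentially. \<psi> i x (zz n) < 1 / Suc m" for i
          by (rule order_tendstoD(2)) (rule le_less_trans[OF px(2)], simp)
        then have "\<forall>\<^sub>F n in sequentially. \<forall>i\<in>{..m}. \<psi> i x (zz n) < 1 / Suc m"
          by (intro eventually_ball_finite) auto
        then show ?thesis using zz(1) eventually_happens'[OF sequentially_bot] by blast
      qed
      then show "x \<in> {x \<in> space M. \<forall>m. \<exists>z\<in>E. \<forall>i\<in>{..m}. \<psi> i x z < 1 / Suc m}" using x by blast
    next
      fix x assume x: "x \<in> {x \<in> space M. \<forall>m. \<exists>z\<in>E. \<forall>i\<in>{..m}. \<psi> i x z < 1 / Suc m}"
      then have "\<forall>m. \<exists>z. z \<in> E \<and> (\<forall>i\<in>{..m}. \<psi> i x z < 1 / Suc m)" by blast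
      from choice[OF this] obtain zz where
        zz: "\<And>m. zz m \<in> E" "\<And>m i. i \<le> m \<Longrightarrow> \<psi> i x (zz m) < 1 / Suc m"
        by auto
      obtain z r where z: "z \<in> C \<inter> Z" "strict_mono r" "(zz \<circ> r) \<longlonglongrightarrow> z"
        using cpt zz(1) E(2) unfolding compact_def by (meson subsetD)
      have "\<psi> i x z \<le> 0" for i
      proof (rule tendsto_le[OF sequentially_bot])
        show "(\<lambda>n. \<psi> i x ((zz \<circ> r) n)) \<longlonglongrightarrow> \<psi> i x z"
          using x z subsetD[OF E(2) zz(1)] by (intro continuous_on_tendsto_compose[OF cont z(3)]) auto
        show "(\<lambda>n. 1 / real (Suc (r n))) \<longlonglongrightarrow> 0"
          using LIMSEQ_subseq_LIMSEQ[OF LIMSEQ_inverse_real_of_nat z(2)]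
          by (simp add: comp_def inverse_eq_divide)
        show "\<forall>\<^sub>F n in sequentially. \<psi> i x ((zz \<circ> r) n) \<le> 1 / real (Suc (r n))"
          using eventually_ge_at_top[of i]
        proof eventually_elim
          case (elim n)
          then have "i \<le> r n" using seq_suble[OF z(2), of n] by simp
          then show ?case using zz(2)[of i "r n"] by simp
        qed
      qed
      then have "z = p x" using unique x z by blast
      then show "x \<in> p -` C \<inter> space M" using x z by auto
    qed
    also have "\<dots> \<in> sets M"
    proof (intro sets.sets_Collect_countable_All sets.sets_Collect_countable_Ex' sets.sets_Collect_finite_All E)
      fix m i z assume "z \<in> E"
      then have [measurable]: "(\<lambda>x. \<psi> i x z) \<in> borel_measurable M" using meas E by blast
      show "{x \<in> space M. \<psi> i x z < 1 / real (Suc m)} \<in> sets M" by measurable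
    qed auto
    finally show ?thesis .
  qed
  then show ?thesis
    by (auto intro!: measurable_sigma_sets[of _ borel] simp: borel_eq_closed
        intro: measurable_measure_of)
qed

text \<open>\<open>g\<close> is the limit of countably valued maps, which pick the first member of a
  dense sequence within \<open>1 / Suc n\<close>. For these the composition is measurable piece by
  piece, and continuity of \<open>F x\<close> carries measurability to the limit.\<close>

lemma measurable_Caratheodory_compose:
  fixes F :: "'a \<Rightarrow> 'b::euclidean_space \<Rightarrow> real"
  assumes g[measurable]: "g \<in> borel_measurable M" and gZ: "\<And>x. x \<in> space M \<Longrightarrow> g x \<in> Z"
    and meas: "\<And>z. z \<in> Z \<Longrightarrow> (\<lambda>x. F x z) \<in> borel_measurable M"
    and cont: "\<And>x. x \<in> space M \<Longrightarrow> continuous_on Z (F x)"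
  shows "(\<lambda>x. F x (g x)) \<in> borel_measurable M"
proof (cases "Z = {}")
  case True
  then have "space M = {}" using gZ by blast
  then show ?thesis by (simp add: measurable_def)
next
  case False
  obtain E where E: "countable E" "E \<subseteq> Z" "Z \<subseteq> closure E"
    using separable by blast
  then have "E \<noteq> {}" using False by auto
  define e where "e = from_nat_into E"
  have e: "e k \<in> Z" "e k \<in> E" "range e = E" for k
    using E \<open>E \<noteq> {}\<close> from_nat_into[OF \<open>E \<noteq> {}\<close>] range_from_nat_into[OF \<open>E \<noteq> {}\<close>] by (auto simp: e_def)
  define j where "j n x = (LEAST k. dist (e k) (g x) < 1 / real (Suc n))" for n x
  have [measurable]: "j n \<in> M \<rightarrow>\<^sub>M count_space UNIV" for n
    unfolding j_def by measurable
  have dist_j: "dist (e (j n x)) (g x) < 1 / real (Suc n)" if "x \<in> space M" for n x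
  proof -
    have "g x \<in> closure E" using gZ that E by blast
    then obtain y where "y \<in> E" "dist y (g x) < 1 / real (Suc n)"
      unfolding closure_approachable by (metis of_nat_0_less_iff zero_less_Suc zero_less_divide_1_iff)
    then have "\<exists>k. dist (e k) (g x) < 1 / real (Suc n)" using e(3) by (metis imageE)
    then show ?thesis unfolding j_def by (rule LeastI_ex)
  qed
  show ?thesis
  proof (rule borel_measurable_LIMSEQ_real)
    fix x assume x: "x \<in> space M"
    have "(\<lambda>n. dist (e (j n x)) (g x)) \<longlonglongrightarrow> 0"
    proof (rule tendsto_sandwich[where f = "\<lambda>_. 0" and h = "\<lambda>n. 1 / real (Suc n)"])
      show "(\<lambda>n. 1 / real (Suc n)) \<longlonglongrightarrow> 0"
        using LIMSEQ_inverse_real_of_nat by (simp add: inverse_eq_divide)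
    qed (use less_imp_le[OF dist_j[OF x]] in auto)
    then have "(\<lambda>n. e (j n x)) \<longlonglongrightarrow> g x" using tendsto_dist_iff by blast
    then show "(\<lambda>n. F x (e (j n x))) \<longlonglongrightarrow> F x (g x)"
      using e(1) gZ[OF x] by (intro continuous_on_tendsto_compose[OF cont[OF x]]) auto
  next
    fix n
    show "(\<lambda>x. F x (e (j n x))) \<in> borel_measurable M"
      by (rule measurable_compose_countable[where f = "\<lambda>k x. F x (e k)" and g = "j n"]) (simp_all add: meas e(1))
  qed
qed

section \<open>Bounded random variables and exchangeability\<close>

lemma prob_space_integrable_bounded:
  fixes f :: "'a \<Rightarrow> real"
  assumes "prob_space M" "f \<in> borel_measurable M" "\<And>x. x \<in> space M \<Longrightarrow> \<bar>f x\<bar> \<le> C"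
  shows "integrable M f"
proof -
  interpret prob_space M by fact
  show ?thesis using assms by (intro integrable_const_bound[where B = C]) auto
qed

lemma prob_space_integral_le:
  fixes f :: "'a \<Rightarrow> real"
  assumes "prob_space M" "integrable M f" "\<And>x. x \<in> space M \<Longrightarrow> f x \<le> C"
  shows "integral\<^sup>L M f \<le> C"
proof -
  interpret prob_space M by fact
  have "integral\<^sup>L M f \<le> integral\<^sup>L M (\<lambda>_. C)" using assms by (intro integral_mono) auto
  then show ?thesis by (simp add: prob_space)
qed

lemma prob_space_abs_integral_le:
  fixes f :: "'a \<Rightarrow> real"
  assumes "prob_space M" "integrable M f" "\<And>x. x \<in> space M \<Longrightarrow> \<bar>f x\<bar> \<le> C"
  shows "\<bar>integral\<^sup>L M f\<bar> \<le> C"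
proof -
  have "(\<integral>x. \<bar>f x\<bar> \<partial>M) \<le> C" using assms by (intro prob_space_integral_le) auto
  then show ?thesis using integral_abs_bound[of M f] by (rule order_trans[rotated])
qed

text \<open>A coordinate of the sample and an independent draw are exchangeable: coordinate
  \<open>i\<close> is split off the product and swapped with \<open>x\<close> by Fubini. The test
  point becomes \<open>S i\<close>, and the training sample changes in coordinate \<open>i\<close>
  only.\<close>

lemma integral_PiM_swap_fresh:
  fixes G :: "(nat \<Rightarrow> 'x) \<times> 'x \<Rightarrow> real"
  assumes D: "prob_space D" and i: "i < m"
    and G[measurable]: "G \<in> borel_measurable (Pi\<^sub>M {..<m} (\<lambda>_. D) \<Otimes>\<^sub>M D)"
    and bound: "\<And>S x. S \<in> space (Pi\<^sub>M {..<m} (\<lambda>_. D)) \<Longrightarrow> x \<in> space D \<Longrightarrow> \<bar>G (S, x)\<bar> \<le> C"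
  shows "(\<integral>S. \<integral>x. G (S, x) \<partial>D \<partial>Pi\<^sub>M {..<m} (\<lambda>_. D))
       = (\<integral>S. \<integral>x. G (S(i := x), S i) \<partial>D \<partial>Pi\<^sub>M {..<m} (\<lambda>_. D))"
proof -
  interpret D: prob_space D by fact
  interpret PS: product_sigma_finite "\<lambda>_::nat. D" by unfold_locales
  interpret DD: pair_prob_space D D by unfold_locales
  define J where "J = {..<m} - {i}"
  have J: "finite J" "i \<notin> J" "insert i J = {..<m}" using i by (auto simp: J_def)
  let ?P = "Pi\<^sub>M {..<m} (\<lambda>_. D)"
  have P: "prob_space ?P" by (intro prob_space_PiM D)
  have upd[measurable]: "(\<lambda>(S, x). S(i := x)) \<in> ?P \<Otimes>\<^sub>M D \<rightarrow>\<^sub>M ?P"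
    using measurable_add_dim[of i "{..<m}" "\<lambda>_. D"] i by (simp add: insert_absorb)
  have updJ: "(\<lambda>(S, x). S(i := x)) \<in> Pi\<^sub>M J (\<lambda>_. D) \<Otimes>\<^sub>M D \<rightarrow>\<^sub>M ?P"
    using measurable_add_dim[of i J "\<lambda>_. D"] J by simp
  have comp[measurable]: "(\<lambda>S. S i) \<in> ?P \<rightarrow>\<^sub>M D" using i by simp
  have mG': "(\<lambda>(S, x). G (S(i := x), S i)) \<in> borel_measurable (?P \<Otimes>\<^sub>M D)"
  proof -
    have "(\<lambda>z. (case z of (S, x) \<Rightarrow> S(i := x), fst z i)) \<in> ?P \<Otimes>\<^sub>M D \<rightarrow>\<^sub>M ?P \<Otimes>\<^sub>M D" by measurable
    from measurable_compose[OF this G] show ?thesis by (simp add: case_prod_beta')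
  qed
  have sp: "S(i := x) \<in> space ?P" if "S \<in> space ?P" "x \<in> space D" for S x
    using that i by (auto simp: space_PiM PiE_def extensional_def)
  have spJ: "S(i := x) \<in> space ?P" if "S \<in> space (Pi\<^sub>M J (\<lambda>_. D))" "x \<in> space D" for S x
    using measurable_space[OF updJ, of "(S, x)"] that by (simp add: space_pair_measure)
  have spi: "S i \<in> space D" if "S \<in> space ?P" for S
    using that i by (auto simp: space_PiM)
  have intG: "\<bar>\<integral>x. G (S, x) \<partial>D\<bar> \<le> C" if "S \<in> space ?P" for S
  proof -
    have "(\<lambda>x. G (S, x)) \<in> borel_measurable D" using that by measurable
    then show ?thesis using bound[OF that]
      by (intro prob_space_abs_integral_le D prob_space_integrable_bounded[where C = C]) auto
  qed
  have intG': "\<bar>\<integral>x. G (S(i := x), S i) \<partial>D\<bar> \<le> C" if "S \<in> space ?P" for S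
  proof -
    have m: "(\<lambda>x. G (S(i := x), S i)) \<in> borel_measurable D"
      using measurable_compose[OF measurable_Pair1'[OF that] mG'] by simp
    then show ?thesis using bound[OF sp[OF that] spi[OF that]]
      by (intro prob_space_abs_integral_le D prob_space_integrable_bounded[where C = C]) auto
  qed
  have i1: "integrable ?P (\<lambda>S. \<integral>x. G (S, x) \<partial>D)"
    using intG by (intro prob_space_integrable_bounded[OF P, where C = C] D.borel_measurable_lebesgue_integral) simp_all
  have i2: "integrable ?P (\<lambda>S. \<integral>x. G (S(i := x), S i) \<partial>D)"
    using intG' mG' by (intro prob_space_integrable_bounded[OF P, where C = C] D.borel_measurable_lebesgue_integral) simp_all
  have "(\<integral>S. \<integral>x. G (S, x) \<partial>D \<partial>?P) = (\<integral>S. \<integral>y. \<integral>x. G (S(i := y), x) \<partial>D \<partial>D \<partial>Pi\<^sub>M J (\<lambda>_. D))"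
    using PS.product_integral_insert[OF J(1,2)] i1 by (simp add: J(3))
  also have "\<dots> = (\<integral>S. \<integral>y. \<integral>x. G (S(i := x), y) \<partial>D \<partial>D \<partial>Pi\<^sub>M J (\<lambda>_. D))"
  proof (rule Bochner_Integration.integral_cong[OF refl])
    fix S assume S: "S \<in> space (Pi\<^sub>M J (\<lambda>_. D))"
    have m1: "(\<lambda>y. S(i := y)) \<in> D \<rightarrow>\<^sub>M ?P"
      using measurable_compose[OF measurable_Pair1'[OF S] updJ] by simp
    have "(\<lambda>z. (S(i := fst z), snd z)) \<in> D \<Otimes>\<^sub>M D \<rightarrow>\<^sub>M ?P \<Otimes>\<^sub>M D"
      by (intro measurable_Pair measurable_compose[OF measurable_fst m1] measurable_snd)
    from measurable_compose[OF this G] have "(\<lambda>(y, x). G (S(i := y), x)) \<in> borel_measurable (D \<Otimes>\<^sub>M D)"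
      by (simp add: case_prod_beta')
    then have "integrable (D \<Otimes>\<^sub>M D) (\<lambda>(y, x). G (S(i := y), x))"
      using bound[OF spJ[OF S]]
      by (intro prob_space_integrable_bounded[where C = C]) (auto simp: space_pair_measure intro: DD.prob_space_axioms)
    from DD.Fubini_integral[OF this]
    show "(\<integral>y. \<integral>x. G (S(i := y), x) \<partial>D \<partial>D) = (\<integral>y. \<integral>x. G (S(i := x), y) \<partial>D \<partial>D)" by simp
  qed
  also have "\<dots> = (\<integral>S. \<integral>x. G (S(i := x), S i) \<partial>D \<partial>?P)"
    by (subst PS.product_integral_insert[OF J(1,2), unfolded J(3), OF i2]) simp
  finally show ?thesis .
qed

context saddle_domain
begin

lemma Z_ne: "W \<times> \<Theta> \<noteq> {}"
  using W_ne Th_ne by simp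

text \<open>As \<open>F x\<close> is continuous, the saddle inequalities need to be tested only
  against a countable dense set of opponents. With uniqueness, the saddle point is the only solution
  of countably many constraints, the setting of \<open>measurable_unique_solution\<close>.\<close>

lemma measurable_saddle:
  assumes meas: "\<And>w \<theta>. w \<in> W \<Longrightarrow> \<theta> \<in> \<Theta> \<Longrightarrow> (\<lambda>x. F x w \<theta>) \<in> borel_measurable M"
    and lip: "\<And>x. x \<in> space M \<Longrightarrow> lipschitz_fun K (F x)"
    and sc: "\<And>x. x \<in> space M \<Longrightarrow> sc_sc \<mu> (F x)" and \<mu>: "0 < \<mu>"
  shows "(\<lambda>x. saddle (F x)) \<in> borel_measurable M"
proof -
  obtain E where E: "countable E" "E \<subseteq> W \<times> \<Theta>" "W \<times> \<Theta> \<subseteq> closure E"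
    using separable by blast
  then have "E \<noteq> {}" using Z_ne by auto
  define e where "e = from_nat_into E"
  have e: "e k \<in> W \<times> \<Theta>" "range e = E" for k
    using E \<open>E \<noteq> {}\<close> from_nat_into[OF \<open>E \<noteq> {}\<close>] range_from_nat_into[OF \<open>E \<noteq> {}\<close>] by (auto simp: e_def)
  have cont: "continuous_on (W \<times> \<Theta>) (\<lambda>z. F x (fst z) (snd z))" if "x \<in> space M" for x
    using lipschitz_fun_continuous_on[OF lip[OF that]] .
  define \<psi> where "\<psi> i x z = F x (fst z) (snd (e i)) - F x (fst (e i)) (snd z)" for i x z
  have sp: "saddle_point W \<Theta> (F x) (saddle (F x))" if "x \<in> space M" for x
    using saddle_point_saddle[OF sc \<mu> lip] that by blast
  have cont1: "continuous_on (W \<times> \<Theta>) (\<lambda>z. F x (fst z) b - F x a (snd z))"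
    if x: "x \<in> space M" and ab: "a \<in> W" "b \<in> \<Theta>" for x a b
  proof (rule continuous_on_diff)
    have "continuous_on (W \<times> \<Theta>) (\<lambda>z. (fst z, b))" "continuous_on (W \<times> \<Theta>) (\<lambda>z. (a, snd z))"
      by (intro continuous_intros)+
    note comp = continuous_on_compose2[OF cont[OF x] this(1)] continuous_on_compose2[OF cont[OF x] this(2)]
    have "(\<lambda>z. (fst z, b)) ` (W \<times> \<Theta>) \<subseteq> W \<times> \<Theta>" "(\<lambda>z. (a, snd z)) ` (W \<times> \<Theta>) \<subseteq> W \<times> \<Theta>"
      using ab by auto
    then show "continuous_on (W \<times> \<Theta>) (\<lambda>z. F x (fst z) b)" "continuous_on (W \<times> \<Theta>) (\<lambda>z. F x a (snd z))"
      using comp by simp_all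
  qed
  show ?thesis
  proof (rule measurable_unique_solution[OF compact_Z, where \<psi> = \<psi>])
    fix x i assume x: "x \<in> space M"
    show "continuous_on (W \<times> \<Theta>) (\<psi> i x)"
      unfolding \<psi>_def using e(1)[of i] by (intro cont1 x) auto
  next
    fix i z assume "z \<in> W \<times> \<Theta>"
    then show "(\<lambda>x. \<psi> i x z) \<in> borel_measurable M"
      unfolding \<psi>_def using e(1)[of i] by (intro borel_measurable_diff meas) auto
  next
    fix x assume "x \<in> space M"
    then show "saddle (F x) \<in> W \<times> \<Theta>" using sp unfolding saddle_point_def by blast
  next
    fix x z assume x: "x \<in> space M" and z: "z \<in> W \<times> \<Theta>"
    show "(\<forall>i. \<psi> i x z \<le> 0) \<longleftrightarrow> z = saddle (F x)"
    proof
      assume "z = saddle (F x)"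
      then show "\<forall>i. \<psi> i x z \<le> 0"
        unfolding \<psi>_def using saddle_point_gap_nonpos[OF sp[OF x] e(1)] by blast
    next
      assume nonpos: "\<forall>i. \<psi> i x z \<le> 0"
      have le: "F x (fst z) \<theta> - F x w (snd z) \<le> 0" if w: "w \<in> W" and \<theta>: "\<theta> \<in> \<Theta>" for w \<theta>
      proof -
        have "(w, \<theta>) \<in> closure E" using w \<theta> E by auto
        then obtain zz where zz: "\<And>n. zz n \<in> E" "zz \<longlonglongrightarrow> (w, \<theta>)"
          unfolding closure_sequential by blast
        have c1: "continuous_on (W \<times> \<Theta>) (\<lambda>y. F x (fst z) (snd y) - F x (fst y) (snd z))"
          using continuous_on_minus[OF cont1[OF x, of "fst z" "snd z"]] z by auto
        have "(\<lambda>n. F x (fst z) (snd (zz n)) - F x (fst (zz n)) (snd z)) \<longlonglongrightarrow> F x (fst z) (snd (w, \<theta>)) - F x (fst (w, \<theta>)) (snd z)"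
          using subsetD[OF E(2) zz(1)] w \<theta> by (intro continuous_on_tendsto_compose[OF c1 zz(2)]) auto
        moreover have "F x (fst z) (snd (zz n)) - F x (fst (zz n)) (snd z) \<le> 0" for n
        proof -
          obtain i where "zz n = e i" using zz(1)[of n] e(2) by auto
          then show ?thesis using nonpos unfolding \<psi>_def by simp
        qed
        ultimately show ?thesis using LIMSEQ_le_const2 by fastforce
      qed
      have "saddle_point W \<Theta> (F x) z"
        unfolding saddle_point_def using z le[of "fst z"] le[of _ "snd z"] by fastforce
      then show "z = saddle (F x)" by (rule saddle_point_unique[OF sc[OF x] \<mu> _ sp[OF x]])
    qed
  qed
qed

end

section \<open>Sums of Lipschitz and of strongly convex-concave functions\<close>

context saddle_domain
begin

lemma lipschitz_fun_mono: "lipschitz_fun K F \<Longrightarrow> K \<le> K' \<Longrightarrow> lipschitz_fun K' F"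
  unfolding lipschitz_fun_def using is_norm_nonneg[OF Nz] by (meson mult_right_mono order_trans)

lemma lipschitz_fun_add:
  assumes "lipschitz_fun K F" "lipschitz_fun K' F'"
  shows "lipschitz_fun (K + K') (\<lambda>w \<theta>. F w \<theta> + F' w \<theta>)"
  unfolding lipschitz_fun_def
proof (intro ballI)
  fix w1 w2 \<theta>1 \<theta>2 assume "w1 \<in> W" "w2 \<in> W" "\<theta>1 \<in> \<Theta>" "\<theta>2 \<in> \<Theta>"
  with lipschitz_funD[OF assms(1) this] lipschitz_funD[OF assms(2) this]
  show "\<bar>F w1 \<theta>1 + F' w1 \<theta>1 - (F w2 \<theta>2 + F' w2 \<theta>2)\<bar> \<le> (K + K') * Nz ((w1, \<theta>1) - (w2, \<theta>2))"
    by (simp add: distrib_right)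
qed

lemma sc_sc_add: "sc_sc \<mu> F \<Longrightarrow> sc_sc \<nu> F' \<Longrightarrow> sc_sc (\<mu> + \<nu>) (\<lambda>w \<theta>. F w \<theta> + F' w \<theta>)"
  unfolding sc_sc_def
  using strongly_convex_on_add[of W Nw \<mu> "\<lambda>w. F w _" \<nu> "\<lambda>w. F' w _"]
    strongly_convex_on_add[of \<Theta> Nt \<mu> "\<lambda>\<theta>. - F _ \<theta>" \<nu> "\<lambda>\<theta>. - F' _ \<theta>"] by simp

lemma convex_concave_imp_sc_sc:
  assumes "\<And>\<theta>. \<theta> \<in> \<Theta> \<Longrightarrow> convex_on W (\<lambda>w. F w \<theta>)" "\<And>w. w \<in> W \<Longrightarrow> concave_on \<Theta> (F w)"
  shows "sc_sc 0 F"
  using assms unfolding sc_sc_def concave_on_def by (auto intro: convex_on_imp_strongly_convex_on)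

end

section \<open>Empirical and population saddle points\<close>

locale stochastic_saddle = saddle_domain W \<Theta> Nw Nt
  for W :: "'w::euclidean_space set" and \<Theta> :: "'t::euclidean_space set" and Nw Nt +
  fixes D :: "'x measure" and f :: "('w, 't, 'x) loss" and L B :: real
  assumes prob_D: "prob_space D"
    and cc: "convex_concave W \<Theta> (space D) f"
    and lip: "lipschitz_loss Nw Nt W \<Theta> (space D) L f"
    and int: "\<And>w \<theta>. w \<in> W \<Longrightarrow> \<theta> \<in> \<Theta> \<Longrightarrow> integrable D (f w \<theta>)"
    and L: "0 < L" and diam: "norm_diameter Nz (W \<times> \<Theta>) = B"
begin

sublocale D: prob_space D by (rule prob_D)

abbreviation (input) samples :: "nat \<Rightarrow> (nat \<Rightarrow> 'x) measure" where
  "samples m \<equiv> Pi\<^sub>M {..<m} (\<lambda>_. D)"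

lemma prob_samples: "prob_space (samples m)"
  by (intro prob_space_PiM prob_D)

lemma samples_component: "S \<in> space (samples m) \<Longrightarrow> i < m \<Longrightarrow> S i \<in> space D"
  by (auto simp: space_PiM)

lemma samples_update:
  "S \<in> space (samples m) \<Longrightarrow> i < m \<Longrightarrow> x \<in> space D \<Longrightarrow> S(i := x) \<in> space (samples m)"
  unfolding space_PiM using PiE_fun_upd[of x "\<lambda>_. space D" i S "{..<m}"] by (simp add: insert_absorb)

lemma Nz_le_B: "z \<in> W \<times> \<Theta> \<Longrightarrow> z' \<in> W \<times> \<Theta> \<Longrightarrow> Nz (z - z') \<le> B"
  using Nz_diff_le_diameter[of z z'] diam by simp

lemma lipschitz_fun_f: "x \<in> space D \<Longrightarrow> lipschitz_fun L (\<lambda>w \<theta>. f w \<theta> x)"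
  using lip unfolding lipschitz_loss_def lipschitz_fun_def by blast

lemma measurable_f: "w \<in> W \<Longrightarrow> \<theta> \<in> \<Theta> \<Longrightarrow> f w \<theta> \<in> borel_measurable D"
  using int by blast

lemma lipschitz_fun_population_risk: "lipschitz_fun L (population_risk D f)"
  unfolding lipschitz_fun_def population_risk_def
proof (intro ballI)
  fix w1 w2 \<theta>1 \<theta>2 assume *: "w1 \<in> W" "w2 \<in> W" "\<theta>1 \<in> \<Theta>" "\<theta>2 \<in> \<Theta>"
  have "\<bar>(\<integral>x. f w1 \<theta>1 x \<partial>D) - (\<integral>x. f w2 \<theta>2 x \<partial>D)\<bar> = \<bar>\<integral>x. f w1 \<theta>1 x - f w2 \<theta>2 x \<partial>D\<bar>"
    using * int by simp
  also have "\<dots> \<le> (\<integral>x. \<bar>f w1 \<theta>1 x - f w2 \<theta>2 x\<bar> \<partial>D)"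
    by (rule integral_abs_bound)
  also have "\<dots> \<le> L * Nz ((w1, \<theta>1) - (w2, \<theta>2))"
    using * int lipschitz_funD[OF lipschitz_fun_f *] by (intro prob_space_integral_le prob_D) auto
  finally show "\<bar>(\<integral>x. f w1 \<theta>1 x \<partial>D) - (\<integral>x. f w2 \<theta>2 x \<partial>D)\<bar> \<le> L * Nz ((w1, \<theta>1) - (w2, \<theta>2))" .
qed

lemma convex_on_population_risk:
  assumes "\<theta> \<in> \<Theta>"
  shows "convex_on W (\<lambda>w. population_risk D f w \<theta>)"
proof (rule convex_onI[OF _ convex_W])
  fix t x y assume t: "0 < (t::real)" "t < 1" and xy: "x \<in> W" "y \<in> W"
  have "(1 - t) *\<^sub>R x + t *\<^sub>R y \<in> W" using t xy by (intro convexD[OF convex_W]) auto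
  then have "(\<integral>s. f ((1 - t) *\<^sub>R x + t *\<^sub>R y) \<theta> s \<partial>D) \<le> (\<integral>s. (1 - t) * f x \<theta> s + t * f y \<theta> s \<partial>D)"
    using cc t xy assms unfolding convex_concave_def
    by (intro integral_mono Bochner_Integration.integrable_add integrable_mult_right int) (auto intro!: convex_onD)
  then show "population_risk D f ((1 - t) *\<^sub>R x + t *\<^sub>R y) \<theta>
      \<le> (1 - t) * population_risk D f x \<theta> + t * population_risk D f y \<theta>"
    unfolding population_risk_def using int xy assms by simp
qed

lemma concave_on_population_risk:
  assumes "w \<in> W"
  shows "concave_on \<Theta> (population_risk D f w)"
  unfolding concave_on_def
proof (rule convex_onI[OF _ convex_Th])
  fix t x y assume t: "0 < (t::real)" "t < 1" and xy: "x \<in> \<Theta>" "y \<in> \<Theta>"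
  have in_Th: "(1 - t) *\<^sub>R x + t *\<^sub>R y \<in> \<Theta>" using t xy by (intro convexD[OF convex_Th]) auto
  have "(1 - t) * f w x s + t * f w y s \<le> f w ((1 - t) *\<^sub>R x + t *\<^sub>R y) s" if "s \<in> space D" for s
    using convex_onD[of \<Theta> "\<lambda>\<theta>. - f w \<theta> s" t x y] cc t xy assms that
    unfolding convex_concave_def concave_on_def by auto
  then have "(\<integral>s. (1 - t) * f w x s + t * f w y s \<partial>D) \<le> (\<integral>s. f w ((1 - t) *\<^sub>R x + t *\<^sub>R y) s \<partial>D)"
    using in_Th xy assms
    by (intro integral_mono Bochner_Integration.integrable_add integrable_mult_right int) auto
  then show "- population_risk D f w ((1 - t) *\<^sub>R x + t *\<^sub>R y)
      \<le> (1 - t) * - population_risk D f w x + t * - population_risk D f w y"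
    unfolding population_risk_def using int xy assms by simp
qed

lemma sc_sc_population_risk: "sc_sc 0 (population_risk D f)"
  using convex_on_population_risk concave_on_population_risk by (intro convex_concave_imp_sc_sc) auto

lemma sc_sc_empirical_risk:
  assumes S: "S \<in> space (samples m)"
  shows "sc_sc 0 (empirical_risk m S f)"
proof -
  have S': "S i \<in> space D" if "i < m" for i using samples_component[OF S that] .
  have "strongly_convex_on W Nw (1 / m * (\<Sum>i<m. 0)) (\<lambda>w. 1 / m * (\<Sum>i<m. f w \<theta> (S i)))" if "\<theta> \<in> \<Theta>" for \<theta>
    using cc that S' unfolding convex_concave_def
    by (intro strongly_convex_on_scale strongly_convex_on_sum convex_on_imp_strongly_convex_on) auto
  moreover have "strongly_convex_on \<Theta> Nt (1 / m * (\<Sum>i<m. 0)) (\<lambda>\<theta>. 1 / m * (\<Sum>i<m. - f w \<theta> (S i)))" if "w \<in> W" for w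
    using cc that S' unfolding convex_concave_def concave_on_def
    by (intro strongly_convex_on_scale strongly_convex_on_sum convex_on_imp_strongly_convex_on) auto
  ultimately show ?thesis
    unfolding sc_sc_def empirical_risk_def by (simp add: sum_negf)
qed

lemma lipschitz_fun_empirical_risk:
  assumes S: "S \<in> space (samples m)"
  shows "lipschitz_fun L (empirical_risk m S f)"
  unfolding lipschitz_fun_def
proof (intro ballI)
  fix w1 w2 \<theta>1 \<theta>2 assume *: "w1 \<in> W" "w2 \<in> W" "\<theta>1 \<in> \<Theta>" "\<theta>2 \<in> \<Theta>"
  let ?d = "L * Nz ((w1, \<theta>1) - (w2, \<theta>2))"
  have d: "0 \<le> ?d" using L is_norm_nonneg[OF Nz] by simp
  have S': "S i \<in> space D" if "i < m" for i using samples_component[OF S that] .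
  have "\<bar>empirical_risk m S f w1 \<theta>1 - empirical_risk m S f w2 \<theta>2\<bar> = \<bar>\<Sum>i<m. f w1 \<theta>1 (S i) - f w2 \<theta>2 (S i)\<bar> / m"
    by (simp add: empirical_risk_def sum_subtractf diff_divide_distrib[symmetric])
  also have "\<dots> \<le> (\<Sum>i<m. ?d) / m"
    using lipschitz_funD[OF lipschitz_fun_f *] S'
    by (intro divide_right_mono order_trans[OF sum_abs] sum_mono) auto
  \<comment> \<open>For \<open>m = 0\<close> the quotient is 0 by division by zero, and
    \<open>0 \<le> ?d\<close> settles this case.\<close>
  also have "\<dots> \<le> ?d" using d by (cases "m = 0") auto
  finally show "\<bar>empirical_risk m S f w1 \<theta>1 - empirical_risk m S f w2 \<theta>2\<bar> \<le> ?d" .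
qed

lemma measurable_empirical_risk:
  assumes "w \<in> W" "\<theta> \<in> \<Theta>"
  shows "(\<lambda>S. empirical_risk m S f w \<theta>) \<in> borel_measurable (samples m)"
proof -
  have "(\<lambda>S. f w \<theta> (S i)) \<in> borel_measurable (samples m)" if "i < m" for i
    by (rule measurable_compose[OF _ measurable_f[OF assms]]) (use that in simp)
  then show ?thesis
    unfolding empirical_risk_def by (intro borel_measurable_divide borel_measurable_sum) auto
qed

text \<open>\<open>R\<close> is deterministic: earlier rounds enter only through it, so that the
  estimates for \<open>emp_saddle\<close> and \<open>pop_saddle\<close> are conditional on the
  history.\<close>

definition emp_saddle :: "nat \<Rightarrow> ('w \<Rightarrow> 't \<Rightarrow> real) \<Rightarrow> (nat \<Rightarrow> 'x) \<Rightarrow> 'w \<times> 't" where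
  "emp_saddle m R S = saddle (\<lambda>w \<theta>. empirical_risk m S f w \<theta> + R w \<theta>)"

definition pop_saddle :: "('w \<Rightarrow> 't \<Rightarrow> real) \<Rightarrow> 'w \<times> 't" where
  "pop_saddle R = saddle (\<lambda>w \<theta>. population_risk D f w \<theta> + R w \<theta>)"

section \<open>Stability and generalization under a fixed regularizer\<close>

context
  fixes R :: "'w \<Rightarrow> 't \<Rightarrow> real" and \<mu> K :: real
  assumes R_sc: "sc_sc \<mu> R" and R_lip: "lipschitz_fun K R" and \<mu>: "0 < \<mu>"
begin

lemma sc_sc_emp: "S \<in> space (samples m) \<Longrightarrow> sc_sc \<mu> (\<lambda>w \<theta>. empirical_risk m S f w \<theta> + R w \<theta>)"
  using sc_sc_add[OF sc_sc_empirical_risk R_sc] by simp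

lemma sc_sc_pop: "sc_sc \<mu> (\<lambda>w \<theta>. population_risk D f w \<theta> + R w \<theta>)"
  using sc_sc_add[OF sc_sc_population_risk R_sc] by simp

lemma saddle_point_pop_saddle: "saddle_point W \<Theta> (\<lambda>w \<theta>. population_risk D f w \<theta> + R w \<theta>) (pop_saddle R)"
  unfolding pop_saddle_def
  by (rule saddle_point_saddle[OF sc_sc_pop \<mu> lipschitz_fun_add[OF lipschitz_fun_population_risk R_lip]])

lemma saddle_point_emp_saddle:
  "S \<in> space (samples m) \<Longrightarrow>
    saddle_point W \<Theta> (\<lambda>w \<theta>. empirical_risk m S f w \<theta> + R w \<theta>) (emp_saddle m R S)"
  unfolding emp_saddle_def
  by (rule saddle_point_saddle[OF sc_sc_emp \<mu> lipschitz_fun_add[OF lipschitz_fun_empirical_risk R_lip]])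

lemma pop_saddle_in: "pop_saddle R \<in> W \<times> \<Theta>"
  using saddle_point_pop_saddle unfolding saddle_point_def by blast

lemma emp_saddle_in: "S \<in> space (samples m) \<Longrightarrow> emp_saddle m R S \<in> W \<times> \<Theta>"
  using saddle_point_emp_saddle unfolding saddle_point_def by blast

lemma measurable_emp_saddle: "emp_saddle m R \<in> borel_measurable (samples m)"
proof -
  have "(\<lambda>S. saddle (\<lambda>w \<theta>. empirical_risk m S f w \<theta> + R w \<theta>)) \<in> borel_measurable (samples m)"
    by (rule measurable_saddle[OF _ lipschitz_fun_add[OF lipschitz_fun_empirical_risk R_lip] sc_sc_emp \<mu>])
       (auto intro!: borel_measurable_add measurable_empirical_risk)
  then show ?thesis unfolding emp_saddle_def[abs_def] .
qed

text \<open>In the difference of the two objectives \<open>R\<close> and all but one summand cancel,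
  so its variation between the swapped points is at most \<open>2 * L / m\<close> times the distance
  of the saddle points. This is the perturbation that \<open>saddle_point_stability\<close> asks
  for.\<close>

lemma emp_saddle_replace_one:
  assumes S: "S \<in> space (samples m)" and x: "x \<in> space D" and i: "i < m"
  shows "Nz (emp_saddle m R S - emp_saddle m R (S(i := x))) \<le> 2 * L / (\<mu> * m)"
proof -
  let ?S = "S(i := x)"
  have S': "?S \<in> space (samples m)" and Si: "S i \<in> space D"
    using samples_update[OF S i x] samples_component[OF S i] .
  define z where "z = emp_saddle m R S"
  define z' where "z' = emp_saddle m R ?S"
  have z: "z \<in> W \<times> \<Theta>" "z' \<in> W \<times> \<Theta>" using emp_saddle_in S S' by (auto simp: z_def z'_def)
  have diff: "empirical_risk m S f w \<theta> - empirical_risk m ?S f w \<theta> = (f w \<theta> (S i) - f w \<theta> x) / m" for w \<theta>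
  proof -
    have "(\<Sum>j<m. f w \<theta> (?S j)) = f w \<theta> x + (\<Sum>j\<in>{..<m} - {i}. f w \<theta> (S j))"
      using i by (subst sum.remove[of _ i]) auto
    moreover have "(\<Sum>j<m. f w \<theta> (S j)) = f w \<theta> (S i) + (\<Sum>j\<in>{..<m} - {i}. f w \<theta> (S j))"
      using i by (subst sum.remove[of _ i]) auto
    ultimately show ?thesis by (simp add: empirical_risk_def diff_divide_distrib[symmetric])
  qed
  \<comment> \<open>Exchanging the coordinates reverses the sign of one of them only, which the pair
    norm does not see.\<close>
  have flip: "Nz ((fst z', snd z) - (fst z, snd z')) = Nz (z - z')"
    by (simp add: pair_norm_def is_norm_diff_commute[OF Nw])
  have f_le: "\<bar>f (fst z') (snd z) y - f (fst z) (snd z') y\<bar> \<le> L * Nz (z - z')" if "y \<in> space D" for y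
    using lipschitz_funD[OF lipschitz_fun_f[OF that], of "fst z'" "fst z" "snd z" "snd z'"] z flip by auto
  have "\<mu> * Nz (z - z') \<le> 2 * L / m"
  proof (rule saddle_point_stability[OF sc_sc_emp[OF S] sc_sc_emp[OF S']
        saddle_point_emp_saddle[OF S, folded z_def] saddle_point_emp_saddle[OF S', folded z'_def]])
    have "(empirical_risk m S f (fst z') (snd z) - empirical_risk m ?S f (fst z') (snd z))
        - (empirical_risk m S f (fst z) (snd z') - empirical_risk m ?S f (fst z) (snd z'))
      = ((f (fst z') (snd z) (S i) - f (fst z) (snd z') (S i)) - (f (fst z') (snd z) x - f (fst z) (snd z') x)) / m"
      by (simp only: diff) (simp add: diff_divide_distrib)
    also have "\<dots> \<le> (2 * (L * Nz (z - z'))) / m"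
      using f_le[OF Si] f_le[OF x] by (intro divide_right_mono) auto
    finally show "(empirical_risk m S f (fst z') (snd z) + R (fst z') (snd z) -
         (empirical_risk m ?S f (fst z') (snd z) + R (fst z') (snd z))) -
        (empirical_risk m S f (fst z) (snd z') + R (fst z) (snd z') -
         (empirical_risk m ?S f (fst z) (snd z') + R (fst z) (snd z')))
        \<le> 2 * L / m * Nz (z - z')" by simp
  qed (use L in simp)
  then show ?thesis using \<mu> i by (simp add: z_def z'_def field_simps)
qed

text \<open>The comparator is the population saddle point, which does not depend on the sample; the
  sample enters only through \<open>z\<close>.\<close>

definition partial_gap :: "'w \<times> 't \<Rightarrow> 'x \<Rightarrow> real" where
  "partial_gap z x = f (fst z) (snd (pop_saddle R)) x - f (fst (pop_saddle R)) (snd z) x"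

lemma partial_gap_bound:
  assumes z: "z \<in> W \<times> \<Theta>" and x: "x \<in> space D"
  shows "\<bar>partial_gap z x\<bar> \<le> L * B"
proof -
  let ?p = "pop_saddle R"
  have "\<bar>partial_gap z x\<bar> \<le> L * Nz ((fst z, snd ?p) - (fst ?p, snd z))"
    unfolding partial_gap_def using z pop_saddle_in by (intro lipschitz_funD[OF lipschitz_fun_f[OF x]]) auto
  also have "\<dots> \<le> L * B"
    using z pop_saddle_in L by (intro mult_left_mono Nz_le_B) (auto simp: mem_Times_iff)
  finally show ?thesis .
qed

lemma partial_gap_lipschitz:
  assumes z: "z \<in> W \<times> \<Theta>" "z' \<in> W \<times> \<Theta>" and x: "x \<in> space D"
  shows "\<bar>partial_gap z x - partial_gap z' x\<bar> \<le> 2 * L * Nz (z - z')"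
proof -
  let ?p = "pop_saddle R"
  have "\<bar>f (fst z) (snd ?p) x - f (fst z') (snd ?p) x\<bar> \<le> L * Nz (z - z')"
  proof -
    have "\<bar>f (fst z) (snd ?p) x - f (fst z') (snd ?p) x\<bar> \<le> L * Nz ((fst z, snd ?p) - (fst z', snd ?p))"
      using z pop_saddle_in by (intro lipschitz_funD[OF lipschitz_fun_f[OF x]]) auto
    also have "\<dots> \<le> L * Nz (z - z')"
      using L Nw_le_Nz[of "z - z'"] by (simp add: Nz_eq_Nw)
    finally show ?thesis .
  qed
  moreover have "\<bar>f (fst ?p) (snd z) x - f (fst ?p) (snd z') x\<bar> \<le> L * Nz (z - z')"
  proof -
    have "\<bar>f (fst ?p) (snd z) x - f (fst ?p) (snd z') x\<bar> \<le> L * Nz ((fst ?p, snd z) - (fst ?p, snd z'))"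
      using z pop_saddle_in by (intro lipschitz_funD[OF lipschitz_fun_f[OF x]]) auto
    also have "\<dots> \<le> L * Nz (z - z')"
      using L Nt_le_Nz[of "z - z'"] by (simp add: Nz_eq_Nt)
    finally show ?thesis .
  qed
  ultimately show ?thesis unfolding partial_gap_def by linarith
qed

lemma measurable_partial_gap:
  assumes g: "g \<in> borel_measurable M" "\<And>y. y \<in> space M \<Longrightarrow> g y \<in> W \<times> \<Theta>" and h: "h \<in> M \<rightarrow>\<^sub>M D"
  shows "(\<lambda>y. partial_gap (g y) (h y)) \<in> borel_measurable M"
proof (rule measurable_Caratheodory_compose[where F = "\<lambda>y z. partial_gap z (h y)" and g = g, OF g])
  fix z assume "z \<in> W \<times> \<Theta>"
  then have "partial_gap z \<in> borel_measurable D"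
    unfolding partial_gap_def[abs_def] using pop_saddle_in by (intro borel_measurable_diff measurable_f) auto
  then show "(\<lambda>y. partial_gap z (h y)) \<in> borel_measurable M" using h by measurable
next
  fix y assume "y \<in> space M"
  then have "h y \<in> space D" using measurable_space[OF h] by blast
  then have "lipschitz_fun (2 * L) (\<lambda>w \<theta>. partial_gap (w, \<theta>) (h y))"
    unfolding lipschitz_fun_def using partial_gap_lipschitz by auto
  from lipschitz_fun_continuous_on[OF this]
  show "continuous_on (W \<times> \<Theta>) (\<lambda>z. partial_gap z (h y))" by simp
qed

text \<open>
  Stability turns into generalization: the empirical saddle point is exactly optimal for the
  empirical risk, and replacing one sample point moves it by \<open>O(L / (\<mu> m))\<close>.
\<close>

lemma expected_distance_emp_pop_saddle_power2:
  assumes m: "0 < m"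
  shows "(\<integral>S. (Nz (emp_saddle m R S - pop_saddle R))\<^sup>2 \<partial>samples m) \<le> 8 * L\<^sup>2 / (\<mu>\<^sup>2 * m)"
proof -
  let ?P = "samples m" and ?p = "emp_saddle m R" and ?zs = "pop_saddle R"
  interpret P: prob_space ?P by (rule prob_samples)
  note [measurable] = measurable_emp_saddle
  have comp[measurable]: "(\<lambda>S. S i) \<in> ?P \<rightarrow>\<^sub>M D" if "i < m" for i using that by simp
  have spi: "S i \<in> space D" if "S \<in> space ?P" "i < m" for S i
    using samples_component that .
  have spu: "S(i := x) \<in> space ?P" if "S \<in> space ?P" "x \<in> space D" "i < m" for S x i
    using samples_update that by blast
  define G where "G = (\<lambda>(S, x). partial_gap (?p S) x)"
  have G[measurable]: "G \<in> borel_measurable (?P \<Otimes>\<^sub>M D)"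
    unfolding G_def case_prod_beta'
    by (intro measurable_partial_gap measurable_compose[OF measurable_fst measurable_emp_saddle])
       (auto simp: space_pair_measure intro: emp_saddle_in)
  have G_bound: "\<bar>G (S, x)\<bar> \<le> L * B" if "S \<in> space ?P" "x \<in> space D" for S x
    unfolding G_def using partial_gap_bound emp_saddle_in that by simp
  have mG': "(\<lambda>(S, x). G (S(i := x), S i)) \<in> borel_measurable (?P \<Otimes>\<^sub>M D)" if i: "i < m" for i
  proof -
    have [measurable]: "(\<lambda>(S, x). S(i := x)) \<in> ?P \<Otimes>\<^sub>M D \<rightarrow>\<^sub>M ?P"
      using measurable_add_dim[of i "{..<m}" "\<lambda>_. D"] i by (simp add: insert_absorb)
    note comp[OF i, measurable]
    have "(\<lambda>z. (case z of (S, x) \<Rightarrow> S(i := x), fst z i)) \<in> ?P \<Otimes>\<^sub>M D \<rightarrow>\<^sub>M ?P \<Otimes>\<^sub>M D" by measurable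
    from measurable_compose[OF this G] show ?thesis by (simp add: case_prod_beta')
  qed
  have intG': "integrable ?P (\<lambda>S. G (S, S i))" if "i < m" for i
  proof -
    note comp[OF that, measurable]
    show ?thesis
      using G_bound spi that by (intro prob_space_integrable_bounded[OF prob_samples, where C = "L * B"]) auto
  qed
  have Gx: "(\<lambda>x. G (S, x)) \<in> borel_measurable D" if "S \<in> space ?P" for S using that by measurable
  have intGx: "integrable D (\<lambda>x. G (S, x))" if "S \<in> space ?P" for S
    using G_bound Gx that by (intro prob_space_integrable_bounded[OF prob_D, where C = "L * B"]) auto
  have "\<bar>\<integral>x. G (S, x) \<partial>D\<bar> \<le> L * B" if "S \<in> space ?P" for S
    using G_bound intGx that by (intro prob_space_abs_integral_le[OF prob_D]) auto
  then have intGG: "integrable ?P (\<lambda>S. \<integral>x. G (S, x) \<partial>D)"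
    by (intro prob_space_integrable_bounded[OF prob_samples, where C = "L * B"] D.borel_measurable_lebesgue_integral) simp_all
  \<comment> \<open>After \<open>S i\<close> and the fresh point are exchanged, both terms are
    evaluated at the data point \<open>S i\<close>. Only the empirical saddle point has moved, by at
    most the bound of \<open>emp_saddle_replace_one\<close>.\<close>
  have swap: "(\<integral>S. \<integral>x. G (S, x) \<partial>D \<partial>?P) - (\<integral>S. G (S, S i) \<partial>?P) \<le> 4 * L\<^sup>2 / (\<mu> * m)" if i: "i < m" for i
  proof -
    have G'x: "integrable D (\<lambda>x. G (S(i := x), S i))" if S: "S \<in> space ?P" for S
    proof (rule prob_space_integrable_bounded[OF prob_D, where C = "L * B"])
      show "(\<lambda>x. G (S(i := x), S i)) \<in> borel_measurable D"
        using measurable_compose[OF measurable_Pair1'[OF S] mG'[OF i]] by simp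
    qed (use G_bound spu spi S i in auto)
    have G'x_bound: "\<bar>\<integral>x. G (S(i := x), S i) \<partial>D\<bar> \<le> L * B" if S: "S \<in> space ?P" for S
      using G_bound spu spi G'x that i by (intro prob_space_abs_integral_le[OF prob_D]) auto
    have int2: "integrable ?P (\<lambda>S. \<integral>x. G (S(i := x), S i) \<partial>D)"
      using G'x_bound mG'[OF i]
      by (intro prob_space_integrable_bounded[OF prob_samples, where C = "L * B"] D.borel_measurable_lebesgue_integral) simp_all
    have "(\<integral>S. \<integral>x. G (S, x) \<partial>D \<partial>?P) - (\<integral>S. G (S, S i) \<partial>?P)
        = (\<integral>S. (\<integral>x. G (S(i := x), S i) \<partial>D) - G (S, S i) \<partial>?P)"
      using integral_PiM_swap_fresh[OF prob_D i G G_bound] int2 intG'[OF i] by simp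
    also have "\<dots> \<le> 4 * L\<^sup>2 / (\<mu> * m)"
    proof (rule prob_space_integral_le[OF prob_samples])
      show "integrable ?P (\<lambda>S. (\<integral>x. G (S(i := x), S i) \<partial>D) - G (S, S i))"
        using int2 intG'[OF i] by simp
      fix S assume S: "S \<in> space ?P"
      have "(\<integral>x. G (S(i := x), S i) \<partial>D) - G (S, S i) = (\<integral>x. G (S(i := x), S i) - G (S, S i) \<partial>D)"
        using G'x[OF S] by (simp add: D.prob_space)
      also have "\<dots> \<le> 4 * L\<^sup>2 / (\<mu> * m)"
      proof (rule prob_space_integral_le[OF prob_D])
        show "integrable D (\<lambda>x. G (S(i := x), S i) - G (S, S i))" using G'x[OF S] by simp
        fix x assume x: "x \<in> space D"
        have "G (S(i := x), S i) - G (S, S i) \<le> 2 * L * Nz (?p (S(i := x)) - ?p S)"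
          using partial_gap_lipschitz[OF emp_saddle_in[OF spu[OF S x i]] emp_saddle_in[OF S] spi[OF S i]]
          unfolding G_def by simp
        also have "\<dots> \<le> 2 * L * (2 * L / (\<mu> * m))"
          using emp_saddle_replace_one[OF S x i] L is_norm_diff_commute[OF Nz, of "?p S"]
          by (intro mult_left_mono) auto
        finally show "G (S(i := x), S i) - G (S, S i) \<le> 4 * L\<^sup>2 / (\<mu> * m)"
          by (simp add: power2_eq_square)
      qed
      finally show "(\<integral>x. G (S(i := x), S i) \<partial>D) - G (S, S i) \<le> 4 * L\<^sup>2 / (\<mu> * m)" .
    qed
    finally show ?thesis .
  qed
  \<comment> \<open>Growth at the population saddle point brings in the regularizer gap
    \<open>r\<close>; optimality of the empirical saddle point bounds \<open>r\<close> by minus the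
    empirical term and thereby eliminates it.\<close>
  have pointwise: "\<mu> / 2 * (Nz (?p S - ?zs))\<^sup>2 \<le> (\<integral>x. G (S, x) \<partial>D) - (\<Sum>i<m. G (S, S i)) / m" if S: "S \<in> space ?P" for S
  proof -
    have ps: "fst (?p S) \<in> W" "snd (?p S) \<in> \<Theta>" "fst ?zs \<in> W" "snd ?zs \<in> \<Theta>"
      using emp_saddle_in[OF S] pop_saddle_in by (auto simp: mem_Times_iff)
    define r where "r = R (fst (?p S)) (snd ?zs) - R (fst ?zs) (snd (?p S))"
    have "\<mu> / 2 * (Nz (?p S - ?zs))\<^sup>2 \<le> (\<integral>x. G (S, x) \<partial>D) + r"
      using saddle_point_growth[OF sc_sc_pop saddle_point_pop_saddle emp_saddle_in[OF S]] int ps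
      unfolding G_def r_def partial_gap_def population_risk_def by simp
    moreover have "(\<Sum>i<m. G (S, S i)) / m + r \<le> 0"
      using saddle_point_gap_nonpos[OF saddle_point_emp_saddle[OF S] pop_saddle_in]
      unfolding G_def r_def partial_gap_def empirical_risk_def
      by (simp add: sum_subtractf diff_divide_distrib)
    ultimately show ?thesis by linarith
  qed
  have intd: "integrable ?P (\<lambda>S. (Nz (?p S - ?zs))\<^sup>2)"
  proof (rule prob_space_integrable_bounded[OF prob_samples, where C = "B\<^sup>2"])
    note measurable_Nz [measurable]
    show "(\<lambda>S. (Nz (?p S - ?zs))\<^sup>2) \<in> borel_measurable ?P" by measurable
    show "\<bar>(Nz (?p S - ?zs))\<^sup>2\<bar> \<le> B\<^sup>2" if "S \<in> space ?P" for S
      using Nz_le_B[OF emp_saddle_in[OF that] pop_saddle_in] is_norm_nonneg[OF Nz] by (simp add: power_mono)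
  qed
  have "\<mu> / 2 * (\<integral>S. (Nz (?p S - ?zs))\<^sup>2 \<partial>?P) = (\<integral>S. \<mu> / 2 * (Nz (?p S - ?zs))\<^sup>2 \<partial>?P)" by simp
  also have "\<dots> \<le> (\<integral>S. (\<integral>x. G (S, x) \<partial>D) - (\<Sum>i<m. G (S, S i)) / m \<partial>?P)"
    using intd intGG intG' pointwise
    by (intro integral_mono Bochner_Integration.integrable_diff integrable_divide Bochner_Integration.integrable_sum integrable_mult_right) auto
  also have "\<dots> = (\<integral>S. \<integral>x. G (S, x) \<partial>D \<partial>?P) - (\<Sum>i<m. \<integral>S. G (S, S i) \<partial>?P) / m"
    using intGG intG'
    by (subst Bochner_Integration.integral_diff)
       (auto simp: Bochner_Integration.integral_sum intro!: integrable_divide Bochner_Integration.integrable_sum)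
  also have "\<dots> = (\<Sum>i<m. (\<integral>S. \<integral>x. G (S, x) \<partial>D \<partial>?P) - (\<integral>S. G (S, S i) \<partial>?P)) / m"
    using m by (simp add: sum_subtractf field_simps)
  also have "\<dots> \<le> (\<Sum>i<m. 4 * L\<^sup>2 / (\<mu> * m)) / m"
    using swap by (intro divide_right_mono sum_mono) auto
  also have "\<dots> = 4 * L\<^sup>2 / (\<mu> * m)" using m by simp
  finally show ?thesis using \<mu> m by (simp add: field_simps power2_eq_square)
qed

lemma integrable_distance_emp_saddle:
  assumes q: "q \<in> W \<times> \<Theta>"
  shows "integrable (samples m) (\<lambda>S. Nz (emp_saddle m R S - q))"
proof (rule prob_space_integrable_bounded[OF prob_samples, where C = B])
  note [measurable] = measurable_emp_saddle
  note measurable_Nz [measurable]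
  show "(\<lambda>S. Nz (emp_saddle m R S - q)) \<in> borel_measurable (samples m)" by measurable
  show "\<bar>Nz (emp_saddle m R S - q)\<bar> \<le> B" if "S \<in> space (samples m)" for S
    using Nz_le_B[OF emp_saddle_in[OF that] q] is_norm_nonneg[OF Nz] by simp
qed

text \<open>The first moment is obtained from the second by the pointwise inequality
  \<open>r \<le> r^2 / (2 * \<eta>) + \<eta> / 2\<close>, sharp at
  \<open>r = \<eta>\<close>.\<close>

lemma expected_distance_emp_pop_saddle:
  assumes m: "0 < m" and \<eta>: "0 < \<eta>" and small: "8 * L\<^sup>2 / (\<mu>\<^sup>2 * m) \<le> \<eta>\<^sup>2"
  shows "(\<integral>S. Nz (emp_saddle m R S - pop_saddle R) \<partial>samples m) \<le> \<eta>"
proof -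
  let ?r = "\<lambda>S. Nz (emp_saddle m R S - pop_saddle R)"
  interpret P: prob_space "samples m" by (rule prob_samples)
  have i1: "integrable (samples m) ?r" by (rule integrable_distance_emp_saddle[OF pop_saddle_in])
  have i2: "integrable (samples m) (\<lambda>S. (?r S)\<^sup>2)"
    using i1 Nz_le_B[OF emp_saddle_in pop_saddle_in] is_norm_nonneg[OF Nz]
    by (intro prob_space_integrable_bounded[OF prob_samples, where C = "B\<^sup>2"])
       (simp_all add: power_mono)
  have "?r S \<le> (?r S)\<^sup>2 / (2 * \<eta>) + \<eta> / 2" for S
    using \<eta> zero_le_power2[of "?r S - \<eta>"] by (simp add: field_simps power2_eq_square)
  then have "(\<integral>S. ?r S \<partial>samples m) \<le> (\<integral>S. (?r S)\<^sup>2 / (2 * \<eta>) + \<eta> / 2 \<partial>samples m)"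
    using i1 i2 by (intro integral_mono) auto
  also have "\<dots> = (\<integral>S. (?r S)\<^sup>2 \<partial>samples m) / (2 * \<eta>) + \<eta> / 2"
    using i2 by (simp add: P.prob_space)
  also have "\<dots> \<le> \<eta>\<^sup>2 / (2 * \<eta>) + \<eta> / 2"
    using order_trans[OF expected_distance_emp_pop_saddle_power2[OF m] small] \<eta>
    by (intro add_mono divide_right_mono) auto
  also have "\<dots> = \<eta>" using \<eta> by (simp add: power2_eq_square)
  finally show ?thesis .
qed

end

end

section \<open>One round of the algorithm\<close>

lemma measurable_prob_algebra_space:
  assumes "K \<in> M \<rightarrow>\<^sub>M prob_algebra N" "x \<in> space M"
  shows "prob_space (K x)" "sets (K x) = sets N" "space (K x) = space N"
proof -
  show "prob_space (K x)" "sets (K x) = sets N"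
    using measurable_space[OF assms] by (simp_all add: space_prob_algebra)
  then show "space (K x) = space N" by (metis sets_eq_imp_space_eq)
qed

lemma integral_bind_prob:
  fixes f :: "'b \<Rightarrow> real"
  assumes M: "prob_space M" and K: "K \<in> M \<rightarrow>\<^sub>M prob_algebra N"
    and f: "f \<in> borel_measurable N" and bound: "\<And>y. y \<in> space N \<Longrightarrow> \<bar>f y\<bar> \<le> C"
  shows "integral\<^sup>L (M \<bind> K) f = (\<integral>x. integral\<^sup>L (K x) f \<partial>M)" (is ?A)
    and "integrable M (\<lambda>x. integral\<^sup>L (K x) f)" (is ?B)
    and "integrable (M \<bind> K) f" (is ?C)
proof -
  interpret prob_space M by fact
  have emb: "AE x in M. emeasure (K x) (space (K x)) \<le> ennreal 1"
    using prob_space.emeasure_space_1[OF measurable_prob_algebra_space(1)[OF K]] by (intro AE_I2) simp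
  note K' = measurable_prob_algebraD[OF K]
  show ?A ?C
    using integral_bind[OF f bound K' finite_measure_axioms emb] integrable_bind[OF f bound K' finite_measure_axioms emb] by auto
  have Kf: "(\<lambda>x. integral\<^sup>L (K x) f) \<in> borel_measurable M"
    using K' f by measurable
  have "\<bar>integral\<^sup>L (K x) f\<bar> \<le> C" if "x \<in> space M" for x
  proof -
    note Kx = measurable_prob_algebra_space[OF K that]
    have "f \<in> borel_measurable (K x)" using f Kx(2) measurable_cong_sets by blast
    then have "integrable (K x) f"
      using bound Kx by (intro prob_space_integrable_bounded[where C = C]) auto
    then show ?thesis using bound Kx by (intro prob_space_abs_integral_le) auto
  qed
  with Kf show ?B by (intro prob_space_integrable_bounded[OF M]) auto
qed

text \<open>The rule by which bounds conditional on a first stage are averaged, first over datasets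
  and then over histories.\<close>

lemma integral_bind_le:
  fixes f :: "'b \<Rightarrow> real"
  assumes M: "prob_space M" and K: "K \<in> M \<rightarrow>\<^sub>M prob_algebra N"
    and f: "f \<in> borel_measurable N" and bound: "\<And>y. y \<in> space N \<Longrightarrow> \<bar>f y\<bar> \<le> C"
    and g: "integrable M g" and le: "\<And>x. x \<in> space M \<Longrightarrow> integral\<^sup>L (K x) f \<le> g x"
  shows "integral\<^sup>L (M \<bind> K) f \<le> integral\<^sup>L M g"
proof -
  have "integral\<^sup>L (M \<bind> K) f = (\<integral>x. integral\<^sup>L (K x) f \<partial>M)"
    by (rule integral_bind_prob(1)[OF M K f bound])
  also have "\<dots> \<le> integral\<^sup>L M g"
    by (rule integral_mono[OF integral_bind_prob(2)[OF M K f bound] g le])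
  finally show ?thesis .
qed

lemma sum_powers_of_two: "(\<Sum>k<t. 2 ^ (k + 1)) = (2 ^ (t + 1) - 2 :: real)"
  by (induction t) auto

context saddle_domain
begin

lemma space_point_space [simp]: "space (point_space W \<Theta>) = W \<times> \<Theta>"
  by (simp add: point_space_def space_restrict_space)

lemma measurable_point_space_continuous:
  "continuous_on (W \<times> \<Theta>) g \<Longrightarrow> g \<in> borel_measurable (point_space W \<Theta>)"
  unfolding point_space_def by (rule borel_measurable_continuous_on_restrict)

lemma measurable_point_space_borel: "(\<lambda>z. z) \<in> point_space W \<Theta> \<rightarrow>\<^sub>M borel"
  unfolding point_space_def by (rule measurable_restrict_space1) simp

lemma measurable_Nz_diff: "(\<lambda>z. Nz (z - q)) \<in> borel_measurable (point_space W \<Theta>)"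
  by (intro measurable_compose[OF _ measurable_Nz] borel_measurable_diff measurable_point_space_borel) simp

lemma saddle_point_gap_nonneg:
  assumes "saddle_point W \<Theta> F zs" "z \<in> W \<times> \<Theta>"
  shows "0 \<le> F (fst z) (snd zs) - F (fst zs) (snd z)"
  using saddle_point_gap_nonpos[OF assms] by simp

lemma lipschitz_fun_partial_gap:
  assumes F: "lipschitz_fun K F" and "0 \<le> K" and zs: "zs \<in> W \<times> \<Theta>"
  shows "(\<lambda>z. F (fst z) (snd zs) - F (fst zs) (snd z)) \<in> borel_measurable (point_space W \<Theta>)"
    and "z \<in> W \<times> \<Theta> \<Longrightarrow> \<bar>F (fst z) (snd zs) - F (fst zs) (snd z)\<bar> \<le> K * norm_diameter Nz (W \<times> \<Theta>)"
proof -
  have zs': "fst zs \<in> W" "snd zs \<in> \<Theta>" using zs by auto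
  note cont = lipschitz_fun_continuous_on[OF F]
  have c: "continuous_on (W \<times> \<Theta>) (\<lambda>z. (fst z, snd zs))" "continuous_on (W \<times> \<Theta>) (\<lambda>z. (fst zs, snd z))"
    by (intro continuous_intros)+
  have sub: "(\<lambda>z. (fst z, snd zs)) ` (W \<times> \<Theta>) \<subseteq> W \<times> \<Theta>" "(\<lambda>z. (fst zs, snd z)) ` (W \<times> \<Theta>) \<subseteq> W \<times> \<Theta>"
    using zs' by auto
  show "(\<lambda>z. F (fst z) (snd zs) - F (fst zs) (snd z)) \<in> borel_measurable (point_space W \<Theta>)"
    using continuous_on_compose2[OF cont c(1) sub(1)] continuous_on_compose2[OF cont c(2) sub(2)]
    by (intro measurable_point_space_continuous continuous_on_diff) simp_all
  assume z: "z \<in> W \<times> \<Theta>"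
  then have "\<bar>F (fst z) (snd zs) - F (fst zs) (snd z)\<bar> \<le> K * Nz ((fst z, snd zs) - (fst zs, snd z))"
    using zs' by (intro lipschitz_funD[OF F]) auto
  also have "\<dots> \<le> K * norm_diameter Nz (W \<times> \<Theta>)"
    using z zs' \<open>0 \<le> K\<close> by (intro mult_left_mono Nz_diff_le_diameter) auto
  finally show "\<bar>F (fst z) (snd zs) - F (fst zs) (snd z)\<bar> \<le> K * norm_diameter Nz (W \<times> \<Theta>)" .
qed

text \<open>
  Relative accuracy is imposed for random initial points. Starting from \<open>q\<close> with probability
  \<open>d / (d + N (q - zs))\<close> and from the saddle point itself otherwise makes the expected distance at
  most \<open>d\<close>, which yields a guarantee for every deterministic start \<open>q\<close>, near or far.
\<close>

lemma relative_accuracy_from_point: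
  assumes acc: "relative_accuracy Nw Nt W \<Theta> m A \<alpha> S f'"
    and kernel: "(\<lambda>z. A S f' z d) \<in> point_space W \<Theta> \<rightarrow>\<^sub>M prob_algebra (point_space W \<Theta>)"
    and zs: "saddle_point W \<Theta> (empirical_risk m S f') zs"
    and lip: "lipschitz_fun K (empirical_risk m S f')" "0 \<le> K"
    and q: "q \<in> W \<times> \<Theta>" and d: "0 < d"
  shows "(\<integral>z. (empirical_risk m S f' (fst z) (snd zs) - empirical_risk m S f' (fst zs) (snd z)) \<partial>A S f' q d)
    \<le> \<alpha> * (d + Nz (q - zs))"
proof -
  let ?ps = "point_space W \<Theta>"
  define gap where "gap z = empirical_risk m S f' (fst z) (snd zs) - empirical_risk m S f' (fst zs) (snd z)" for z
  have zs_in: "zs \<in> W \<times> \<Theta>" using zs unfolding saddle_point_def by blast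
  have gap_meas: "gap \<in> borel_measurable ?ps"
    unfolding gap_def[abs_def] using lipschitz_fun_partial_gap(1)[OF lip zs_in] .
  have gap_bound: "\<bar>gap z\<bar> \<le> K * norm_diameter Nz (W \<times> \<Theta>)" if "z \<in> W \<times> \<Theta>" for z
    unfolding gap_def using lipschitz_fun_partial_gap(2)[OF lip zs_in that] .
  define \<rho> where "\<rho> = Nz (q - zs)"
  have \<rho>: "0 \<le> \<rho>" unfolding \<rho>_def by (rule is_norm_nonneg[OF Nz])
  define p where "p = d / (d + \<rho>)"
  have p: "0 < p" "p \<le> 1" "p * (d + \<rho>) = d" using d \<rho> by (auto simp: p_def)
  define P where "P = distr (measure_pmf (bernoulli_pmf p)) ?ps (\<lambda>b. if b then q else zs)"
  have start: "(\<lambda>b. if b then q else zs) \<in> measure_pmf (bernoulli_pmf p) \<rightarrow>\<^sub>M ?ps"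
    using q zs_in by (simp add: measurable_def space_point_space[unfolded])
  have P: "P \<in> space (prob_algebra ?ps)" "prob_space P"
    using prob_space.prob_space_distr[OF prob_space_measure_pmf start]
    by (simp_all add: P_def space_prob_algebra)
  have int_P: "(\<integral>z. g z \<partial>P) = g q * p + g zs * (1 - p)" if "g \<in> borel_measurable ?ps" for g :: "_ \<Rightarrow> real"
    unfolding P_def integral_distr[OF start that] using p by simp
  have "(\<integral>z. Nz (z - zs) \<partial>P) = \<rho> * p"
    using int_P[OF measurable_Nz_diff[of zs]] is_norm_eq_0_iff[OF Nz, of 0] by (simp add: \<rho>_def)
  also have "\<dots> \<le> p * (d + \<rho>)" using p(1) d by (simp add: algebra_simps)
  also have "\<dots> = d" by (rule p(3))
  finally have "(\<integral>z. gap z \<partial>(P \<bind> (\<lambda>z'. A S f' z' d))) \<le> d * \<alpha>"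
    using acc zs d P(1) unfolding relative_accuracy_def gap_def by blast
  moreover have "(\<integral>z. gap z \<partial>(P \<bind> (\<lambda>z'. A S f' z' d))) = (\<integral>z'. integral\<^sup>L (A S f' z' d) gap \<partial>P)"
  proof (rule integral_bind_prob(1)[OF P(2) _ gap_meas])
    show "(\<lambda>z'. A S f' z' d) \<in> P \<rightarrow>\<^sub>M prob_algebra ?ps" using kernel by (simp add: P_def)
  qed (use gap_bound in simp)
  moreover have "(\<integral>z'. integral\<^sup>L (A S f' z' d) gap \<partial>P)
      = integral\<^sup>L (A S f' q d) gap * p + integral\<^sup>L (A S f' zs d) gap * (1 - p)"
    by (intro int_P measurable_compose[OF measurable_prob_algebraD[OF kernel]]
        integral_measurable_subprob_algebra gap_meas)
  \<comment> \<open>The start at the saddle point contributes a nonnegative gap and is dropped; the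
    start \<open>q\<close> remains, with weight \<open>p\<close>.\<close>
  moreover have "0 \<le> integral\<^sup>L (A S f' zs d) gap * (1 - p)"
    using measurable_prob_algebra_space[OF kernel, of zs] zs_in saddle_point_gap_nonneg[OF zs] p(2)
    by (intro mult_nonneg_nonneg integral_nonneg_AE AE_I2) (simp_all add: gap_def)
  ultimately have "p * integral\<^sup>L (A S f' q d) gap \<le> d * \<alpha>"
    by (simp add: mult.commute)
  also have "\<dots> = p * (d + \<rho>) * \<alpha>" by (simp only: p(3))
  also have "\<dots> = p * (\<alpha> * (d + \<rho>))" by (simp only: mult_ac)
  finally show ?thesis using p(1) by (simp add: gap_def[abs_def] \<rho>_def)
qed

section \<open>The accumulated regularizer\<close>

definition reg :: "real \<Rightarrow> nat \<Rightarrow> (nat \<Rightarrow> 'w \<times> 't) \<Rightarrow> 'w \<Rightarrow> 't \<Rightarrow> real" where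
  "reg lam t h w \<theta> = (\<Sum>k<t. 2 ^ (k + 1) * lam * ((Nw (w - fst (h k)))\<^sup>2 - (Nt (\<theta> - snd (h k)))\<^sup>2))"

lemma reg_loss_eq: "reg_loss Nw Nt lam f t h w \<theta> x = f w \<theta> x + reg lam t h w \<theta>"
  by (induction t arbitrary: w \<theta> x) (simp_all add: reg_def algebra_simps)

text \<open>The regularizer is the same for all data points, so averaging reproduces it; for
  \<open>m = 0\<close> division by zero would make it vanish.\<close>

lemma empirical_risk_reg_loss:
  "0 < m \<Longrightarrow> empirical_risk m S (reg_loss Nw Nt lam f t h) w \<theta> = empirical_risk m S f w \<theta> + reg lam t h w \<theta>"
  by (simp add: empirical_risk_def reg_loss_eq sum.distrib add_divide_distrib)

lemma sc_sc_reg: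
  assumes "strongly_convex (1 / \<kappa>) Nw (\<lambda>w. (Nw w)\<^sup>2)" "strongly_convex (1 / \<kappa>) Nt (\<lambda>\<theta>. (Nt \<theta>)\<^sup>2)"
    and "0 \<le> lam"
  shows "sc_sc ((2 ^ (t + 1) - 2) * lam / \<kappa>) (reg lam t h)"
proof -
  \<comment> \<open>One statement serves both variables: \<open>c k\<close> carries the squared norm
    of the other variable, which is constant here.\<close>
  have *: "strongly_convex_on V N ((2 ^ (t + 1) - 2) * lam / \<kappa>) (\<lambda>v. \<Sum>k<t. 2 ^ (k + 1) * lam * ((N (v - u k))\<^sup>2 - c k))"
    if N: "is_norm N" and sc: "strongly_convex (1 / \<kappa>) N (\<lambda>v. (N v)\<^sup>2)"
    for N :: "'b::euclidean_space \<Rightarrow> real" and V u c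
  proof -
    have shift: "strongly_convex_on V N (1 / \<kappa> + 0) (\<lambda>v. (N (v - u k))\<^sup>2 + - c k)" for k
    proof (rule strongly_convex_on_add)
      show "strongly_convex_on V N (1 / \<kappa>) (\<lambda>v. (N (v - u k))\<^sup>2)"
        using strongly_convex_on_translation[OF strongly_convex_imp_strongly_convex_on[OF N sc]]
        by (rule strongly_convex_on_subset) simp
      show "strongly_convex_on V N 0 (\<lambda>_. - c k)" by (simp add: strongly_convex_on_def algebra_simps)
    qed
    have "strongly_convex_on V N (\<Sum>k<t. 2 ^ (k + 1) * lam * (1 / \<kappa> + 0)) (\<lambda>v. \<Sum>k<t. 2 ^ (k + 1) * lam * ((N (v - u k))\<^sup>2 + - c k))"
      using \<open>0 \<le> lam\<close> by (intro strongly_convex_on_sum strongly_convex_on_scale shift) auto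
    moreover have "(\<Sum>k<t. 2 ^ (k + 1) * lam * (1 / \<kappa> + 0)) = (2 ^ (t + 1) - 2) * lam / \<kappa>"
      unfolding sum_powers_of_two[symmetric] by (simp add: sum_distrib_right sum_divide_distrib)
    ultimately show ?thesis by simp
  qed
  have neg: "- reg lam t h w \<theta> = (\<Sum>k<t. 2 ^ (k + 1) * lam * ((Nt (\<theta> - snd (h k)))\<^sup>2 - (Nw (w - fst (h k)))\<^sup>2))" for w \<theta>
    unfolding reg_def sum_negf[symmetric] by (intro sum.cong) (auto simp: algebra_simps)
  show ?thesis
    unfolding sc_sc_def neg unfolding reg_def using *[OF Nw assms(1)] *[OF Nt assms(2)] by simp
qed

text \<open>Each difference of squares factors into a difference, bounded by the distance of the
  arguments, and a sum of distances to the centre. Cauchy-Schwarz recombines the two coordinates,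
  and the centres lie in the domain, so distances to them are at most \<open>B\<close>.\<close>

lemma lipschitz_fun_reg:
  assumes h: "\<And>k. k < t \<Longrightarrow> h k \<in> W \<times> \<Theta>" and B: "norm_diameter Nz (W \<times> \<Theta>) = B" and "0 \<le> lam"
  shows "lipschitz_fun (2 * B * lam * (2 ^ (t + 1) - 2)) (reg lam t h)"
  unfolding lipschitz_fun_def
proof (intro ballI)
  fix w1 w2 \<theta>1 \<theta>2 assume *: "w1 \<in> W" "w2 \<in> W" "\<theta>1 \<in> \<Theta>" "\<theta>2 \<in> \<Theta>"
  define z1 z2 where "z1 = (w1, \<theta>1)" and "z2 = (w2, \<theta>2)"
  have sq: "\<bar>(N (a - u))\<^sup>2 - (N (b - u))\<^sup>2\<bar> \<le> N (a - b) * N (a - u) + N (a - b) * N (b - u)"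
    if N: "is_norm N" for N :: "'b::euclidean_space \<Rightarrow> real" and a b u
  proof -
    have "\<bar>(N (a - u))\<^sup>2 - (N (b - u))\<^sup>2\<bar> = \<bar>N (a - u) - N (b - u)\<bar> * (N (a - u) + N (b - u))"
      using is_norm_nonneg[OF N] by (simp add: square_diff_square_factored power2_eq_square abs_mult)
    also have "\<dots> \<le> N (a - b) * (N (a - u) + N (b - u))"
      using is_norm_nonneg[OF N] by (intro mult_right_mono is_norm_dist_diff_le N) simp
    finally show ?thesis by (simp add: algebra_simps)
  qed
  have "\<bar>reg lam t h w1 \<theta>1 - reg lam t h w2 \<theta>2\<bar>
      = \<bar>\<Sum>k<t. 2 ^ (k + 1) * lam * (((Nw (w1 - fst (h k)))\<^sup>2 - (Nw (w2 - fst (h k)))\<^sup>2) - ((Nt (\<theta>1 - snd (h k)))\<^sup>2 - (Nt (\<theta>2 - snd (h k)))\<^sup>2))\<bar>"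
    by (simp add: reg_def sum_subtractf[symmetric] algebra_simps)
  also have "\<dots> \<le> (\<Sum>k<t. 2 ^ (k + 1) * lam * (2 * B * Nz (z1 - z2)))"
  proof (rule order_trans[OF sum_abs], rule sum_mono)
    fix k assume "k \<in> {..<t}"
    then have hk: "h k \<in> W \<times> \<Theta>" using h by simp
    have "\<bar>((Nw (w1 - fst (h k)))\<^sup>2 - (Nw (w2 - fst (h k)))\<^sup>2) - ((Nt (\<theta>1 - snd (h k)))\<^sup>2 - (Nt (\<theta>2 - snd (h k)))\<^sup>2)\<bar>
        \<le> (Nw (w1 - w2) * Nw (w1 - fst (h k)) + Nt (\<theta>1 - \<theta>2) * Nt (\<theta>1 - snd (h k)))
         + (Nw (w1 - w2) * Nw (w2 - fst (h k)) + Nt (\<theta>1 - \<theta>2) * Nt (\<theta>2 - snd (h k)))"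
      using sq[OF Nw, of w1 "fst (h k)" w2] sq[OF Nt, of \<theta>1 "snd (h k)" \<theta>2] by linarith
    also have "\<dots> \<le> Nz (z1 - z2) * Nz (z1 - h k) + Nz (z1 - z2) * Nz (z2 - h k)"
      using pair_norm_Cauchy_Schwarz[of Nw "z1 - z2" "z1 - h k" Nt] pair_norm_Cauchy_Schwarz[of Nw "z1 - z2" "z2 - h k" Nt]
      by (simp add: z1_def z2_def)
    also have "\<dots> \<le> Nz (z1 - z2) * B + Nz (z1 - z2) * B"
      using Nz_diff_le_diameter[OF _ hk] * B by (intro add_mono mult_left_mono is_norm_nonneg[OF Nz]) (auto simp: z1_def z2_def)
    finally have "2 ^ (k + 1) * lam * \<bar>((Nw (w1 - fst (h k)))\<^sup>2 - (Nw (w2 - fst (h k)))\<^sup>2) - ((Nt (\<theta>1 - snd (h k)))\<^sup>2 - (Nt (\<theta>2 - snd (h k)))\<^sup>2)\<bar>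
        \<le> 2 ^ (k + 1) * lam * (2 * B * Nz (z1 - z2))"
      using \<open>0 \<le> lam\<close> by (intro mult_left_mono) auto
    then show "\<bar>2 ^ (k + 1) * lam * (((Nw (w1 - fst (h k)))\<^sup>2 - (Nw (w2 - fst (h k)))\<^sup>2) - ((Nt (\<theta>1 - snd (h k)))\<^sup>2 - (Nt (\<theta>2 - snd (h k)))\<^sup>2))\<bar>
        \<le> 2 ^ (k + 1) * lam * (2 * B * Nz (z1 - z2))"
      using \<open>0 \<le> lam\<close> by (simp only: abs_mult) simp
  qed
  also have "\<dots> = (2 * B * lam * (2 ^ (t + 1) - 2)) * Nz (z1 - z2)"
    unfolding sum_powers_of_two[symmetric] by (simp add: sum_distrib_left sum_distrib_right mult_ac)
  finally show "\<bar>reg lam t h w1 \<theta>1 - reg lam t h w2 \<theta>2\<bar> \<le> 2 * B * lam * (2 ^ (t + 1) - 2) * Nz ((w1, \<theta>1) - (w2, \<theta>2))"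
    by (simp add: z1_def z2_def)
qed

end

text \<open>
  Assumption \<open>lam_L\<close> is the square of \<open>48 L \<kappa>\<^sup>3\<^sup>/\<^sup>2 \<le> lam B \<surd>m\<close>.
\<close>

locale ssp = stochastic_saddle W \<Theta> Nw Nt D f L B
  for W :: "'w::euclidean_space set" and \<Theta> :: "'t::euclidean_space set" and Nw Nt
    and D :: "'x measure" and f L B +
  fixes \<kappa> \<alpha> lam :: real and m T :: nat and A :: "('w, 't, 'x) subroutine"
  assumes sc_Nw: "strongly_convex (1 / \<kappa>) Nw (\<lambda>w. (Nw w)\<^sup>2)"
    and sc_Nt: "strongly_convex (1 / \<kappa>) Nt (\<lambda>\<theta>. (Nt \<theta>)\<^sup>2)"
    and \<kappa>: "0 < \<kappa>" and \<alpha>: "0 \<le> \<alpha>" and B_pos: "0 < B" and lam_pos: "0 < lam" and m: "0 < m"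
    and lam_\<alpha>: "48 * \<alpha> * \<kappa>\<^sup>2 \<le> lam * B"
    and lam_L: "2304 * L\<^sup>2 * \<kappa> ^ 3 \<le> (lam * B)\<^sup>2 * m"
    and T_le: "0 < T \<Longrightarrow> 2 ^ T * (lam * B) \<le> L"
    and sub: "randomized_subroutine W \<Theta> (space D) m A"
    and meas: "measurable_rounds Nw Nt W \<Theta> D B lam m T A f"
    and acc: "\<And>f' S'. convex_concave W \<Theta> (space D) f' \<Longrightarrow>
                lipschitz_loss Nw Nt W \<Theta> (space D) (5 * L) f' \<Longrightarrow>
                S' \<in> {..<m} \<rightarrow>\<^sub>E space D \<Longrightarrow> relative_accuracy Nw Nt W \<Theta> m A \<alpha> S' f'"
begin

abbreviation (input) points :: "('w \<times> 't) measure" where "points \<equiv> point_space W \<Theta>"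
abbreviation (input) histories :: "nat \<Rightarrow> (nat \<Rightarrow> 'w \<times> 't) measure" where
  "histories t \<equiv> Pi\<^sub>M {..t} (\<lambda>_. point_space W \<Theta>)"

abbreviation (input) rloss :: "nat \<Rightarrow> (nat \<Rightarrow> 'w \<times> 't) \<Rightarrow> ('w, 't, 'x) loss" where
  "rloss t h \<equiv> reg_loss Nw Nt lam f t h"

text \<open>The weights \<open>2 ^ (k + 1) * lam\<close> for \<open>k < t\<close> add up to
  \<open>(2 ^ (t + 1) - 2) * lam\<close>, and each squared norm contributes the factor
  \<open>1 / \<kappa>\<close>.\<close>

definition modulus :: "nat \<Rightarrow> real" where
  "modulus t = (2 ^ (t + 1) - 2) * lam / \<kappa>"

lemma kappa_ge_half: "1 / 2 \<le> \<kappa>"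
  by (rule strongly_convex_kappa_ge_half[OF Nw sc_Nw \<kappa>])

lemma modulus_ge: "0 < t \<Longrightarrow> 2 ^ t * lam / \<kappa> \<le> modulus t"
proof -
  assume "0 < t"
  then have "(2::real) ^ 1 \<le> 2 ^ t" by (intro power_increasing) auto
  then show ?thesis unfolding modulus_def using lam_pos \<kappa> by (intro divide_right_mono mult_right_mono) auto
qed

lemma modulus_pos: "0 < t \<Longrightarrow> 0 < modulus t"
  by (rule less_le_trans[OF _ modulus_ge]) (use lam_pos \<kappa> in simp_all)

lemma modulus_radius_ge: "0 < t \<Longrightarrow> lam * B / \<kappa> \<le> modulus t * (B / 2 ^ t)"
  using mult_right_mono[OF modulus_ge, of t "B / 2 ^ t"] B_pos by simp

lemma sc_sc_reg': "sc_sc (modulus t) (reg lam t h)"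
  unfolding modulus_def using sc_sc_reg[OF sc_Nw sc_Nt] lam_pos by simp

lemma lipschitz_fun_reg':
  "(\<And>k. k < t \<Longrightarrow> h k \<in> W \<times> \<Theta>) \<Longrightarrow> lipschitz_fun (2 * B * lam * (2 ^ (t + 1) - 2)) (reg lam t h)"
  using lipschitz_fun_reg[OF _ diam] lam_pos by simp

lemma history_in: "h \<in> space (histories t) \<Longrightarrow> k \<le> t \<Longrightarrow> h k \<in> W \<times> \<Theta>"
  using space_point_space by (auto simp: space_PiM PiE_iff)

lemma modulus_nonneg: "0 \<le> modulus t"
  using modulus_pos[of t] by (cases "t = 0") (auto simp: modulus_def)

lemma convex_concave_rloss: "convex_concave W \<Theta> (space D) (rloss t h)"
  unfolding convex_concave_def
proof (intro ballI conjI)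
  fix x \<theta> assume x: "x \<in> space D" and \<theta>: "\<theta> \<in> \<Theta>"
  have "convex_on W (\<lambda>w. reg lam t h w \<theta>)"
    using sc_sc_reg'[of t h] \<theta> unfolding sc_sc_def
    by (intro strongly_convex_on_imp_convex_on[OF _ modulus_nonneg convex_W]) auto
  then show "convex_on W (\<lambda>w. rloss t h w \<theta> x)"
    unfolding reg_loss_eq using cc x \<theta> unfolding convex_concave_def by (intro convex_on_add) auto
next
  fix x w assume x: "x \<in> space D" and w: "w \<in> W"
  have "convex_on \<Theta> (\<lambda>\<theta>. - reg lam t h w \<theta>)"
    using sc_sc_reg'[of t h] w unfolding sc_sc_def
    by (intro strongly_convex_on_imp_convex_on[OF _ modulus_nonneg convex_Th]) auto
  then have "convex_on \<Theta> (\<lambda>\<theta>. - f w \<theta> x + - reg lam t h w \<theta>)"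
    using cc x w unfolding convex_concave_def concave_on_def by (intro convex_on_add) auto
  then show "concave_on \<Theta> (\<lambda>\<theta>. rloss t h w \<theta> x)"
    unfolding reg_loss_eq concave_on_def by simp
qed

text \<open>Origin of the factor 5: the regularizer of round \<open>t\<close> has Lipschitz constant
  at most \<open>4 * 2 ^ t * (lam * B)\<close>, and \<open>T_le\<close> bounds this by
  \<open>4 * L\<close>.\<close>

lemma lipschitz_loss_rloss:
  assumes t: "t \<le> T" "0 < T" and h: "\<And>k. k < t \<Longrightarrow> h k \<in> W \<times> \<Theta>"
  shows "lipschitz_loss Nw Nt W \<Theta> (space D) (5 * L) (rloss t h)"
proof -
  have "(2::real) ^ t \<le> 2 ^ T" using t by (intro power_increasing) auto
  then have "2 ^ t * (lam * B) \<le> 2 ^ T * (lam * B)" using lam_pos B_pos by (intro mult_right_mono) auto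
  then have "2 ^ t * (lam * B) \<le> L" using T_le[OF t(2)] by simp
  moreover have "0 < lam * B" using lam_pos B_pos by simp
  ultimately have "L + 2 * B * lam * (2 ^ (t + 1) - 2) \<le> 5 * L" by (simp add: algebra_simps)
  then have "lipschitz_fun (5 * L) (\<lambda>w \<theta>. f w \<theta> x + reg lam t h w \<theta>)" if "x \<in> space D" for x
    by - (rule lipschitz_fun_mono[OF lipschitz_fun_add[OF lipschitz_fun_f[OF that] lipschitz_fun_reg'[of t h, OF h]]])
  then show ?thesis
    unfolding lipschitz_loss_def lipschitz_fun_def reg_loss_eq by blast
qed

definition pop_iter :: "nat \<Rightarrow> (nat \<Rightarrow> 'w \<times> 't) \<Rightarrow> 'w \<times> 't" where
  "pop_iter t h = pop_saddle (reg lam t h)"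

definition round :: "nat \<Rightarrow> (nat \<Rightarrow> 'w \<times> 't) \<Rightarrow> (nat \<Rightarrow> 'x) \<Rightarrow> ('w \<times> 't) measure" where
  "round t h S = A S (rloss (Suc t) h) (h t) (B / 2 ^ Suc t)"

lemma measurable_round:
  "t < T \<Longrightarrow> (\<lambda>(S, h). round t h S) \<in> samples m \<Otimes>\<^sub>M histories t \<rightarrow>\<^sub>M prob_algebra points"
  using meas unfolding measurable_rounds_def round_def by blast

lemma measurable_round_sample:
  assumes t: "t < T" and h: "h \<in> space (histories t)"
  shows "round t h \<in> samples m \<rightarrow>\<^sub>M prob_algebra points"
  using measurable_compose[OF measurable_Pair2'[OF h] measurable_round[OF t]] by simp

text \<open>Relative accuracy from the start \<open>h t\<close> bounds the expected gap, growth
  makes this a bound on a squared distance, and the inequality of means at scale \<open>b\<close>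
  leaves the gap divided by the modulus times \<open>b\<close>. Sample and history are still fixed,
  so the actual distance of the start enters, and enters linearly.\<close>

lemma round_distance_emp_saddle:
  assumes t: "t < T" and h: "h \<in> space (histories t)" and S: "S \<in> space (samples m)"
  defines "b \<equiv> B / 2 ^ Suc t"
  defines "zh \<equiv> emp_saddle m (reg lam (Suc t) h) S"
  shows "(\<integral>z. Nz (z - zh) \<partial>round t h S) \<le> (b + Nz (h t - zh)) / 24 + b / 2"
proof -
  let ?R = "reg lam (Suc t) h" and ?\<mu> = "modulus (Suc t)" and ?f = "rloss (Suc t) h"
  have hk: "h k \<in> W \<times> \<Theta>" if "k < Suc t" for k using history_in[OF h] that by simp
  note R_sc = sc_sc_reg'[of "Suc t" h] and R_lip = lipschitz_fun_reg'[of "Suc t" h, OF hk]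
    and \<mu> = modulus_pos[of "Suc t", OF zero_less_Suc]
  have b: "0 < b" using B_pos by (simp add: b_def)
  have emp: "empirical_risk m S ?f = (\<lambda>w \<theta>. empirical_risk m S f w \<theta> + ?R w \<theta>)"
    by (intro ext empirical_risk_reg_loss m)
  note zh = saddle_point_emp_saddle[OF R_sc R_lip \<mu> S, folded zh_def]
  have zh_in: "zh \<in> W \<times> \<Theta>" using zh unfolding saddle_point_def by blast
  define gap where "gap z = empirical_risk m S ?f (fst z) (snd zh) - empirical_risk m S ?f (fst zh) (snd z)" for z
  define K where "K = L + 2 * B * lam * (2 ^ (Suc t + 1) - 2)"
  have lipK: "lipschitz_fun K (empirical_risk m S ?f)"
    unfolding emp K_def by (rule lipschitz_fun_add[OF lipschitz_fun_empirical_risk[OF S] R_lip])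
  have "(2::real) ^ 1 \<le> 2 ^ (Suc t + 1)" by (rule power_increasing) auto
  then have K: "0 \<le> K"
    unfolding K_def using L B_pos lam_pos by (intro add_nonneg_nonneg mult_nonneg_nonneg) auto
  have S': "S \<in> {..<m} \<rightarrow>\<^sub>E space D" using S by (simp add: space_PiM)
  have kernel: "(\<lambda>z. A S ?f z b) \<in> points \<rightarrow>\<^sub>M prob_algebra points"
    using sub S' b unfolding randomized_subroutine_def by blast
  have gap_le: "(\<integral>z. gap z \<partial>round t h S) \<le> \<alpha> * (b + Nz (h t - zh))"
    unfolding gap_def round_def b_def[symmetric]
  proof (rule relative_accuracy_from_point[where A = A and S = S and f' = ?f and d = b and q = "h t"
        and zs = zh and m = m, OF _ kernel _ lipK K _ b])
    show "relative_accuracy Nw Nt W \<Theta> m A \<alpha> S ?f"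
      using t hk by (intro acc convex_concave_rloss lipschitz_loss_rloss S') auto
    show "saddle_point W \<Theta> (empirical_risk m S ?f) zh" unfolding emp by (rule zh)
  qed (use hk in simp)
  note rd = measurable_prob_algebra_space[OF measurable_round_sample[OF t h] S]
  have gap_int: "integrable (round t h S) gap"
  proof (rule prob_space_integrable_bounded[OF rd(1)])
    show "gap \<in> borel_measurable (round t h S)"
      using lipschitz_fun_partial_gap(1)[OF lipK K zh_in] rd(2) unfolding gap_def
      using measurable_cong_sets by blast
    show "\<bar>gap z\<bar> \<le> K * norm_diameter Nz (W \<times> \<Theta>)" if "z \<in> space (round t h S)" for z
      unfolding gap_def using lipschitz_fun_partial_gap(2)[OF lipK K zh_in] that rd(3) by simp
  qed
  have dist_int: "integrable (round t h S) (\<lambda>z. Nz (z - zh))"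
  proof (rule prob_space_integrable_bounded[OF rd(1)])
    show "(\<lambda>z. Nz (z - zh)) \<in> borel_measurable (round t h S)"
      using measurable_Nz_diff rd(2) measurable_cong_sets by blast
    show "\<bar>Nz (z - zh)\<bar> \<le> B" if "z \<in> space (round t h S)" for z
      using Nz_le_B[OF _ zh_in] is_norm_nonneg[OF Nz] that rd(3) by simp
  qed
  interpret rd: prob_space "round t h S" by (rule rd(1))
  have pointwise: "Nz (z - zh) \<le> gap z / (?\<mu> * b) + b / 2" if "z \<in> space (round t h S)" for z
  proof -
    have "?\<mu> / 2 * (Nz (z - zh))\<^sup>2 \<le> gap z"
      using saddle_point_growth[OF sc_sc_emp[OF R_sc R_lip \<mu> S] zh] that rd(3) unfolding gap_def emp by simp
    then have "(Nz (z - zh))\<^sup>2 \<le> 2 * gap z / ?\<mu>" using \<mu> by (simp add: field_simps)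
    then have "(Nz (z - zh))\<^sup>2 / (2 * b) \<le> (2 * gap z / ?\<mu>) / (2 * b)"
      using b by (intro divide_right_mono) auto
    moreover have "Nz (z - zh) \<le> (Nz (z - zh))\<^sup>2 / (2 * b) + b / 2"
      using b zero_le_power2[of "Nz (z - zh) - b"] by (simp add: field_simps power2_eq_square)
    ultimately show ?thesis by simp
  qed
  \<comment> \<open>The 48 in \<open>lam\<close> and \<open>\<kappa> \<ge> 1 / 2\<close> give the
    24; the second power of \<open>\<kappa>\<close> pays for the \<open>1 / \<kappa>\<close> in the
    modulus.\<close>
  have "24 * \<alpha> \<le> ?\<mu> * b"
  proof -
    have "24 * \<alpha> \<le> 48 * \<alpha> * \<kappa>"
      using kappa_ge_half \<alpha> mult_left_mono[of "1 / 2" \<kappa> "48 * \<alpha>"] by simp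
    also have "\<dots> = 48 * \<alpha> * \<kappa>\<^sup>2 / \<kappa>" using \<kappa> by (simp add: power2_eq_square)
    also have "\<dots> \<le> lam * B / \<kappa>" using lam_\<alpha> \<kappa> by (intro divide_right_mono) auto
    also have "\<dots> \<le> ?\<mu> * b" unfolding b_def by (rule modulus_radius_ge) simp
    finally show ?thesis .
  qed
  then have ratio: "\<alpha> / (?\<mu> * b) \<le> 1 / 24" using \<mu> b by (simp add: field_simps)
  have "(\<integral>z. Nz (z - zh) \<partial>round t h S) \<le> (\<integral>z. gap z / (?\<mu> * b) + b / 2 \<partial>round t h S)"
    using dist_int gap_int pointwise by (intro integral_mono) auto
  also have "\<dots> = (\<integral>z. gap z \<partial>round t h S) / (?\<mu> * b) + b / 2"
    using gap_int by (simp add: rd.prob_space)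
  also have "\<dots> \<le> \<alpha> * (b + Nz (h t - zh)) / (?\<mu> * b) + b / 2"
    using gap_le \<mu> b by (intro add_mono divide_right_mono) auto
  also have "\<dots> = \<alpha> / (?\<mu> * b) * (b + Nz (h t - zh)) + b / 2" by simp
  also have "\<dots> \<le> 1 / 24 * (b + Nz (h t - zh)) + b / 2"
    using ratio b is_norm_nonneg[OF Nz] by (intro add_mono mult_right_mono) auto
  finally show ?thesis by simp
qed

text \<open>A twelfth of the radius requires \<open>8 * 144 = 1152\<close> after squaring, with the
  8 of the second moment bound. \<open>lam_L\<close> supplies \<open>2304 = 48 * 48\<close>, and of
  its \<open>\<kappa> ^ 3\<close> the modulus consumes a square; the remaining factor is at least
  1/2.\<close>

lemma emp_pop_distance:
  assumes h: "h \<in> space (histories t)"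
  shows "(\<integral>S. Nz (emp_saddle m (reg lam (Suc t) h) S - pop_iter (Suc t) h) \<partial>samples m) \<le> B / 2 ^ Suc t / 12"
proof -
  let ?b = "B / 2 ^ Suc t" and ?\<mu> = "modulus (Suc t)"
  have hk: "h k \<in> W \<times> \<Theta>" if "k < Suc t" for k using history_in[OF h] that by simp
  have \<mu>: "0 < ?\<mu>" by (rule modulus_pos) simp
  have "1152 * L\<^sup>2 \<le> 2304 * L\<^sup>2 * \<kappa>"
    using kappa_ge_half mult_left_mono[of "1 / 2" \<kappa> "2304 * L\<^sup>2"] by simp
  also have "\<dots> = 2304 * L\<^sup>2 * \<kappa> ^ 3 / \<kappa>\<^sup>2" using \<kappa> by (simp add: power2_eq_square power3_eq_cube)
  also have "\<dots> \<le> (lam * B)\<^sup>2 * m / \<kappa>\<^sup>2" using lam_L by (intro divide_right_mono) auto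
  also have "\<dots> = (lam * B / \<kappa>)\<^sup>2 * m" by (simp add: power_divide)
  also have "\<dots> \<le> (?\<mu> * ?b)\<^sup>2 * m"
    using modulus_radius_ge[of "Suc t"] lam_pos B_pos \<kappa> by (intro mult_right_mono power_mono) auto
  finally have "1152 * L\<^sup>2 \<le> ?\<mu>\<^sup>2 * ?b\<^sup>2 * m" by (simp only: power_mult_distrib)
  moreover have "(?b / 12)\<^sup>2 = ?b\<^sup>2 / 144" by (simp add: power_divide)
  ultimately have "8 * L\<^sup>2 / (?\<mu>\<^sup>2 * m) \<le> (?b / 12)\<^sup>2"
    using \<mu> m by (simp add: field_simps)
  then show ?thesis
    unfolding pop_iter_def using B_pos m
    by (intro expected_distance_emp_pop_saddle[OF sc_sc_reg' lipschitz_fun_reg' \<mu>] hk) auto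
qed

lemma pop_iter_in:
  assumes "0 < t" "\<And>k. k < t \<Longrightarrow> h k \<in> W \<times> \<Theta>"
  shows "pop_iter t h \<in> W \<times> \<Theta>"
  unfolding pop_iter_def using assms
  by (intro pop_saddle_in[OF sc_sc_reg' lipschitz_fun_reg'] modulus_pos) auto

text \<open>The distance between the two saddle points is paid twice: fully in the triangle
  inequality, and with weight 1/24 when the distance of the start is transferred. Hence 25/24, which
  times 1/12 is below 1/4 and fits together with \<open>b / 2\<close> into
  \<open>3 / 4 * b\<close>.\<close>

lemma round_distance_pop_iter:
  assumes t: "t < T" and h: "h \<in> space (histories t)"
  defines "b \<equiv> B / 2 ^ Suc t"
  shows "(\<integral>z. Nz (z - pop_iter (Suc t) h) \<partial>(samples m \<bind> round t h))
      \<le> (b + Nz (h t - pop_iter (Suc t) h)) / 24 + 3 / 4 * b"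
proof -
  let ?zs = "pop_iter (Suc t) h" and ?zh = "emp_saddle m (reg lam (Suc t) h)"
  interpret P: prob_space "samples m" by (rule prob_samples)
  have hk: "h k \<in> W \<times> \<Theta>" if "k < Suc t" for k using history_in[OF h] that by simp
  have zs_in: "?zs \<in> W \<times> \<Theta>" using hk by (intro pop_iter_in) auto
  note R_sc = sc_sc_reg'[of "Suc t" h] and R_lip = lipschitz_fun_reg'[of "Suc t" h, OF hk]
    and \<mu> = modulus_pos[of "Suc t", OF zero_less_Suc]
  have b: "0 < b" using B_pos by (simp add: b_def)
  have int: "integrable (samples m) (\<lambda>S. Nz (?zh S - ?zs))"
    by (rule integrable_distance_emp_saddle[OF R_sc R_lip \<mu> zs_in])
  have "(\<integral>z. Nz (z - ?zs) \<partial>(samples m \<bind> round t h))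
      \<le> (\<integral>S. (25 / 24) * Nz (?zh S - ?zs) + ((b + Nz (h t - ?zs)) / 24 + b / 2) \<partial>samples m)"
  proof (rule integral_bind_le[OF prob_samples measurable_round_sample[OF t h] measurable_Nz_diff])
    show "\<bar>Nz (z - ?zs)\<bar> \<le> B" if "z \<in> space points" for z
      using Nz_le_B[OF _ zs_in] is_norm_nonneg[OF Nz] that by simp
    show "integrable (samples m) (\<lambda>S. (25 / 24) * Nz (?zh S - ?zs) + ((b + Nz (h t - ?zs)) / 24 + b / 2))"
      using int by simp
    fix S assume S: "S \<in> space (samples m)"
    note rd = measurable_prob_algebra_space[OF measurable_round_sample[OF t h] S]
    interpret rd: prob_space "round t h S" by (rule rd(1))
    have zh_in: "?zh S \<in> W \<times> \<Theta>" by (rule emp_saddle_in[OF R_sc R_lip \<mu> S])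
    have dist_int: "integrable (round t h S) (\<lambda>z. Nz (z - q))" if q: "q \<in> W \<times> \<Theta>" for q
    proof (rule prob_space_integrable_bounded[OF rd(1)])
      show "(\<lambda>z. Nz (z - q)) \<in> borel_measurable (round t h S)"
        using measurable_Nz_diff rd(2) measurable_cong_sets by blast
      show "\<bar>Nz (z - q)\<bar> \<le> B" if "z \<in> space (round t h S)" for z
        using Nz_le_B[OF _ q] is_norm_nonneg[OF Nz] that rd(3) by simp
    qed
    have "(\<integral>z. Nz (z - ?zs) \<partial>round t h S) \<le> (\<integral>z. Nz (z - ?zh S) + Nz (?zh S - ?zs) \<partial>round t h S)"
      using dist_int zs_in zh_in is_norm_dist_triangle[OF Nz] by (intro integral_mono) auto
    also have "\<dots> = (\<integral>z. Nz (z - ?zh S) \<partial>round t h S) + Nz (?zh S - ?zs)"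
      using dist_int[OF zh_in] by (simp add: rd.prob_space)
    also have "\<dots> \<le> (b + Nz (h t - ?zh S)) / 24 + b / 2 + Nz (?zh S - ?zs)"
      using round_distance_emp_saddle[OF t h S] unfolding b_def by simp
    also have "\<dots> \<le> (b + (Nz (h t - ?zs) + Nz (?zh S - ?zs))) / 24 + b / 2 + Nz (?zh S - ?zs)"
      using is_norm_dist_triangle[OF Nz, of "h t" "?zh S" ?zs] is_norm_diff_commute[OF Nz, of "?zh S" ?zs]
      by (intro add_mono divide_right_mono) auto
    finally show "(\<integral>z. Nz (z - ?zs) \<partial>round t h S) \<le> (25 / 24) * Nz (?zh S - ?zs) + ((b + Nz (h t - ?zs)) / 24 + b / 2)"
      by (simp add: field_simps)
  qed
  also have "\<dots> = (25 / 24) * (\<integral>S. Nz (?zh S - ?zs) \<partial>samples m) + ((b + Nz (h t - ?zs)) / 24 + b / 2)"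
    using int by (simp add: P.prob_space)
  also have "\<dots> \<le> (25 / 24) * (b / 12) + ((b + Nz (h t - ?zs)) / 24 + b / 2)"
    using emp_pop_distance[OF h] unfolding b_def by simp
  also have "\<dots> \<le> (b + Nz (h t - ?zs)) / 24 + 3 / 4 * b" using b by simp
  finally show ?thesis .
qed

end

section \<open>The law of the iterates\<close>

text \<open>Drawing from a product is drawing successively; in this form the data of different
  rounds can be integrated out one after the other.\<close>

lemma bind_pair_measure:
  assumes "prob_space M1" "prob_space M2" and F: "F \<in> M1 \<Otimes>\<^sub>M M2 \<rightarrow>\<^sub>M prob_algebra N"
  shows "(M1 \<Otimes>\<^sub>M M2) \<bind> F = M1 \<bind> (\<lambda>x. M2 \<bind> (\<lambda>y. F (x, y)))"
proof -
  interpret M1: prob_space M1 by fact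
  interpret M2: prob_space M2 by fact
  interpret pair_prob_space M1 M2 by unfold_locales
  note F' = measurable_prob_algebraD[OF F]
  have ret: "(\<lambda>x. M2 \<bind> (\<lambda>y. return (M1 \<Otimes>\<^sub>M M2) (x, y))) \<in> M1 \<rightarrow>\<^sub>M subprob_algebra (M1 \<Otimes>\<^sub>M M2)"
    by (intro measurable_bind[where N = M2] measurable_const measurable_compose[OF _ return_measurable])
       (simp_all add: space_subprob_algebra M2.subprob_space_axioms)
  have "(M1 \<Otimes>\<^sub>M M2) \<bind> F = (M1 \<bind> (\<lambda>x. M2 \<bind> (\<lambda>y. return (M1 \<Otimes>\<^sub>M M2) (x, y)))) \<bind> F"
    using pair_measure_eq_bind by simp
  also have "\<dots> = M1 \<bind> (\<lambda>x. M2 \<bind> (\<lambda>y. return (M1 \<Otimes>\<^sub>M M2) (x, y)) \<bind> F)"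
    by (rule bind_assoc[OF ret F'])
  also have "\<dots> = M1 \<bind> (\<lambda>x. M2 \<bind> (\<lambda>y. F (x, y)))"
  proof (rule bind_cong[OF refl])
    fix x assume x: "x \<in> space M1"
    have "M2 \<bind> (\<lambda>y. return (M1 \<Otimes>\<^sub>M M2) (x, y)) \<bind> F = M2 \<bind> (\<lambda>y. return (M1 \<Otimes>\<^sub>M M2) (x, y) \<bind> F)"
      by (rule bind_assoc[OF measurable_compose[OF measurable_Pair1'[OF x] return_measurable] F'])
    also have "\<dots> = M2 \<bind> (\<lambda>y. F (x, y))"
      using x by (intro bind_cong refl bind_return[OF F']) (simp add: space_pair_measure)
    finally show "M2 \<bind> (\<lambda>y. return (M1 \<Otimes>\<^sub>M M2) (x, y)) \<bind> F = M2 \<bind> (\<lambda>y. F (x, y))" .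
  qed
  finally show ?thesis .
qed

locale ssp_run = ssp W \<Theta> Nw Nt D f L B \<kappa> \<alpha> lam m T A
  for W :: "'w::euclidean_space set" and \<Theta> :: "'t::euclidean_space set" and Nw Nt
    and D :: "'x measure" and f L B \<kappa> \<alpha> lam m T A +
  fixes n :: nat and z0 :: "'w \<times> 't" and idx :: "nat \<Rightarrow> nat \<Rightarrow> nat"
  assumes z0: "z0 \<in> W \<times> \<Theta>"
    and idx_inj: "inj_on (\<lambda>(t, i). idx t i) ({1..T} \<times> {..<m})"
    and idx_less: "\<And>t i. t \<in> {1..T} \<Longrightarrow> i < m \<Longrightarrow> idx t i < n"
    and T_gt: "L \<le> 2 ^ (T + 1) * (lam * B)"
begin

definition extend :: "nat \<Rightarrow> (nat \<Rightarrow> 'w \<times> 't) \<Rightarrow> ('w \<times> 't) measure \<Rightarrow> (nat \<Rightarrow> 'w \<times> 't) measure" where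
  "extend t h M = distr M (histories (Suc t)) (\<lambda>z. h(Suc t := z))"

text \<open>An idealized run whose rounds draw independent samples, averaged out within each step.
  Expected distances are computed under this law, and \<open>history_law\<close> carries them over
  to the algorithm.\<close>

primrec fresh_history :: "nat \<Rightarrow> (nat \<Rightarrow> 'w \<times> 't) measure" where
  "fresh_history 0 = return (histories 0) (\<lambda>k\<in>{..0}. z0)"
| "fresh_history (Suc t) = fresh_history t \<bind> (\<lambda>h. extend t h (samples m \<bind> round t h))"

abbreviation (input) history :: "nat \<Rightarrow> (nat \<Rightarrow> 'x) \<Rightarrow> (nat \<Rightarrow> 'w \<times> 't) measure" where
  "history \<equiv> ssp_history Nw Nt W \<Theta> B lam m idx A z0 f"

definition block :: "nat \<Rightarrow> (nat \<Rightarrow> 'x) \<Rightarrow> nat \<Rightarrow> 'x" where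
  "block t S = (\<lambda>i\<in>{..<m}. S (idx t i))"

definition used :: "nat \<Rightarrow> nat set" where
  "used t = (\<lambda>(s, i). idx s i) ` ({1..t} \<times> {..<m})"

lemma used_Suc: "used (Suc t) = used t \<union> idx (Suc t) ` {..<m}"
proof -
  have "{1..Suc t} \<times> {..<m} = {1..t} \<times> {..<m} \<union> Pair (Suc t) ` {..<m}" by auto
  then show ?thesis unfolding used_def by (simp only: image_Un image_image) simp
qed

lemma finite_used: "finite (used t)"
  by (simp add: used_def)

lemma used_disjoint: "t < T \<Longrightarrow> used t \<inter> idx (Suc t) ` {..<m} = {}"
proof (intro equals0I)
  fix j assume t: "t < T" and "j \<in> used t \<inter> idx (Suc t) ` {..<m}"
  then obtain s i i' where j: "s \<in> {1..t}" "i < m" "i' < m" "idx s i = idx (Suc t) i'"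
    by (auto simp: used_def)
  then have "(s, i) = (Suc t, i')" using t by (intro inj_onD[OF idx_inj]) auto
  then show False using j(1) by simp
qed

lemma used_subset: "t \<le> T \<Longrightarrow> used t \<subseteq> {..<n}"
  using idx_less by (auto simp: used_def)

lemma idx_inj_round: "t < T \<Longrightarrow> inj_on (idx (Suc t)) {..<m}"
  by (rule inj_onI) (use inj_onD[OF idx_inj, of "(Suc t, _)" "(Suc t, _)"] in auto)

lemma measurable_extend:
  "(\<lambda>(h, z). h(Suc t := z)) \<in> histories t \<Otimes>\<^sub>M points \<rightarrow>\<^sub>M histories (Suc t)"
  using measurable_add_dim[of "Suc t" "{..t}" "\<lambda>_. points"] by (simp add: atMost_Suc)

lemma measurable_extend1:
  "h \<in> space (histories t) \<Longrightarrow> (\<lambda>z. h(Suc t := z)) \<in> points \<rightarrow>\<^sub>M histories (Suc t)"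
  using measurable_compose[OF measurable_Pair1' measurable_extend] by simp

lemma extend_eq_bind:
  assumes "h \<in> space (histories t)" "M \<in> space (prob_algebra points)"
  shows "M \<bind> (\<lambda>z. return (histories (Suc t)) (h(Suc t := z))) = extend t h M"
  unfolding extend_def
proof (rule bind_return_distr')
  show "space M \<noteq> {}" using assms(2) by (simp add: space_prob_algebra prob_space.not_empty)
  have "sets M = sets points" using assms(2) by (simp add: space_prob_algebra)
  then show "(\<lambda>z. h(Suc t := z)) \<in> M \<rightarrow>\<^sub>M histories (Suc t)"
    using measurable_extend1[OF assms(1)] measurable_cong_sets by blast
qed

lemma history_Suc:
  "history (Suc t) S = history t S \<bind> (\<lambda>h. round t h (block (Suc t) S) \<bind>
     (\<lambda>z. return (histories (Suc t)) (h(Suc t := z))))"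
  by (simp add: round_def block_def)

declare ssp_history.simps(2) [simp del]

text \<open>Locality in the sample: together with disjointness of the blocks it makes the history of
  the first rounds independent of the data of the next one.\<close>

lemma history_cong:
  "(\<And>j. j \<in> used t \<Longrightarrow> S j = S' j) \<Longrightarrow> history t S = history t S'"
proof (induction t)
  case (Suc t)
  then have "history t S = history t S'" by (intro Suc.IH) (auto simp: used_Suc)
  moreover have "block (Suc t) S = block (Suc t) S'"
    unfolding block_def using Suc.prems by (intro restrict_ext) (auto simp: used_Suc)
  ultimately show ?case by (simp add: history_Suc)
qed simp

lemma measurable_block:
  "idx t ` {..<m} \<subseteq> I \<Longrightarrow> block t \<in> Pi\<^sub>M I (\<lambda>_. D) \<rightarrow>\<^sub>M samples m"
  unfolding block_def[abs_def] by (intro measurable_restrict measurable_component_singleton) auto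

lemma measurable_step:
  assumes t: "t < T"
  shows "(\<lambda>(S, h). round t h S \<bind> (\<lambda>z. return (histories (Suc t)) (h(Suc t := z))))
    \<in> samples m \<Otimes>\<^sub>M histories t \<rightarrow>\<^sub>M prob_algebra (histories (Suc t))"
  unfolding case_prod_beta'
proof (rule measurable_bind_prob_space2)
  show "(\<lambda>x. round t (snd x) (fst x)) \<in> samples m \<Otimes>\<^sub>M histories t \<rightarrow>\<^sub>M prob_algebra points"
    using measurable_round[OF t] by (simp add: case_prod_beta')
  have "(\<lambda>p. (snd (fst p))(Suc t := snd p)) \<in> (samples m \<Otimes>\<^sub>M histories t) \<Otimes>\<^sub>M points \<rightarrow>\<^sub>M histories (Suc t)"
    using measurable_compose[OF measurable_Pair[OF measurable_compose[OF measurable_fst measurable_snd] measurable_snd] measurable_extend]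
    by (simp add: case_prod_beta')
  from measurable_compose[OF this measurable_return_prob_space]
  show "(\<lambda>(x, z). return (histories (Suc t)) ((snd x)(Suc t := z)))
      \<in> (samples m \<Otimes>\<^sub>M histories t) \<Otimes>\<^sub>M points \<rightarrow>\<^sub>M prob_algebra (histories (Suc t))"
    by (simp add: case_prod_beta')
qed

lemma initial_history: "(\<lambda>k\<in>{..0}. z0) \<in> space (histories 0)"
  using z0 by (simp add: space_PiM)

lemma measurable_history:
  "t \<le> T \<Longrightarrow> used t \<subseteq> I \<Longrightarrow> history t \<in> Pi\<^sub>M I (\<lambda>_. D) \<rightarrow>\<^sub>M prob_algebra (histories t)"
proof (induction t)
  case 0
  have "return (histories 0) (\<lambda>k\<in>{..0}. z0) \<in> space (prob_algebra (histories 0))"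
    using prob_space_return[OF initial_history] by (simp add: space_prob_algebra)
  then show ?case by (simp add: measurable_const)
next
  case (Suc t)
  then have t: "t < T" and IH: "history t \<in> Pi\<^sub>M I (\<lambda>_. D) \<rightarrow>\<^sub>M prob_algebra (histories t)"
    and blk: "block (Suc t) \<in> Pi\<^sub>M I (\<lambda>_. D) \<rightarrow>\<^sub>M samples m"
    by (auto simp: used_Suc intro!: measurable_block)
  have "(\<lambda>(S, h). (block (Suc t) S, h)) \<in> Pi\<^sub>M I (\<lambda>_. D) \<Otimes>\<^sub>M histories t \<rightarrow>\<^sub>M samples m \<Otimes>\<^sub>M histories t"
    unfolding case_prod_beta' by (intro measurable_Pair measurable_compose[OF measurable_fst blk] measurable_snd)
  from measurable_compose[OF this measurable_step[OF t]]
  have "(\<lambda>(S, h). round t h (block (Suc t) S) \<bind> (\<lambda>z. return (histories (Suc t)) (h(Suc t := z))))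
      \<in> Pi\<^sub>M I (\<lambda>_. D) \<Otimes>\<^sub>M histories t \<rightarrow>\<^sub>M prob_algebra (histories (Suc t))"
    by (simp add: case_prod_beta')
  from measurable_bind_prob_space2[OF IH this] show ?case
    unfolding history_Suc[abs_def] .
qed

lemma prob_PiM_D: "prob_space (Pi\<^sub>M I (\<lambda>_. D))"
  by (intro prob_space_PiM prob_D)

lemma distr_block:
  assumes t: "t < T"
  shows "distr (Pi\<^sub>M (idx (Suc t) ` {..<m}) (\<lambda>_. D)) (samples m) (block (Suc t)) = samples m"
  unfolding block_def[abs_def]
  by (rule distr_PiM_reindex[where M = "\<lambda>_. D"]) (use idx_inj_round[OF t] prob_D in auto)

text \<open>The indices of a block are distinct, so the coordinates read by a round again form an
  i.i.d. sample of size \<open>m\<close>. Reading a part of the large sample thus becomes drawing a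
  fresh one.\<close>

lemma step_fresh_sample:
  assumes t: "t < T" and h: "h \<in> space (histories t)"
  shows "Pi\<^sub>M (idx (Suc t) ` {..<m}) (\<lambda>_. D) \<bind>
      (\<lambda>b. round t h (block (Suc t) b) \<bind> (\<lambda>z. return (histories (Suc t)) (h(Suc t := z))))
    = extend t h (samples m \<bind> round t h)"
proof -
  let ?K = "Pi\<^sub>M (idx (Suc t) ` {..<m}) (\<lambda>_. D)" and ?ret = "\<lambda>z. return (histories (Suc t)) (h(Suc t := z))"
  have ne: "space ?K \<noteq> {}" by (rule prob_space.not_empty[OF prob_PiM_D])
  have ret: "?ret \<in> points \<rightarrow>\<^sub>M subprob_algebra (histories (Suc t))"
    by (rule measurable_compose[OF measurable_extend1[OF h] return_measurable])
  note rd = measurable_round_sample[OF t h]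
  have G: "(\<lambda>S. round t h S \<bind> ?ret) \<in> samples m \<rightarrow>\<^sub>M subprob_algebra (histories (Suc t))"
    using measurable_compose[OF measurable_Pair2'[OF h] measurable_step[OF t]] by (auto intro: measurable_prob_algebraD)
  have "?K \<bind> (\<lambda>b. round t h (block (Suc t) b) \<bind> ?ret) = distr ?K (samples m) (block (Suc t)) \<bind> (\<lambda>S. round t h S \<bind> ?ret)"
    by (rule bind_distr[OF measurable_block[OF order_refl] G ne, symmetric])
  also have "\<dots> = samples m \<bind> (\<lambda>S. round t h S \<bind> ?ret)" unfolding distr_block[OF t] ..
  also have "\<dots> = (samples m \<bind> round t h) \<bind> ?ret"
    by (rule bind_assoc[OF measurable_prob_algebraD[OF rd] ret, symmetric])
  also have "\<dots> = extend t h (samples m \<bind> round t h)"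
  proof (rule extend_eq_bind[OF h])
    have "samples m \<in> space (prob_algebra (samples m))" using prob_samples by (simp add: space_prob_algebra)
    then show "samples m \<bind> round t h \<in> space (prob_algebra points)"
      using prob_space_bind'[OF _ rd] sets_bind'[OF _ rd] by (auto simp: space_prob_algebra)
  qed
  finally show ?thesis .
qed

lemma measurable_fresh_step:
  assumes t: "t < T"
  shows "(\<lambda>h. extend t h (samples m \<bind> round t h)) \<in> histories t \<rightarrow>\<^sub>M prob_algebra (histories (Suc t))"
  unfolding extend_def
proof (rule measurable_distr_prob_space2[where M = points])
  show "(\<lambda>h. samples m \<bind> round t h) \<in> histories t \<rightarrow>\<^sub>M prob_algebra points"
  proof (rule measurable_bind_prob_space2[where N = "samples m"])
    show "(\<lambda>h. samples m) \<in> histories t \<rightarrow>\<^sub>M prob_algebra (samples m)"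
      using prob_samples by (intro measurable_const) (simp add: space_prob_algebra)
    have "(\<lambda>(h, S). (S, h)) \<in> histories t \<Otimes>\<^sub>M samples m \<rightarrow>\<^sub>M samples m \<Otimes>\<^sub>M histories t"
      by (rule measurable_pair_swap')
    from measurable_compose[OF this measurable_round[OF t]]
    show "(\<lambda>(h, S). round t h S) \<in> histories t \<Otimes>\<^sub>M samples m \<rightarrow>\<^sub>M prob_algebra points"
      by (simp add: case_prod_beta')
  qed
qed (rule measurable_extend)

text \<open>In the induction step the product over \<open>used (Suc t)\<close> splits into earlier
  coordinates and the new block. The history reads only the former and the new data are only the
  latter, so Fubini for kernels exchanges the two draws, and for each history the block is
  integrated out inside the step.\<close>

lemma history_law_used:
  "t \<le> T \<Longrightarrow> Pi\<^sub>M (used t) (\<lambda>_. D) \<bind> history t = fresh_history t"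
proof (induction t)
  case 0
  have "history 0 = (\<lambda>_. return (histories 0) (\<lambda>k\<in>{..0}. z0))" by auto
  then show ?case
    using bind_const'[OF prob_PiM_D prob_space_imp_subprob_space[OF prob_space_return[OF initial_history]]] by simp
next
  case (Suc t)
  then have t: "t < T" "t \<le> T" by auto
  let ?J = "used t" and ?K = "idx (Suc t) ` {..<m}"
  let ?P = "Pi\<^sub>M ?J (\<lambda>_. D)" and ?Q = "Pi\<^sub>M ?K (\<lambda>_. D)"
  let ?step = "\<lambda>b h. round t h (block (Suc t) b) \<bind> (\<lambda>z. return (histories (Suc t)) (h(Suc t := z)))"
  interpret PS: product_sigma_finite "\<lambda>_::nat. D" by unfold_locales
  have U: "used (Suc t) = ?J \<union> ?K" by (rule used_Suc)
  have mergem: "merge ?J ?K \<in> ?P \<Otimes>\<^sub>M ?Q \<rightarrow>\<^sub>M Pi\<^sub>M (?J \<union> ?K) (\<lambda>_. D)" by (rule measurable_merge)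
  have hS: "history (Suc t) \<in> Pi\<^sub>M (?J \<union> ?K) (\<lambda>_. D) \<rightarrow>\<^sub>M prob_algebra (histories (Suc t))"
    using measurable_history[OF Suc.prems order_refl] unfolding U .
  have ne: "space (?P \<Otimes>\<^sub>M ?Q) \<noteq> {}"
    using prob_space.not_empty[OF prob_PiM_D[of ?J]] prob_space.not_empty[OF prob_PiM_D[of ?K]]
    unfolding space_pair_measure by blast
  have "Pi\<^sub>M (used (Suc t)) (\<lambda>_. D) \<bind> history (Suc t)
      = distr (?P \<Otimes>\<^sub>M ?Q) (Pi\<^sub>M (?J \<union> ?K) (\<lambda>_. D)) (merge ?J ?K) \<bind> history (Suc t)"
    unfolding U using PS.distr_merge[OF used_disjoint[OF t(1)] finite_used finite_imageI[OF finite_lessThan]] by simp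
  also have "\<dots> = (?P \<Otimes>\<^sub>M ?Q) \<bind> (\<lambda>p. history (Suc t) (merge ?J ?K p))"
    by (rule bind_distr[OF mergem measurable_prob_algebraD[OF hS] ne])
  also have "\<dots> = ?P \<bind> (\<lambda>a. ?Q \<bind> (\<lambda>b. history (Suc t) (merge ?J ?K (a, b))))"
    by (rule bind_pair_measure[OF prob_PiM_D prob_PiM_D measurable_compose[OF mergem hS]])
  also have "\<dots> = ?P \<bind> (\<lambda>a. history t a \<bind> (\<lambda>h. extend t h (samples m \<bind> round t h)))"
  proof (rule bind_cong[OF refl])
    fix a assume a: "a \<in> space ?P"
    note ha = measurable_prob_algebra_space[OF measurable_history[OF t(2) order_refl] a]
    interpret pair_prob_space ?Q "history t a"
      unfolding pair_prob_space_def pair_sigma_finite_def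
      using prob_PiM_D ha(1) by (auto intro: prob_space_imp_sigma_finite)
    have merge_eq: "history (Suc t) (merge ?J ?K (a, b)) = history t a \<bind> ?step b" for b
    proof -
      have "history t (merge ?J ?K (a, b)) = history t a"
        by (rule history_cong) (simp add: merge_def)
      moreover have "block (Suc t) (merge ?J ?K (a, b)) = block (Suc t) b"
        using used_disjoint[OF t(1)] unfolding block_def by (intro restrict_ext) (auto simp: merge_def)
      ultimately show ?thesis by (simp add: history_Suc)
    qed
    have "(\<lambda>(b, h). (block (Suc t) b, h)) \<in> ?Q \<Otimes>\<^sub>M histories t \<rightarrow>\<^sub>M samples m \<Otimes>\<^sub>M histories t"
      unfolding case_prod_beta'
      by (intro measurable_Pair measurable_compose[OF measurable_fst measurable_block] measurable_snd) auto
    from measurable_prob_algebraD[OF measurable_compose[OF this measurable_step[OF t(1)]]]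
    have "(\<lambda>(b, h). ?step b h) \<in> ?Q \<Otimes>\<^sub>M histories t \<rightarrow>\<^sub>M subprob_algebra (histories (Suc t))"
      by (simp add: case_prod_beta')
    moreover have "sets (?Q \<Otimes>\<^sub>M history t a) = sets (?Q \<Otimes>\<^sub>M histories t)"
      using ha(2) by (intro sets_pair_measure_cong) auto
    ultimately have stepm: "(\<lambda>(b, h). ?step b h) \<in> ?Q \<Otimes>\<^sub>M history t a \<rightarrow>\<^sub>M subprob_algebra (histories (Suc t))"
      using measurable_cong_sets by blast
    have "?Q \<bind> (\<lambda>b. history (Suc t) (merge ?J ?K (a, b))) = ?Q \<bind> (\<lambda>b. history t a \<bind> ?step b)"
      by (simp add: merge_eq)
    also have "\<dots> = history t a \<bind> (\<lambda>h. ?Q \<bind> (\<lambda>b. ?step b h))"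
      by (rule bind_rotate[OF stepm])
    also have "\<dots> = history t a \<bind> (\<lambda>h. extend t h (samples m \<bind> round t h))"
      using step_fresh_sample[OF t(1)] ha(3) by (intro bind_cong refl) simp
    finally show "?Q \<bind> (\<lambda>b. history (Suc t) (merge ?J ?K (a, b)))
        = history t a \<bind> (\<lambda>h. extend t h (samples m \<bind> round t h))" .
  qed
  also have "\<dots> = (?P \<bind> history t) \<bind> (\<lambda>h. extend t h (samples m \<bind> round t h))"
    by (rule bind_assoc[OF measurable_prob_algebraD[OF measurable_history[OF t(2) order_refl]]
          measurable_prob_algebraD[OF measurable_fresh_step[OF t(1)]], symmetric])
  also have "\<dots> = fresh_history (Suc t)" using Suc.IH[OF t(2)] by simp
  finally show ?case .
qed

text \<open>Sample points read by no round are marginalized out: the history depends on the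
  restriction of the sample to \<open>used T\<close> only.\<close>

lemma history_law:
  "Pi\<^sub>M {..<n} (\<lambda>_. D) \<bind> history T = fresh_history T"
proof -
  let ?P = "Pi\<^sub>M {..<n} (\<lambda>_. D)" and ?U = "Pi\<^sub>M (used T) (\<lambda>_. D)"
  have sub: "used T \<subseteq> {..<n}" by (rule used_subset) simp
  interpret product_prob_space "\<lambda>_::nat. D" "{..<n}" by unfold_locales
  have restr: "(\<lambda>S. restrict S (used T)) \<in> ?P \<rightarrow>\<^sub>M ?U"
    by (rule measurable_restrict_subset[OF sub])
  have "fresh_history T = distr ?P ?U (\<lambda>S. restrict S (used T)) \<bind> history T"
    unfolding distr_PiM_restrict_finite[OF finite_used sub] by (rule history_law_used[symmetric]) simp
  also have "\<dots> = ?P \<bind> (\<lambda>S. history T (restrict S (used T)))"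
    by (rule bind_distr[OF restr measurable_prob_algebraD[OF measurable_history[OF order_refl order_refl]]
          prob_space.not_empty[OF prob_PiM_D]])
  also have "\<dots> = ?P \<bind> history T"
    by (intro bind_cong refl history_cong) simp
  finally show ?thesis by simp
qed

lemma fresh_history_prob: "t \<le> T \<Longrightarrow> fresh_history t \<in> space (prob_algebra (histories t))"
proof (induction t)
  case 0
  then show ?case using prob_space_return[OF initial_history] by (simp add: space_prob_algebra)
next
  case (Suc t)
  then have t: "t < T" and IH: "fresh_history t \<in> space (prob_algebra (histories t))" by auto
  show ?case
    using prob_space_bind'[OF IH measurable_fresh_step[OF t]] sets_bind'[OF IH measurable_fresh_step[OF t]]
    by (simp add: space_prob_algebra)
qed

end

section \<open>The strong gap\<close>

lemma sum_inverse_powers_of_two: "(\<Sum>j\<in>{k<..<t}. 1 / 2 ^ j) \<le> (1 / 2 ^ k :: real)"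
proof (cases "k < t")
  case True
  \<comment> \<open>The induction runs on the exact value; the slack \<open>2 / 2 ^ t\<close> is
    dropped afterwards.\<close>
  then have "(\<Sum>j\<in>{k<..<t}. 1 / 2 ^ j) = (1 / 2 ^ k - 2 / 2 ^ t :: real)"
  proof (induction t)
    case (Suc t)
    show ?case
    proof (cases "k = t")
      case False
      then have "{k<..<Suc t} = insert t {k<..<t}" and "k < t" using Suc.prems by auto
      then show ?thesis using Suc.IH by simp
    next
      case True
      then have "{k<..<Suc t} = {}" by auto
      then show ?thesis using True by simp
    qed
  qed simp
  then show ?thesis by simp
qed simp

context stochastic_saddle
begin

abbreviation (input) F :: "'w \<Rightarrow> 't \<Rightarrow> real" where "F \<equiv> population_risk D f"

definition strong_gap :: "'w \<times> 't \<Rightarrow> real" where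
  "strong_gap z = (SUP \<theta>\<in>\<Theta>. population_risk D f (fst z) \<theta>) - (INF w\<in>W. population_risk D f w (snd z))"

lemma population_risk_diff_le:
  "w \<in> W \<Longrightarrow> w' \<in> W \<Longrightarrow> \<theta> \<in> \<Theta> \<Longrightarrow> \<theta>' \<in> \<Theta> \<Longrightarrow> \<bar>F w \<theta> - F w' \<theta>'\<bar> \<le> L * B"
  by (rule order_trans[OF lipschitz_funD[OF lipschitz_fun_population_risk] mult_left_mono[OF Nz_le_B]])
     (use L in auto)

lemma bdd_above_population_risk: "w \<in> W \<Longrightarrow> bdd_above (F w ` \<Theta>)"
proof -
  assume w: "w \<in> W"
  obtain \<theta>' where \<theta>': "\<theta>' \<in> \<Theta>" using Th_ne by blast
  show ?thesis
  proof (rule bdd_aboveI2)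
    fix \<theta> assume "\<theta> \<in> \<Theta>"
    then show "F w \<theta> \<le> F w \<theta>' + L * B" using population_risk_diff_le[OF w w _ \<theta>', of \<theta>] by simp
  qed
qed

lemma bdd_below_population_risk: "\<theta> \<in> \<Theta> \<Longrightarrow> bdd_below ((\<lambda>w. F w \<theta>) ` W)"
proof -
  assume \<theta>: "\<theta> \<in> \<Theta>"
  obtain w' where w': "w' \<in> W" using W_ne by blast
  show ?thesis
  proof (rule bdd_belowI2)
    fix w assume "w \<in> W"
    then show "F w' \<theta> - L * B \<le> F w \<theta>" using population_risk_diff_le[OF w' _ \<theta> \<theta>, of w] by simp
  qed
qed

lemma strong_gap_le:
  assumes "\<And>w \<theta>. w \<in> W \<Longrightarrow> \<theta> \<in> \<Theta> \<Longrightarrow> F (fst z) \<theta> - F w (snd z) \<le> X"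
  shows "strong_gap z \<le> X"
proof -
  have "(SUP \<theta>\<in>\<Theta>. F (fst z) \<theta>) \<le> X + F w (snd z)" if w: "w \<in> W" for w
    using assms[OF w] Th_ne by (intro cSUP_least) (auto simp: algebra_simps)
  then have "(SUP \<theta>\<in>\<Theta>. F (fst z) \<theta>) - X \<le> (INF w\<in>W. F w (snd z))"
    using W_ne by (intro cINF_greatest) (auto simp: algebra_simps)
  then show ?thesis by (simp add: strong_gap_def)
qed

lemma strong_gap_ge:
  assumes z: "z \<in> W \<times> \<Theta>" and "w \<in> W" "\<theta> \<in> \<Theta>"
  shows "F (fst z) \<theta> - F w (snd z) \<le> strong_gap z"
proof -
  have "F (fst z) \<theta> \<le> (SUP \<theta>\<in>\<Theta>. F (fst z) \<theta>)"
    using assms by (intro cSUP_upper bdd_above_population_risk) auto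
  moreover have "(INF w\<in>W. F w (snd z)) \<le> F w (snd z)"
    using assms by (intro cINF_lower bdd_below_population_risk) auto
  ultimately show ?thesis by (simp add: strong_gap_def)
qed

lemma population_gap_lipschitz:
  assumes z: "z \<in> W \<times> \<Theta>" "z' \<in> W \<times> \<Theta>" and w: "w \<in> W" "\<theta> \<in> \<Theta>"
  shows "F (fst z) \<theta> - F w (snd z) \<le> F (fst z') \<theta> - F w (snd z') + 2 * L * Nz (z - z')"
proof -
  have "\<bar>F (fst z) \<theta> - F (fst z') \<theta>\<bar> \<le> L * Nz (z - z')"
  proof -
    have "\<bar>F (fst z) \<theta> - F (fst z') \<theta>\<bar> \<le> L * Nz ((fst z, \<theta>) - (fst z', \<theta>))"
      using z w by (intro lipschitz_funD[OF lipschitz_fun_population_risk]) auto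
    also have "\<dots> \<le> L * Nz (z - z')"
      using L Nw_le_Nz[of "z - z'"] by (simp add: Nz_eq_Nw)
    finally show ?thesis .
  qed
  moreover have "\<bar>F w (snd z) - F w (snd z')\<bar> \<le> L * Nz (z - z')"
  proof -
    have "\<bar>F w (snd z) - F w (snd z')\<bar> \<le> L * Nz ((w, snd z) - (w, snd z'))"
      using z w by (intro lipschitz_funD[OF lipschitz_fun_population_risk]) auto
    also have "\<dots> \<le> L * Nz (z - z')"
      using L Nt_le_Nz[of "z - z'"] by (simp add: Nz_eq_Nt)
    finally show ?thesis .
  qed
  ultimately show ?thesis by linarith
qed

lemma strong_gap_lipschitz:
  assumes z: "z \<in> W \<times> \<Theta>" "z' \<in> W \<times> \<Theta>"
  shows "strong_gap z \<le> strong_gap z' + 2 * L * Nz (z - z')"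
  using population_gap_lipschitz[OF z] strong_gap_ge[OF z(2)] by (intro strong_gap_le) (meson add_right_mono order_trans)

text \<open>The supremum and the infimum may range over uncountable sets, so measurability is
  obtained from Lipschitz continuity of the gap.\<close>

lemma measurable_strong_gap: "strong_gap \<in> borel_measurable (point_space W \<Theta>)"
proof -
  have "lipschitz_fun (2 * L) (\<lambda>w \<theta>. strong_gap (w, \<theta>))"
    unfolding lipschitz_fun_def
  proof (intro ballI)
    fix w1 w2 \<theta>1 \<theta>2 assume "w1 \<in> W" "w2 \<in> W" "\<theta>1 \<in> \<Theta>" "\<theta>2 \<in> \<Theta>"
    then show "\<bar>strong_gap (w1, \<theta>1) - strong_gap (w2, \<theta>2)\<bar> \<le> 2 * L * Nz ((w1, \<theta>1) - (w2, \<theta>2))"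
      using strong_gap_lipschitz[of "(w1, \<theta>1)" "(w2, \<theta>2)"] strong_gap_lipschitz[of "(w2, \<theta>2)" "(w1, \<theta>1)"]
        is_norm_diff_commute[OF Nz, of "(w1, \<theta>1)" "(w2, \<theta>2)"] by auto
  qed
  from lipschitz_fun_continuous_on[OF this] show ?thesis
    by (intro measurable_point_space_continuous) simp
qed

lemma strong_gap_bounds:
  assumes z: "z \<in> W \<times> \<Theta>"
  shows "0 \<le> strong_gap z" "strong_gap z \<le> L * B"
proof -
  show "0 \<le> strong_gap z" using strong_gap_ge[OF z, of "fst z" "snd z"] z by auto
  show "strong_gap z \<le> L * B"
  proof (rule strong_gap_le)
    fix w \<theta> assume "w \<in> W" "\<theta> \<in> \<Theta>"
    then show "F (fst z) \<theta> - F w (snd z) \<le> L * B"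
      using population_risk_diff_le[of "fst z" w \<theta> "snd z"] z by auto
  qed
qed

end

section \<open>Distances between the iterates and the population saddle points\<close>

context ssp
begin

lemma pop_iter_cong:
  assumes "\<And>k. k < t \<Longrightarrow> h k = h' k"
  shows "pop_iter t h = pop_iter t h'"
proof -
  have "reg lam t h = reg lam t h'" unfolding reg_def using assms by (intro ext sum.cong) auto
  then show ?thesis by (simp add: pop_iter_def)
qed

lemma pop_iter_shift:
  assumes t: "0 < t" and h: "\<And>k. k < Suc t \<Longrightarrow> h k \<in> W \<times> \<Theta>"
  shows "Nz (pop_iter (Suc t) h - h t) \<le> Nz (pop_iter t h - h t)"
proof -
  have h': "h k \<in> W \<times> \<Theta>" if "k < t" for k using h that by simp
  note sp = saddle_point_pop_saddle[OF sc_sc_reg' lipschitz_fun_reg' modulus_pos]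
  have 1: "saddle_point W \<Theta> (\<lambda>w \<theta>. F w \<theta> + reg lam t h w \<theta>) (pop_iter t h)"
    unfolding pop_iter_def using t h' by (intro sp)
  have "saddle_point W \<Theta> (\<lambda>w \<theta>. F w \<theta> + reg lam (Suc t) h w \<theta>) (pop_iter (Suc t) h)"
    unfolding pop_iter_def using h by (intro sp) auto
  then have 2: "saddle_point W \<Theta> (\<lambda>w \<theta>. F w \<theta> + reg lam t h w \<theta> + (2 ^ (t + 1) * lam) * (Nw (w - fst (h t)))\<^sup>2
      - (2 ^ (t + 1) * lam) * (Nt (\<theta> - snd (h t)))\<^sup>2) (pop_iter (Suc t) h)"
    by (simp add: reg_def algebra_simps)
  show ?thesis using saddle_point_shift[OF 1 2] lam_pos by simp
qed

text \<open>
  The loss of round \<open>0\<close> is not strongly convex and its saddle point need not be unique, so the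
  radius of round \<open>0\<close> is the diameter.
\<close>

definition radius :: "nat \<Rightarrow> (nat \<Rightarrow> 'w \<times> 't) \<Rightarrow> real" where
  "radius t h = (if t = 0 then B else Nz (h t - pop_iter t h))"

lemma radius_cong: "(\<And>k. k \<le> t \<Longrightarrow> h k = h' k) \<Longrightarrow> radius t h = radius t h'"
  unfolding radius_def using pop_iter_cong[of t h h'] by simp

lemma radius_bounds:
  assumes "\<And>k. k \<le> t \<Longrightarrow> h k \<in> W \<times> \<Theta>"
  shows "0 \<le> radius t h" "radius t h \<le> B"
  using assms Nz_le_B[OF _ pop_iter_in, of "h t" t h] is_norm_nonneg[OF Nz] B_pos by (auto simp: radius_def)

text \<open>Round \<open>Suc t\<close> starts at \<open>h t\<close>, so its distance to the new
  target is bounded by a radius already under control: through \<open>pop_iter_shift\<close> for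
  positive \<open>t\<close>, through the diameter at \<open>t = 0\<close>.\<close>

lemma next_pop_iter_distance:
  assumes h: "\<And>k. k \<le> t \<Longrightarrow> h k \<in> W \<times> \<Theta>"
  shows "Nz (pop_iter (Suc t) h - h t) \<le> radius t h"
proof (cases "t = 0")
  case True
  then show ?thesis unfolding radius_def using h Nz_le_B pop_iter_in[of "Suc t" h] by auto
next
  case False
  then show ?thesis
    unfolding radius_def using pop_iter_shift[of t h] h is_norm_diff_commute[OF Nz, of "h t"] by auto
qed

text \<open>The population saddle points of rounds \<open>j\<close> and \<open>Suc j\<close> are
  joined through the iterate \<open>h j\<close>, at the cost of one radius on each side; hence the
  factor 2. The first leg, which starts at \<open>h k\<close> itself, costs a single radius.\<close>

lemma pop_iter_distance:
  assumes "k < t" "\<And>j. j < t \<Longrightarrow> h j \<in> W \<times> \<Theta>"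
  shows "Nz (pop_iter t h - h k) \<le> radius k h + 2 * (\<Sum>j\<in>{k<..<t}. radius j h)"
  using assms
proof (induction t)
  case (Suc t)
  have h: "h j \<in> W \<times> \<Theta>" if "j \<le> t" for j using Suc.prems(2) that by simp
  show ?case
  proof (cases "k = t")
    case True
    moreover have "{t<..<Suc t} = {}" by auto
    ultimately show ?thesis using next_pop_iter_distance[of t h] h by simp
  next
    case False
    then have k: "k < t" using Suc.prems(1) by simp
    have "Nz (pop_iter (Suc t) h - h k) \<le> Nz (pop_iter (Suc t) h - h t) + Nz (h t - pop_iter t h) + Nz (pop_iter t h - h k)"
      using is_norm_dist_triangle[OF Nz, of "pop_iter (Suc t) h" "h k" "h t"]
        is_norm_dist_triangle[OF Nz, of "h t" "h k" "pop_iter t h"] by linarith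
    moreover have "Nz (h t - pop_iter t h) = radius t h" using k by (simp add: radius_def)
    moreover have "Nz (pop_iter t h - h k) \<le> radius k h + 2 * (\<Sum>j\<in>{k<..<t}. radius j h)"
      using Suc.IH[OF k] h by simp
    moreover have "{k<..<Suc t} = insert t {k<..<t}" using k by auto
    ultimately show ?thesis using next_pop_iter_distance[of t h] h by simp
  qed
qed simp

text \<open>At the population saddle point the gap is controlled by
  \<open>saddle_point_regularized_gap\<close> with all regularizers at once; passing to the iterate
  costs \<open>2 * L\<close> times its radius.\<close>

lemma strong_gap_le_radii:
  assumes t: "0 < t" and h: "\<And>k. k \<le> t \<Longrightarrow> h k \<in> W \<times> \<Theta>"
  shows "strong_gap (h t) \<le> 2 * B * (\<Sum>k<t. 2 ^ (k + 1) * lam * (radius k h + 2 * (\<Sum>j\<in>{k<..<t}. radius j h)))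
    + 2 * L * radius t h"
proof (rule strong_gap_le)
  fix w \<theta> assume w: "w \<in> W" "\<theta> \<in> \<Theta>"
  let ?p = "pop_iter t h"
  have hk: "h k \<in> W \<times> \<Theta>" if "k < t" for k using h that by simp
  have p: "?p \<in> W \<times> \<Theta>" using t hk by (rule pop_iter_in)
  have "saddle_point W \<Theta> (\<lambda>w \<theta>. F w \<theta> + reg lam t h w \<theta>) ?p"
    unfolding pop_iter_def using t hk
    by (intro saddle_point_pop_saddle[OF sc_sc_reg' lipschitz_fun_reg' modulus_pos])
  then have "F (fst ?p) \<theta> - F w (snd ?p) \<le> 2 * B * (\<Sum>k\<in>{..<t}. 2 ^ (k + 1) * lam * Nz (?p - h k))"
    using saddle_point_regularized_gap[of F "{..<t}" "\<lambda>k. 2 ^ (k + 1) * lam" h ?p B "(w, \<theta>)"]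
      convex_on_population_risk concave_on_population_risk lam_pos diam w
    unfolding reg_def by simp
  also have "\<dots> \<le> 2 * B * (\<Sum>k<t. 2 ^ (k + 1) * lam * (radius k h + 2 * (\<Sum>j\<in>{k<..<t}. radius j h)))"
    using B_pos lam_pos hk by (intro mult_left_mono sum_mono pop_iter_distance) auto
  finally show "F (fst (h t)) \<theta> - F w (snd (h t))
      \<le> 2 * B * (\<Sum>k<t. 2 ^ (k + 1) * lam * (radius k h + 2 * (\<Sum>j\<in>{k<..<t}. radius j h))) + 2 * L * radius t h"
    using population_gap_lipschitz[OF h[OF order_refl] p w] t by (simp add: radius_def)
qed

lemma measurable_history_component: "k \<le> t \<Longrightarrow> (\<lambda>h. h k) \<in> histories t \<rightarrow>\<^sub>M points"
  by (rule measurable_component_singleton) simp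

lemma borel_measurable_history_component: "k \<le> t \<Longrightarrow> (\<lambda>h. h k) \<in> borel_measurable (histories t)"
  using measurable_compose[OF measurable_history_component measurable_point_space_borel] by simp

lemma measurable_reg:
  assumes "j \<le> Suc t"
  shows "(\<lambda>h. reg lam j h w \<theta>) \<in> borel_measurable (histories t)"
proof -
  have "(\<lambda>z. Nw (w - fst z)) \<in> borel_measurable borel" "(\<lambda>z. Nt (\<theta> - snd z)) \<in> borel_measurable borel"
    by (auto intro!: borel_measurable_continuous_onI continuous_on_compose2[OF continuous_on_is_norm[OF Nw, of UNIV]]
        continuous_on_compose2[OF continuous_on_is_norm[OF Nt, of UNIV]] continuous_intros)
  note comp = measurable_compose[OF borel_measurable_history_component this(1)]
    measurable_compose[OF borel_measurable_history_component this(2)]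
  show ?thesis
    unfolding reg_def using assms
    by (intro borel_measurable_sum borel_measurable_times borel_measurable_diff borel_measurable_power
        borel_measurable_const comp) auto
qed

lemma measurable_pop_iter:
  assumes j: "0 < j" "j \<le> Suc t"
  shows "pop_iter j \<in> borel_measurable (histories t)"
proof -
  have hk: "h k \<in> W \<times> \<Theta>" if "h \<in> space (histories t)" "k < j" for h k
    using history_in[OF that(1), of k] that(2) j(2) by simp
  have "(\<lambda>h. saddle (\<lambda>w \<theta>. F w \<theta> + reg lam j h w \<theta>)) \<in> borel_measurable (histories t)"
  proof (rule measurable_saddle)
    show "(\<lambda>h. F w \<theta> + reg lam j h w \<theta>) \<in> borel_measurable (histories t)" for w \<theta>
      using measurable_reg[OF j(2)] by simp
    show "lipschitz_fun (L + 2 * B * lam * (2 ^ (j + 1) - 2)) (\<lambda>w \<theta>. F w \<theta> + reg lam j h w \<theta>)"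
      if "h \<in> space (histories t)" for h
      using hk[OF that] by (intro lipschitz_fun_add lipschitz_fun_population_risk lipschitz_fun_reg')
    show "sc_sc (modulus j) (\<lambda>w \<theta>. F w \<theta> + reg lam j h w \<theta>)" if "h \<in> space (histories t)" for h
      using hk[OF that] j(1) by (intro sc_sc_pop[OF sc_sc_reg' lipschitz_fun_reg' modulus_pos])
    show "0 < modulus j" by (rule modulus_pos[OF j(1)])
  qed
  then show ?thesis unfolding pop_iter_def[abs_def] pop_saddle_def .
qed

lemma measurable_radius: "j \<le> t \<Longrightarrow> radius j \<in> borel_measurable (histories t)"
proof (cases "j = 0")
  case True
  then show ?thesis by (simp add: radius_def[abs_def])
next
  case False
  assume "j \<le> t"
  then have "(\<lambda>h. Nz (h j - pop_iter j h)) \<in> borel_measurable (histories t)"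
    using False measurable_pop_iter[of j t] borel_measurable_history_component[of j t]
    by (intro measurable_compose[OF _ measurable_Nz] borel_measurable_diff) auto
  then show ?thesis using False by (simp add: radius_def[abs_def])
qed

lemma integrable_radius:
  assumes M: "M \<in> space (prob_algebra (histories t))" and j: "j \<le> t"
  shows "integrable M (radius j)"
proof (rule prob_space_integrable_bounded[where C = B])
  have s: "sets M = sets (histories t)" using M by (simp add: space_prob_algebra)
  show "prob_space M" using M by (simp add: space_prob_algebra)
  show "radius j \<in> borel_measurable M" using measurable_radius[OF j] s measurable_cong_sets by blast
  fix h assume "h \<in> space M"
  then have "h \<in> space (histories t)" using sets_eq_imp_space_eq[OF s] by simp
  then show "\<bar>radius j h\<bar> \<le> B" using radius_bounds[of j h] history_in[of h t] j by auto
qed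

end

section \<open>Expected radii and the expected gap\<close>

context ssp_run
begin

lemma integral_extend:
  fixes g :: "(nat \<Rightarrow> 'w \<times> 't) \<Rightarrow> real"
  assumes h: "h \<in> space (histories t)" and M: "sets M = sets points"
    and g: "g \<in> borel_measurable (histories (Suc t))"
  shows "integral\<^sup>L (extend t h M) g = (\<integral>z. g (h(Suc t := z)) \<partial>M)"
  unfolding extend_def
  using measurable_extend1[OF h] measurable_cong_sets[OF M refl, of "histories (Suc t)"]
  by (intro integral_distr[OF _ g]) auto

lemma sets_round_law:
  assumes "t < T" "h \<in> space (histories t)"
  shows "prob_space (samples m \<bind> round t h)" "sets (samples m \<bind> round t h) = sets points"
proof -
  have "samples m \<in> space (prob_algebra (samples m))" using prob_samples by (simp add: space_prob_algebra)
  then show "prob_space (samples m \<bind> round t h)" "sets (samples m \<bind> round t h) = sets points"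
    using prob_space_bind'[OF _ measurable_round_sample[OF assms]] sets_bind'[OF _ measurable_round_sample[OF assms]]
    by auto
qed

text \<open>An extension leaves the radii of earlier rounds unchanged, so only
  \<open>j = Suc t\<close> needs an estimate. There \<open>round_distance_pop_iter\<close> gives a
  recursion that is affine in the previous radius and can therefore be averaged.\<close>

lemma expected_radius:
  "t \<le> T \<Longrightarrow> j \<le> t \<Longrightarrow> integral\<^sup>L (fresh_history t) (radius j) \<le> B / 2 ^ j"
proof (induction t arbitrary: j)
  case 0
  interpret prob_space "fresh_history 0"
    using fresh_history_prob[of 0] by (simp add: space_prob_algebra)
  show ?case using 0 by (simp add: radius_def[abs_def] prob_space del: fresh_history.simps)
next
  case (Suc t)
  then have t: "t < T" "t \<le> T" by auto
  note M = fresh_history_prob[OF t(2)]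
  then have Mp: "prob_space (fresh_history t)" and Ms: "sets (fresh_history t) = sets (histories t)"
    by (auto simp: space_prob_algebra)
  interpret M: prob_space "fresh_history t" by (rule Mp)
  note sp = sets_eq_imp_space_eq[OF Ms]
  have step: "(\<lambda>h. extend t h (samples m \<bind> round t h)) \<in> fresh_history t \<rightarrow>\<^sub>M prob_algebra (histories (Suc t))"
    using measurable_fresh_step[OF t(1)] measurable_cong_sets[OF Ms refl] by blast
  note radm = measurable_radius[OF Suc.prems(2)]
  have rad_bound: "\<bar>radius j h\<bar> \<le> B" if "h \<in> space (histories (Suc t))" for h
    using radius_bounds[of j h] history_in[OF that] Suc.prems(2) by auto
  show ?case
  proof (cases "j = Suc t")
    case False
    then have j: "j \<le> t" using Suc.prems by simp
    have "integral\<^sup>L (fresh_history (Suc t)) (radius j) \<le> integral\<^sup>L (fresh_history t) (radius j)"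
      unfolding fresh_history.simps
    proof (rule integral_bind_le[OF Mp step radm rad_bound integrable_radius[OF M j]])
      fix h assume "h \<in> space (fresh_history t)"
      then have h: "h \<in> space (histories t)" by (simp add: sp)
      note rl = sets_round_law[OF t(1) h]
      interpret rl: prob_space "samples m \<bind> round t h" by (rule rl(1))
      have "radius j (h(Suc t := z)) = radius j h" for z using j by (intro radius_cong) auto
      then show "integral\<^sup>L (extend t h (samples m \<bind> round t h)) (radius j) \<le> radius j h"
        unfolding integral_extend[OF h rl(2) radm] by (simp add: rl.prob_space)
    qed
    also have "\<dots> \<le> B / 2 ^ j" by (rule Suc.IH[OF t(2) j])
    finally show ?thesis .
  next
    case True
    let ?b = "B / 2 ^ Suc t"
    have "integral\<^sup>L (fresh_history (Suc t)) (radius j)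
        \<le> integral\<^sup>L (fresh_history t) (\<lambda>h. (?b + radius t h) / 24 + 3 / 4 * ?b)"
      unfolding fresh_history.simps
    proof (rule integral_bind_le[OF Mp step radm rad_bound])
      show "integrable (fresh_history t) (\<lambda>h. (?b + radius t h) / 24 + 3 / 4 * ?b)"
        using integrable_radius[OF M order_refl] by simp
      fix h assume "h \<in> space (fresh_history t)"
      then have h: "h \<in> space (histories t)" by (simp add: sp)
      note rl = sets_round_law[OF t(1) h]
      have "pop_iter (Suc t) (h(Suc t := z)) = pop_iter (Suc t) h" for z by (intro pop_iter_cong) auto
      then have "integral\<^sup>L (extend t h (samples m \<bind> round t h)) (radius j)
          = (\<integral>z. Nz (z - pop_iter (Suc t) h) \<partial>(samples m \<bind> round t h))"
        unfolding integral_extend[OF h rl(2) radm] by (simp add: True radius_def)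
      also have "\<dots> \<le> (?b + Nz (h t - pop_iter (Suc t) h)) / 24 + 3 / 4 * ?b"
        by (rule round_distance_pop_iter[OF t(1) h])
      also have "\<dots> \<le> (?b + radius t h) / 24 + 3 / 4 * ?b"
        using next_pop_iter_distance[of t h] history_in[OF h] is_norm_diff_commute[OF Nz, of "h t"] by simp
      finally show "integral\<^sup>L (extend t h (samples m \<bind> round t h)) (radius j) \<le> (?b + radius t h) / 24 + 3 / 4 * ?b" .
    qed
    also have "\<dots> = (?b + integral\<^sup>L (fresh_history t) (radius t)) / 24 + 3 / 4 * ?b"
      using integrable_radius[OF M order_refl] by (simp add: M.prob_space add_divide_distrib)
    also have "\<dots> \<le> (?b + B / 2 ^ t) / 24 + 3 / 4 * ?b"
      by (intro add_mono divide_right_mono Suc.IH[OF t(2) order_refl]) auto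
    \<comment> \<open>\<open>B / 2 ^ t\<close> equals \<open>2 * ?b\<close>, so the left side is
      \<open>3 / 24 * ?b + 3 / 4 * ?b = 7 / 8 * ?b\<close>.\<close>
    also have "\<dots> \<le> ?b" using B_pos by (simp add: field_simps)
    finally show ?thesis using True by simp
  qed
qed

text \<open>A weight \<open>2 ^ (k + 1) * lam\<close> meets an expected distance of at most
  \<open>3 * B / 2 ^ k\<close>, which after multiplication by \<open>2 * B\<close> gives
  \<open>12 * T\<close> in total; the last radius contributes 4 through \<open>T_gt\<close>. For
  positive \<open>T\<close> this is at most \<open>16 * T + 2\<close>, and the summand 2 is the
  whole bound when \<open>T = 0\<close>.\<close>

lemma expected_strong_gap_fresh:
  "(\<integral>h. strong_gap (h T) \<partial>fresh_history T) \<le> (16 * real T + 2) * (lam * B\<^sup>2)"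
proof -
  note M = fresh_history_prob[OF order_refl]
  then have Mp: "prob_space (fresh_history T)" and Ms: "sets (fresh_history T) = sets (histories T)"
    by (auto simp: space_prob_algebra)
  interpret M: prob_space "fresh_history T" by (rule Mp)
  note sp = sets_eq_imp_space_eq[OF Ms]
  have h_in: "h k \<in> W \<times> \<Theta>" if "h \<in> space (fresh_history T)" "k \<le> T" for h k
    using history_in that sp by blast
  have int: "integrable (fresh_history T) (\<lambda>h. strong_gap (h T))"
  proof (rule prob_space_integrable_bounded[OF Mp])
    have "(\<lambda>h. strong_gap (h T)) \<in> borel_measurable (histories T)"
      by (rule measurable_compose[OF measurable_history_component[OF order_refl] measurable_strong_gap])
    then show "(\<lambda>h. strong_gap (h T)) \<in> borel_measurable (fresh_history T)"
      using Ms measurable_cong_sets by blast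
    show "\<bar>strong_gap (h T)\<bar> \<le> L * B" if "h \<in> space (fresh_history T)" for h
      using strong_gap_bounds[OF h_in[OF that order_refl]] by simp
  qed
  show ?thesis
  proof (cases "T = 0")
    case True
    \<comment> \<open>Without any round \<open>T_gt\<close> reads
      \<open>L \<le> 2 * (lam * B)\<close>, so the trivial bound \<open>L * B\<close> is good
      enough.\<close>
    have "(\<integral>h. strong_gap (h T) \<partial>fresh_history T) \<le> L * B"
      using strong_gap_bounds[OF h_in] by (intro prob_space_integral_le[OF Mp int]) auto
    also have "\<dots> \<le> 2 * (lam * B) * B"
      using T_gt True B_pos by (intro mult_right_mono) auto
    finally show ?thesis using True by (simp add: power2_eq_square)
  next
    case False
    let ?E = "\<lambda>j. integral\<^sup>L (fresh_history T) (radius j)"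
    note irad = integrable_radius[OF M]
    have irad2: "integrable (fresh_history T) (\<lambda>h. radius k h + 2 * (\<Sum>j\<in>{k<..<T}. radius j h))" if "k < T" for k
      using irad that by (intro Bochner_Integration.integrable_add integrable_mult_right Bochner_Integration.integrable_sum) auto
    have "(\<integral>h. strong_gap (h T) \<partial>fresh_history T)
        \<le> (\<integral>h. 2 * B * (\<Sum>k<T. 2 ^ (k + 1) * lam * (radius k h + 2 * (\<Sum>j\<in>{k<..<T}. radius j h)))
              + 2 * L * radius T h \<partial>fresh_history T)"
      using int irad irad2 False strong_gap_le_radii[of T] h_in
      by (intro integral_mono Bochner_Integration.integrable_add integrable_mult_right Bochner_Integration.integrable_sum) auto
    also have "\<dots> = 2 * B * (\<Sum>k<T. 2 ^ (k + 1) * lam * (?E k + 2 * (\<Sum>j\<in>{k<..<T}. ?E j))) + 2 * L * ?E T"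
    proof -
      have "(\<integral>h. radius k h + 2 * (\<Sum>j\<in>{k<..<T}. radius j h) \<partial>fresh_history T) = ?E k + 2 * (\<Sum>j\<in>{k<..<T}. ?E j)"
        if "k < T" for k
        using that irad by (subst Bochner_Integration.integral_add)
          (auto simp: Bochner_Integration.integral_sum intro!: Bochner_Integration.integrable_sum)
      then show ?thesis
        using irad irad2
        by (subst Bochner_Integration.integral_add)
          (auto simp: Bochner_Integration.integral_sum intro!: Bochner_Integration.integrable_sum)
    qed
    also have "\<dots> \<le> 2 * B * (\<Sum>k<T. 2 ^ (k + 1) * lam * (3 * (B / 2 ^ k))) + 2 * L * (B / 2 ^ T)"
    proof (intro add_mono mult_left_mono sum_mono)
      fix k assume "k \<in> {..<T}"
      then have k: "k < T" by simp
      have "(\<Sum>j\<in>{k<..<T}. ?E j) \<le> (\<Sum>j\<in>{k<..<T}. B * (1 / 2 ^ j))"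
        using expected_radius[of T] by (intro sum_mono) auto
      also have "\<dots> \<le> B * (1 / 2 ^ k)"
        unfolding sum_distrib_left[symmetric] using B_pos
        by (intro mult_left_mono sum_inverse_powers_of_two) auto
      finally show "?E k + 2 * (\<Sum>j\<in>{k<..<T}. ?E j) \<le> 3 * (B / 2 ^ k)"
        using expected_radius[of T k] k by simp
    qed (use expected_radius[of T T] B_pos lam_pos L in auto)
    also have "2 * B * (\<Sum>k<T. 2 ^ (k + 1) * lam * (3 * (B / 2 ^ k))) = 12 * real T * (lam * B\<^sup>2)"
      by (simp add: power2_eq_square)
    also have "2 * L * (B / 2 ^ T) \<le> 2 * (2 ^ (T + 1) * (lam * B)) * (B / 2 ^ T)"
      using T_gt B_pos by (intro mult_right_mono mult_left_mono) auto
    also have "\<dots> = 4 * (lam * B\<^sup>2)" by (simp add: power2_eq_square)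
    also have "12 * real T * (lam * B\<^sup>2) + 4 * (lam * B\<^sup>2) = (12 * real T + 4) * (lam * B\<^sup>2)"
      by (simp add: algebra_simps)
    also have "\<dots> \<le> (16 * real T + 2) * (lam * B\<^sup>2)"
      using False lam_pos by (intro mult_right_mono) auto
    finally show ?thesis by simp
  qed
qed

text \<open>The output is the last coordinate of the history, so \<open>history_law\<close>
  transfers the bound from independent samples to the actual run.\<close>

lemma Gap_SP_R_SSP:
  "Gap_SP W \<Theta> D n f (R_SSP Nw Nt W \<Theta> B lam m T idx A z0 f) \<le> (16 * real T + 2) * (lam * B\<^sup>2)"
proof -
  let ?P = "Pi\<^sub>M {..<n} (\<lambda>_. D)"
  let ?last = "\<lambda>h. return points (h T)"
  have last: "?last \<in> histories T \<rightarrow>\<^sub>M prob_algebra points"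
    by (rule measurable_compose[OF measurable_history_component[OF order_refl] measurable_return_prob_space])
  have hist: "history T \<in> ?P \<rightarrow>\<^sub>M prob_algebra (histories T)"
    by (rule measurable_history[OF order_refl used_subset[OF order_refl]])
  have "?P \<bind> R_SSP Nw Nt W \<Theta> B lam m T idx A z0 f = ?P \<bind> (\<lambda>S. history T S \<bind> ?last)"
    by (simp add: R_SSP_def[abs_def])
  also have "\<dots> = (?P \<bind> history T) \<bind> ?last"
    by (rule bind_assoc[OF measurable_prob_algebraD[OF hist] measurable_prob_algebraD[OF last], symmetric])
  also have "\<dots> = fresh_history T \<bind> ?last" unfolding history_law ..
  finally have law: "?P \<bind> R_SSP Nw Nt W \<Theta> B lam m T idx A z0 f = fresh_history T \<bind> ?last" .
  note M = fresh_history_prob[OF order_refl]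
  then have Mp: "prob_space (fresh_history T)" and Ms: "sets (fresh_history T) = sets (histories T)"
    by (auto simp: space_prob_algebra)
  note sp = sets_eq_imp_space_eq[OF Ms]
  have last': "?last \<in> fresh_history T \<rightarrow>\<^sub>M prob_algebra points"
    using last measurable_cong_sets[OF Ms refl] by blast
  have "Gap_SP W \<Theta> D n f (R_SSP Nw Nt W \<Theta> B lam m T idx A z0 f) = integral\<^sup>L (fresh_history T \<bind> ?last) strong_gap"
    unfolding Gap_SP_def law strong_gap_def ..
  also have "\<dots> = (\<integral>h. integral\<^sup>L (?last h) strong_gap \<partial>fresh_history T)"
    using strong_gap_bounds by (intro integral_bind_prob(1)[OF Mp last' measurable_strong_gap, where C = "L * B"]) simp
  also have "\<dots> = (\<integral>h. strong_gap (h T) \<partial>fresh_history T)"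
    using history_in measurable_strong_gap
    by (intro Bochner_Integration.integral_cong refl integral_return) (auto simp: sp)
  also have "\<dots> \<le> (16 * real T + 2) * (lam * B\<^sup>2)" by (rule expected_strong_gap_fresh)
  finally show ?thesis .
qed

end

section \<open>From the gap bound to the rate\<close>

lemma powr_three_halves_power2: "0 < x \<Longrightarrow> (x powr (3 / 2))\<^sup>2 = (x::real) ^ 3"
proof -
  assume x: "0 < x"
  have "(x powr (3 / 2))\<^sup>2 = x powr (3 / 2 * 2)" unfolding powr_powr[symmetric] using x by simp
  also have "\<dots> = x ^ 3" using x by simp
  finally show ?thesis .
qed

lemma powr_three_halves: "0 < x \<Longrightarrow> x powr (3 / 2) = (x::real) * sqrt x"
proof -
  assume x: "0 < x"
  have "x powr (3 / 2) = x powr (1 + 1 / 2)" by simp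
  also have "\<dots> = x powr 1 * x powr (1 / 2)" by (rule powr_add)
  finally show ?thesis using x by (simp add: powr_half_sqrt)
qed

text \<open>The constant 4 is a factor 2 lost when a number of at least 1 is rounded down, times a
  factor 2 from \<open>ln 2 \<ge> 1 / 2\<close> in the change of base.\<close>

lemma batch_size_bounds:
  fixes n n' :: nat
  assumes n: "2 \<le> n" and n': "n' = nat \<lfloor>real n / log 2 (real n)\<rfloor>"
  shows "0 < n'" "n' \<le> n" "real n \<le> 4 * ln n * real n'"
proof -
  define x where "x = real n / log 2 (real n)"
  have ln2: "2 / 3 \<le> ln (2::real)" by (rule ln2_ge_two_thirds)
  have ln_n: "ln 2 \<le> ln (real n)" using n by simp
  \<comment> \<open>\<open>n \<le> 2 ^ n\<close> yields \<open>log 2 n \<le> n\<close>, so the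
    quotient \<open>x\<close> is at least 1 and does not round to 0.\<close>
  have "ln (real n) \<le> ln (2 ^ n)"
    using n less_imp_le[OF of_nat_less_two_power[of n, where 'a = real]] by (subst ln_le_cancel_iff) auto
  then have "ln (real n) \<le> real n * ln 2" by (simp add: ln_realpow)
  then have x1: "1 \<le> x" using ln2 ln_n by (simp add: x_def log_def field_simps)
  then have fl: "1 \<le> \<lfloor>x\<rfloor>" by simp
  have n'_fl: "real n' = of_int \<lfloor>x\<rfloor>" using fl unfolding n' x_def by simp
  show "0 < n'" using fl unfolding n' x_def by simp
  have "1 \<le> log 2 (real n)" using ln_n ln2 by (simp add: log_def)
  then have "x \<le> real n" unfolding x_def using n by (simp add: field_simps)
  then have "real n' \<le> real n" unfolding n'_fl by linarith
  then show "n' \<le> n" by simp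
  have "(1::real) \<le> of_int \<lfloor>x\<rfloor>" using fl by simp
  then have "x \<le> 2 * real n'" unfolding n'_fl by linarith
  then have "real n * ln 2 \<le> 2 * real n' * ln (real n)"
    using ln2 ln_n by (simp add: x_def log_def field_simps)
  moreover have "real n * (1 / 2) \<le> real n * ln 2" using ln2 by (intro mult_left_mono) auto
  ultimately show "real n \<le> 4 * ln n * real n'" by (simp add: algebra_simps)
qed

text \<open>Replacing \<open>n'\<close> by \<open>n\<close> costs a factor
  \<open>2 * sqrt (ln n)\<close>; with the logarithm from the number of rounds this makes the
  exponent 3/2. Since \<open>ln n \<ge> 1 / 2\<close>, the factor \<open>16 * T + 2\<close> is at
  most \<open>36 * ln n\<close>, and the resulting constants \<open>36 * 48\<close> and
  \<open>2 * 36 * 48\<close> lie below 100000.\<close>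

lemma rate_bound:
  fixes B L \<alpha> \<kappa> lam T :: real and n n' :: nat
  assumes pos: "0 < L" "0 < B" "0 < \<kappa>" "0 \<le> \<alpha>" and n: "2 \<le> n"
    and n': "0 < n'" "real n \<le> 4 * ln n * real n'" and T: "T \<le> 2 * ln n"
    and lam: "lam = 48 / B * (\<alpha> * \<kappa>\<^sup>2 + L * \<kappa> powr (3 / 2) / sqrt (real n'))"
  shows "(16 * T + 2) * (lam * B\<^sup>2) \<le> 100000 * (B * \<alpha> * \<kappa>\<^sup>2 * ln (real n)
      + B * L * \<kappa> powr (3 / 2) * ln (real n) powr (3 / 2) / sqrt (real n))"
proof -
  define l where "l = ln (real n)"
  define k where "k = \<kappa> powr (3 / 2)"
  have "2 / 3 \<le> ln (2::real)" "ln 2 \<le> ln (real n)" using ln2_ge_two_thirds n by simp_all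
  then have l: "1 / 2 \<le> l" by (simp add: l_def)
  have k: "0 < k" using pos by (simp add: k_def)
  have "sqrt (real n) \<le> sqrt (4 * l * real n')" using n'(2) by (simp add: l_def)
  also have "\<dots> = 2 * sqrt l * sqrt (real n')" by (simp add: real_sqrt_mult)
  finally have "1 / sqrt (real n') \<le> 2 * sqrt l / sqrt (real n)"
    using n' n by (simp add: field_simps)
  then have "(L * k) * (1 / sqrt (real n')) \<le> (L * k) * (2 * sqrt l / sqrt (real n))"
    using pos k by (intro mult_left_mono) auto
  then have sqrt_bound: "L * k / sqrt (real n') \<le> 2 * (L * k * sqrt l / sqrt (real n))"
    by (simp add: mult_ac)
  define q where "q = L * k * sqrt l / sqrt (real n)"
  have q: "0 \<le> q" using pos k l by (simp add: q_def)
  have ak: "0 \<le> \<alpha> * \<kappa>\<^sup>2" using pos by simp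
  have "lam * B\<^sup>2 = 48 * B * (\<alpha> * \<kappa>\<^sup>2 + L * k / sqrt (real n'))"
    using pos by (simp add: lam k_def power2_eq_square)
  also have "\<dots> \<le> 48 * B * (\<alpha> * \<kappa>\<^sup>2 + 2 * q)"
    using sqrt_bound pos by (intro mult_left_mono add_left_mono) (auto simp: q_def)
  finally have lamB: "lam * B\<^sup>2 \<le> 48 * B * (\<alpha> * \<kappa>\<^sup>2 + 2 * q)" .
  have lamB0: "0 \<le> lam * B\<^sup>2" using pos by (simp add: lam)
  have "(16 * T + 2) * (lam * B\<^sup>2) \<le> (36 * l) * (lam * B\<^sup>2)"
    using T l lamB0 by (intro mult_right_mono) (auto simp: l_def)
  also have "\<dots> \<le> (36 * l) * (48 * B * (\<alpha> * \<kappa>\<^sup>2 + 2 * q))"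
    using l by (intro mult_left_mono lamB) simp
  also have "\<dots> = 1728 * (l * B * (\<alpha> * \<kappa>\<^sup>2)) + 3456 * (l * B * q)"
    by (simp add: algebra_simps)
  also have "\<dots> \<le> 100000 * (l * B * (\<alpha> * \<kappa>\<^sup>2)) + 100000 * (l * B * q)"
    using l q ak pos by (intro add_mono mult_right_mono mult_nonneg_nonneg) auto
  also have "\<dots> = 100000 * (B * \<alpha> * \<kappa>\<^sup>2 * l + B * L * k * l powr (3 / 2) / sqrt (real n))"
    using l by (simp add: powr_three_halves q_def algebra_simps)
  finally show ?thesis by (simp add: l_def k_def)
qed

theorem theorem1:
  fixes W :: "'w::euclidean_space set" and \<Theta> :: "'t::euclidean_space set"
    and D :: "'x measure"
    and Nw :: "'w \<Rightarrow> real" and Nt :: "'t \<Rightarrow> real"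
    and f :: "'w \<Rightarrow> 't \<Rightarrow> 'x \<Rightarrow> real"
    and L B \<kappa> \<alpha> lam :: real and n n' T :: nat
    and z0 :: "'w \<times> 't" and idx :: "nat \<Rightarrow> nat \<Rightarrow> nat"
    and A_emp :: "('w, 't, 'x) subroutine"
  assumes D: "prob_space D"
    and W: "compact W" "convex W" and Th: "compact \<Theta>" "convex \<Theta>"
    and norms: "is_norm Nw" "is_norm Nt"
    and cc: "convex_concave W \<Theta> (space D) f"
    and lip: "lipschitz_loss Nw Nt W \<Theta> (space D) L f"
    and int: "\<forall>w\<in>W. \<forall>\<theta>\<in>\<Theta>. integrable D (f w \<theta>)"
    and diam: "norm_diameter (pair_norm Nw Nt) (W \<times> \<Theta>) = B"
    and sc: "strongly_convex (1 / \<kappa>) Nw (\<lambda>w. (Nw w)\<^sup>2)"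
            "strongly_convex (1 / \<kappa>) Nt (\<lambda>\<theta>. (Nt \<theta>)\<^sup>2)"
    and params: "0 < L" "0 < B" "0 < \<kappa>" "0 \<le> \<alpha>" "2 \<le> n"
    and n': "n' = nat \<lfloor>real n / log 2 (real n)\<rfloor>"
    and lam: "lam = 48 / B * (\<alpha> * \<kappa>\<^sup>2 + L * \<kappa> powr (3 / 2) / sqrt (real n'))"
    and T: "T = nat \<lfloor>log 2 (L / (B * lam))\<rfloor>"
    and z0: "z0 \<in> W \<times> \<Theta>"
    and idx: "inj_on (\<lambda>(t, i). idx t i) ({1..T} \<times> {..<n'})"
             "\<forall>t\<in>{1..T}. \<forall>i<n'. idx t i < n"
    and sub: "randomized_subroutine W \<Theta> (space D) n' A_emp"
    and meas: "measurable_rounds Nw Nt W \<Theta> D B lam n' T A_emp f"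
    and acc: "\<And>f' S'. convex_concave W \<Theta> (space D) f' \<Longrightarrow>
                lipschitz_loss Nw Nt W \<Theta> (space D) (5 * L) f' \<Longrightarrow>
                S' \<in> {..<n'} \<rightarrow>\<^sub>E space D \<Longrightarrow>
                relative_accuracy Nw Nt W \<Theta> n' A_emp \<alpha> S' f'"
  shows "Gap_SP W \<Theta> D n f (R_SSP Nw Nt W \<Theta> B lam n' T idx A_emp z0 f)
           \<le> 100000 * (B * \<alpha> * \<kappa>\<^sup>2 * ln (real n)
                + B * L * \<kappa> powr (3 / 2) * ln (real n) powr (3 / 2) / sqrt (real n))"
proof -
  have ne: "W \<noteq> {}" "\<Theta> \<noteq> {}" using z0 by auto
  have half: "1 / 2 \<le> \<kappa>"
    by (rule strongly_convex_kappa_ge_half[OF norms(1) sc(1) params(3)])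
  note n'_bounds = batch_size_bounds[OF params(5) n']
  define k where "k = \<kappa> powr (3 / 2)"
  have k: "0 < k" using params by (simp add: k_def)
  define r where "r = L * k / sqrt (real n')"
  have r: "0 < r" using params k n'_bounds(1) by (simp add: r_def)
  have lamB: "lam * B = 48 * (\<alpha> * \<kappa>\<^sup>2 + r)" using params by (simp add: lam r_def k_def)
  have ak: "0 \<le> \<alpha> * \<kappa>\<^sup>2" using params by simp
  have lamB_pos: "0 < lam * B" unfolding lamB using ak r by simp
  have lam_pos: "0 < lam" using lamB_pos params(2) by (simp add: zero_less_mult_iff)
  define x where "x = L / (B * lam)"
  have x: "0 < x" "x * (lam * B) = L" using params lam_pos by (simp_all add: x_def)
  \<comment> \<open>\<open>nat\<close> truncates a negative floor to 0, so
    \<open>2 ^ T \<le> x\<close> is claimed for positive \<open>T\<close> only; the bound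
    \<open>x \<le> 2 ^ (T + 1)\<close> survives the truncation.\<close>
  have pow_T: "2 ^ T \<le> x" if "0 < T"
  proof -
    have "real T \<le> log 2 x" using that unfolding T x_def[symmetric] by linarith
    then have "2 powr real T \<le> x" using x(1) by (simp add: le_log_iff)
    then show ?thesis by (simp add: powr_realpow)
  qed
  have "x \<le> 2 ^ (T + 1)"
  proof -
    have "log 2 x \<le> real (T + 1)" unfolding T x_def[symmetric] by linarith
    then have "x \<le> 2 powr real (T + 1)" using x(1) by (simp add: log_le_iff)
    then show ?thesis by (simp only: powr_realpow)
  qed
  then have T_gt: "L \<le> 2 ^ (T + 1) * (lam * B)"
    using mult_right_mono[of x "2 ^ (T + 1)" "lam * B"] x(2) lamB_pos by simp
  interpret ssp_run W \<Theta> Nw Nt D f L B \<kappa> \<alpha> lam n' T A_emp n z0 idx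
  proof (intro ssp_run.intro ssp.intro stochastic_saddle.intro saddle_domain.intro
      ssp_run_axioms.intro ssp_axioms.intro stochastic_saddle_axioms.intro)
    show "48 * \<alpha> * \<kappa>\<^sup>2 \<le> lam * B" unfolding lamB using r by simp
    \<comment> \<open>2304 is the square of 48, and \<open>k\<close> squared is the cube of
      \<open>\<kappa>\<close>.\<close>
    have "2304 * L\<^sup>2 * \<kappa> ^ 3 = (48 * r)\<^sup>2 * n'"
      using n'_bounds(1) powr_three_halves_power2[OF params(3)]
      by (simp add: r_def k_def power_mult_distrib power_divide)
    also have "\<dots> \<le> (lam * B)\<^sup>2 * n'"
      unfolding lamB using ak r by (intro mult_right_mono power_mono) auto
    finally show "2304 * L\<^sup>2 * \<kappa> ^ 3 \<le> (lam * B)\<^sup>2 * n'" .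
    show "2 ^ T * (lam * B) \<le> L" if "0 < T"
      using mult_right_mono[OF pow_T[OF that], of "lam * B"] x(2) lamB_pos by simp
    show "integrable D (f w \<theta>)" if "w \<in> W" "\<theta> \<in> \<Theta>" for w \<theta> using int that by blast
    show "idx t i < n" if "t \<in> {1..T}" "i < n'" for t i using idx(2) that by blast
  qed (fact D W Th ne norms cc lip diam sc params lam_pos n'_bounds(1) sub meas acc z0 idx(1) T_gt)+
  \<comment> \<open>The second summand of \<open>lam\<close> bounds \<open>x\<close> by
    \<open>sqrt n' / (48 * k)\<close>. As \<open>\<kappa> \<ge> 1 / 2\<close> gives
    \<open>k \<ge> 1 / 4\<close>, this is at most \<open>n\<close>, so \<open>2 ^ T \<le> n\<close>;
    \<open>ln 2 \<ge> 1 / 2\<close> accounts for the factor 2.\<close>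
  have "real T \<le> 2 * ln n"
  proof (cases "T = 0")
    case False
    have "(1 / 2) powr 2 \<le> (1 / 2) powr (3 / 2 :: real)" by (rule powr_mono') auto
    also have "\<dots> \<le> k" unfolding k_def using half by (intro powr_mono2) auto
    finally have k4: "1 / 4 \<le> k" by (simp add: power_divide)
    have "2 ^ T \<le> x" using pow_T False by simp
    also have "x \<le> L / (48 * r)"
    proof -
      have "48 * r \<le> B * lam" using lamB ak by (simp add: mult.commute)
      then show ?thesis unfolding x_def using r params(1) by (intro frac_le) auto
    qed
    also have "\<dots> = sqrt n' / (48 * k)" using params(1) by (simp add: r_def)
    also have "\<dots> \<le> sqrt n' / 1" using k4 by (intro frac_le) auto
    also have "\<dots> = sqrt n'" by simp
    also have "\<dots> \<le> real n'" using n'_bounds(1) by (intro real_le_lsqrt self_le_power) auto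
    also have "\<dots> \<le> real n" using n'_bounds(2) by simp
    finally have "ln (2 ^ T) \<le> ln (real n)" using params(5) by (subst ln_le_cancel_iff) auto
    then have "real T * ln 2 \<le> ln n" by (simp add: ln_realpow)
    moreover have "real T * (1 / 2) \<le> real T * ln 2"
      using ln2_ge_two_thirds by (intro mult_left_mono) auto
    ultimately show ?thesis by simp
  qed (use params(5) in simp)
  from rate_bound[OF params n'_bounds(1,3) this lam] Gap_SP_R_SSP
  show ?thesis by linarith
qed

end
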